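(* The bicategory $\mathcal Q\mathrm{uant}$ of unital quantales, modules and module homomorphisms is a cyclic $*$-autonomous bicategory.
   Context: $\mathcal Q\mathrm{uant}$: 0-cells are unital quantales (complete lattices with an associative, unital multiplication $\otimes$, unit $\top$, preserving suprema in each variable). A 1-cell $Q\nrightarrow R$ is a $(Q,R)$-module: a suplattice $A$ with actions $\star\colon Q\times A\to A$ and $\cdot\colon A\times R\to A$, each preserving suprema in each variable, such that $(q\otimes q')\star a=q\star(q'\star a)$, $a\cdot(r\otimes r')=(a\cdot r)\cdot r'$, $\top\star a=a$, $a\cdot\top=a$, $(q\star a)\cdot r=q\star(a\cdot r)$. 2-cells are sup-preserving maps $f$ with $f(q\star a)=q\star f(a)$ and $f(a\cdot r)=f(a)\cdot r$. Equivalently it is the bicategory of monoids, bimodules and bimodule morphisms in the symmetric monoidal closed category $\mathrm{Sup}$ of suplattices; composition of $A\colon Q\nrightarrow R$ and $B\colon R\nrightarrow S$ is the tensor product $A\otimes_R B$ (the coequalizer in $\mathrm{Sup}$ of $A\otimes R\otimes B\rightrightarrows A\otimes B$), and the identity on $Q$ is $Q$ itself. Composition in bicategories is written $\otimes$ in diagrammatic order, with identities $\top_X$. A right extension of $B\colon X\to Z$ along $A\colon X\to Y$ is a 1-cell $A\rhd B\colon Y\to Z$ with a 2-cell $A\otimes(A\rhd B)\to B$ inducing bijections between 2-cells $C\to A\rhd B$ and $A\otimes C\to B$ for all $C\colon Y\to Z$. A right lifting of $C\colon Z\to Y$ through $A\colon X\to Y$ is a 1-cell $C\lhd A\colon Z\to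 X$ with a 2-cell $(C\lhd A)\otimes A\to C$ inducing bijections between 2-cells $B\to C\lhd A$ and $B\otimes A\to C$ for all $B\colon Z\to X$. A bicategory is biclosed if it has all of these. A family $\{\bot_X\colon X\to X\}$ of 1-cells, one for each 0-cell of a biclosed bicategory, is dualizing if the canonical 2-cells $\delta_{A,Y}\colon A\to(\bot_Y\lhd A)\rhd\bot_Y$ and $\delta_{X,A}\colon A\to\bot_X\lhd(A\rhd\bot_X)$ are invertible for all $A\colon X\to Y$. It is cyclic dualizing if moreover there are invertible 2-cells $\theta_A\colon\bot_Y\lhd A\to A\rhd\bot_X$, natural in $A\colon X\to Y$, such that $\theta_{\bot_Y\lhd A}\circ(\bot_X\lhd\theta_A)\circ\delta_{X,A}=\delta_{A,Y}$. A cyclic $*$-autonomous bicategory is (equivalently to the definition via an adjoint equivalence $(-)^*\colon\mathcal B(X,Y)\to\mathcal B(Y,X)^{op}$ with $A^*$ naturally the right extension of $\top_X^*$ along $A$) a biclosed bicategory admitting a cyclic dualizing family. *)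

theory Defs
  imports "HOL-Algebra.Complete_Lattice" "HOL-Library.Equipollence"
begin

section \<open>Bicategories\<close>

text \<open>
  Composition of 1-cells is in diagrammatic order, vertical composition of 2-cells is in
  applicative order.
\<close>

record ('o, 'm, 'c) bicat =
  cells0 :: "'o set"
  cells1 :: "'m set"
  cells2 :: "'c set"
  src :: "'m \<Rightarrow> 'o"
  trg :: "'m \<Rightarrow> 'o"
  dom2 :: "'c \<Rightarrow> 'm"
  cod2 :: "'c \<Rightarrow> 'm"
  vid :: "'m \<Rightarrow> 'c"
  vcomp :: "'c \<Rightarrow> 'c \<Rightarrow> 'c"  (infixr \<open>\<cdot>\<index>\<close> 65)
  ident :: "'o \<Rightarrow> 'm"
  hcomp1 :: "'m \<Rightarrow> 'm \<Rightarrow> 'm"  (infixr \<open>\<otimes>\<^sub>1\<index>\<close> 75)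
  hcomp2 :: "'c \<Rightarrow> 'c \<Rightarrow> 'c"  (infixr \<open>\<otimes>\<^sub>2\<index>\<close> 75)
  assoc :: "'m \<Rightarrow> 'm \<Rightarrow> 'm \<Rightarrow> 'c"
  lunit :: "'m \<Rightarrow> 'c"
  runit :: "'m \<Rightarrow> 'c"

definition hom1 :: "('o, 'm, 'c) bicat \<Rightarrow> 'o \<Rightarrow> 'o \<Rightarrow> 'm set" where
  "hom1 B X Y = {A \<in> cells1 B. src B A = X \<and> trg B A = Y}"

definition hom2 :: "('o, 'm, 'c) bicat \<Rightarrow> 'm \<Rightarrow> 'm \<Rightarrow> 'c set" where
  "hom2 B A A' = {\<alpha> \<in> cells2 B. dom2 B \<alpha> = A \<and> cod2 B \<alpha> = A'}"

definition iso2 :: "('o, 'm, 'c) bicat \<Rightarrow> 'm \<Rightarrow> 'm \<Rightarrow> 'c set" where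
  "iso2 B A A' = {\<alpha> \<in> hom2 B A A'.
     \<exists>\<beta> \<in> hom2 B A' A. vcomp B \<beta> \<alpha> = vid B A \<and> vcomp B \<alpha> \<beta> = vid B A'}"

locale bicategory =
  fixes B :: "('o, 'm, 'c) bicat" (structure)
  assumes src_closed: "A \<in> cells1 B \<Longrightarrow> src B A \<in> cells0 B"
    and trg_closed: "A \<in> cells1 B \<Longrightarrow> trg B A \<in> cells0 B"
    and dom2_closed: "\<alpha> \<in> cells2 B \<Longrightarrow> dom2 B \<alpha> \<in> cells1 B"
    and cod2_closed: "\<alpha> \<in> cells2 B \<Longrightarrow> cod2 B \<alpha> \<in> cells1 B"
    and globular_src: "\<alpha> \<in> cells2 B \<Longrightarrow> src B (dom2 B \<alpha>) = src B (cod2 B \<alpha>)"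
    and globular_trg: "\<alpha> \<in> cells2 B \<Longrightarrow> trg B (dom2 B \<alpha>) = trg B (cod2 B \<alpha>)"
    and vid_closed: "A \<in> cells1 B \<Longrightarrow> vid B A \<in> hom2 B A A"
    and vcomp_closed: "\<lbrakk>\<alpha> \<in> hom2 B A A'; \<beta> \<in> hom2 B A' A''\<rbrakk> \<Longrightarrow> \<beta> \<cdot> \<alpha> \<in> hom2 B A A''"
    and vcomp_assoc: "\<lbrakk>\<alpha> \<in> hom2 B A A'; \<beta> \<in> hom2 B A' A''; \<gamma> \<in> hom2 B A'' A'''\<rbrakk>
          \<Longrightarrow> (\<gamma> \<cdot> \<beta>) \<cdot> \<alpha> = \<gamma> \<cdot> (\<beta> \<cdot> \<alpha>)"
    and vcomp_vid: "\<alpha> \<in> hom2 B A A' \<Longrightarrow> \<alpha> \<cdot> vid B A = \<alpha>"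
    and vid_vcomp: "\<alpha> \<in> hom2 B A A' \<Longrightarrow> vid B A' \<cdot> \<alpha> = \<alpha>"
    and ident_closed: "X \<in> cells0 B \<Longrightarrow> ident B X \<in> hom1 B X X"
    and hcomp1_closed: "\<lbrakk>A \<in> hom1 B X Y; C \<in> hom1 B Y Z\<rbrakk> \<Longrightarrow> A \<otimes>\<^sub>1 C \<in> hom1 B X Z"
    and hcomp2_closed: "\<lbrakk>\<alpha> \<in> hom2 B A A'; \<gamma> \<in> hom2 B C C'; trg B A = src B C\<rbrakk>
          \<Longrightarrow> \<alpha> \<otimes>\<^sub>2 \<gamma> \<in> hom2 B (A \<otimes>\<^sub>1 C) (A' \<otimes>\<^sub>1 C')"
    and hcomp2_vid: "\<lbrakk>A \<in> hom1 B X Y; C \<in> hom1 B Y Z\<rbrakk> \<Longrightarrow> vid B A \<otimes>\<^sub>2 vid B C = vid B (A \<otimes>\<^sub>1 C)"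
    and interchange: "\<lbrakk>\<alpha> \<in> hom2 B A A'; \<alpha>' \<in> hom2 B A' A''; \<gamma> \<in> hom2 B C C'; \<gamma>' \<in> hom2 B C' C'';
            trg B A = src B C\<rbrakk>
          \<Longrightarrow> (\<alpha>' \<cdot> \<alpha>) \<otimes>\<^sub>2 (\<gamma>' \<cdot> \<gamma>) = (\<alpha>' \<otimes>\<^sub>2 \<gamma>') \<cdot> (\<alpha> \<otimes>\<^sub>2 \<gamma>)"
    and assoc_iso: "\<lbrakk>A \<in> hom1 B W X; C \<in> hom1 B X Y; D \<in> hom1 B Y Z\<rbrakk>
          \<Longrightarrow> assoc B A C D \<in> iso2 B ((A \<otimes>\<^sub>1 C) \<otimes>\<^sub>1 D) (A \<otimes>\<^sub>1 (C \<otimes>\<^sub>1 D))"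
    and assoc_natural: "\<lbrakk>\<alpha> \<in> hom2 B A A'; \<gamma> \<in> hom2 B C C'; \<delta> \<in> hom2 B D D';
            trg B A = src B C; trg B C = src B D\<rbrakk>
          \<Longrightarrow> assoc B A' C' D' \<cdot> ((\<alpha> \<otimes>\<^sub>2 \<gamma>) \<otimes>\<^sub>2 \<delta>) = (\<alpha> \<otimes>\<^sub>2 (\<gamma> \<otimes>\<^sub>2 \<delta>)) \<cdot> assoc B A C D"
    and lunit_iso: "A \<in> hom1 B X Y \<Longrightarrow> lunit B A \<in> iso2 B (ident B X \<otimes>\<^sub>1 A) A"
    and lunit_natural: "\<lbrakk>\<alpha> \<in> hom2 B A A'; A \<in> hom1 B X Y\<rbrakk>
          \<Longrightarrow> lunit B A' \<cdot> (vid B (ident B X) \<otimes>\<^sub>2 \<alpha>) = \<alpha> \<cdot> lunit B A"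
    and runit_iso: "A \<in> hom1 B X Y \<Longrightarrow> runit B A \<in> iso2 B (A \<otimes>\<^sub>1 ident B Y) A"
    and runit_natural: "\<lbrakk>\<alpha> \<in> hom2 B A A'; A \<in> hom1 B X Y\<rbrakk>
          \<Longrightarrow> runit B A' \<cdot> (\<alpha> \<otimes>\<^sub>2 vid B (ident B Y)) = \<alpha> \<cdot> runit B A"
    and pentagon: "\<lbrakk>A \<in> hom1 B V W; C \<in> hom1 B W X; D \<in> hom1 B X Y; E \<in> hom1 B Y Z\<rbrakk>
          \<Longrightarrow> assoc B A C (D \<otimes>\<^sub>1 E) \<cdot> assoc B (A \<otimes>\<^sub>1 C) D E
            = (vid B A \<otimes>\<^sub>2 assoc B C D E) \<cdot> assoc B A (C \<otimes>\<^sub>1 D) E \<cdot> (assoc B A C D \<otimes>\<^sub>2 vid B E)"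
    and triangle: "\<lbrakk>A \<in> hom1 B X Y; C \<in> hom1 B Y Z\<rbrakk>
          \<Longrightarrow> (vid B A \<otimes>\<^sub>2 lunit B C) \<cdot> assoc B A (ident B Y) C = runit B A \<otimes>\<^sub>2 vid B C"
begin

text \<open>
  \<open>is_rext A C E \<epsilon>\<close>: \<open>E\<close> with \<open>\<epsilon> : A \<otimes> E \<rightarrow> C\<close> is a right extension of \<open>C : X \<rightarrow> Z\<close>
  along \<open>A : X \<rightarrow> Y\<close>.
\<close>

definition is_rext :: "'m \<Rightarrow> 'm \<Rightarrow> 'm \<Rightarrow> 'c \<Rightarrow> bool" where
  "is_rext A C E \<epsilon> \<longleftrightarrow>
     E \<in> hom1 B (trg B A) (trg B C) \<and> \<epsilon> \<in> hom2 B (A \<otimes>\<^sub>1 E) C \<and>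
     (\<forall>D \<in> hom1 B (trg B A) (trg B C).
        bij_betw (\<lambda>\<phi>. \<epsilon> \<cdot> (vid B A \<otimes>\<^sub>2 \<phi>)) (hom2 B D E) (hom2 B (A \<otimes>\<^sub>1 D) C))"

text \<open>
  \<open>is_rlift C A E \<epsilon>\<close>: \<open>E\<close> with \<open>\<epsilon> : E \<otimes> A \<rightarrow> C\<close> is a right lifting of \<open>C : Z \<rightarrow> Y\<close>
  through \<open>A : X \<rightarrow> Y\<close>.
\<close>

definition is_rlift :: "'m \<Rightarrow> 'm \<Rightarrow> 'm \<Rightarrow> 'c \<Rightarrow> bool" where
  "is_rlift C A E \<epsilon> \<longleftrightarrow>
     E \<in> hom1 B (src B C) (src B A) \<and> \<epsilon> \<in> hom2 B (E \<otimes>\<^sub>1 A) C \<and>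
     (\<forall>D \<in> hom1 B (src B C) (src B A).
        bij_betw (\<lambda>\<phi>. \<epsilon> \<cdot> (\<phi> \<otimes>\<^sub>2 vid B A)) (hom2 B D E) (hom2 B (D \<otimes>\<^sub>1 A) C))"

end

locale biclosed_bicategory = bicategory B for B :: "('o, 'm, 'c) bicat" (structure) +
  assumes rext_exists: "\<lbrakk>A \<in> cells1 B; C \<in> cells1 B; src B A = src B C\<rbrakk> \<Longrightarrow> \<exists>E \<epsilon>. is_rext A C E \<epsilon>"
    and rlift_exists: "\<lbrakk>A \<in> cells1 B; C \<in> cells1 B; trg B A = trg B C\<rbrakk> \<Longrightarrow> \<exists>E \<epsilon>. is_rlift C A E \<epsilon>"
begin

text \<open>
  Right extensions and right liftings are unique up to unique isomorphism; we fix a choice of them,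
  \<open>rext A C\<close> for \<open>A \<rhd> C\<close> and \<open>rlift C A\<close> for \<open>C \<lhd> A\<close>, with their universal 2-cells.
\<close>

definition rext :: "'m \<Rightarrow> 'm \<Rightarrow> 'm" where
  "rext A C = fst (SOME (E, \<epsilon>). is_rext A C E \<epsilon>)"

definition rext_ev :: "'m \<Rightarrow> 'm \<Rightarrow> 'c" where
  "rext_ev A C = snd (SOME (E, \<epsilon>). is_rext A C E \<epsilon>)"

definition rlift :: "'m \<Rightarrow> 'm \<Rightarrow> 'm" where
  "rlift C A = fst (SOME (E, \<epsilon>). is_rlift C A E \<epsilon>)"

definition rlift_ev :: "'m \<Rightarrow> 'm \<Rightarrow> 'c" where
  "rlift_ev C A = snd (SOME (E, \<epsilon>). is_rlift C A E \<epsilon>)"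

text \<open>The 2-cell \<open>D \<rightarrow> A \<rhd> C\<close> corresponding to \<open>\<gamma> : A \<otimes> D \<rightarrow> C\<close>.\<close>

definition rext_transpose :: "'m \<Rightarrow> 'm \<Rightarrow> 'm \<Rightarrow> 'c \<Rightarrow> 'c" where
  "rext_transpose A C D \<gamma> =
     (THE \<phi>. \<phi> \<in> hom2 B D (rext A C) \<and> rext_ev A C \<cdot> (vid B A \<otimes>\<^sub>2 \<phi>) = \<gamma>)"

text \<open>The 2-cell \<open>D \<rightarrow> C \<lhd> A\<close> corresponding to \<open>\<gamma> : D \<otimes> A \<rightarrow> C\<close>.\<close>

definition rlift_transpose :: "'m \<Rightarrow> 'm \<Rightarrow> 'm \<Rightarrow> 'c \<Rightarrow> 'c" where
  "rlift_transpose C A D \<gamma> =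
     (THE \<phi>. \<phi> \<in> hom2 B D (rlift C A) \<and> rlift_ev C A \<cdot> (\<phi> \<otimes>\<^sub>2 vid B A) = \<gamma>)"

text \<open>
  The contravariant actions on \<open>\<alpha> : A \<rightarrow> A'\<close>, namely
  \<open>\<alpha> \<rhd> C : A' \<rhd> C \<rightarrow> A \<rhd> C\<close> and \<open>C \<lhd> \<alpha> : C \<lhd> A' \<rightarrow> C \<lhd> A\<close>.
\<close>

definition rext_map :: "'c \<Rightarrow> 'm \<Rightarrow> 'c" where
  "rext_map \<alpha> C =
     rext_transpose (dom2 B \<alpha>) C (rext (cod2 B \<alpha>) C)
       (rext_ev (cod2 B \<alpha>) C \<cdot> (\<alpha> \<otimes>\<^sub>2 vid B (rext (cod2 B \<alpha>) C)))"

definition rlift_map :: "'m \<Rightarrow> 'c \<Rightarrow> 'c" where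
  "rlift_map C \<alpha> =
     rlift_transpose C (dom2 B \<alpha>) (rlift C (cod2 B \<alpha>))
       (rlift_ev C (cod2 B \<alpha>) \<cdot> (vid B (rlift C (cod2 B \<alpha>)) \<otimes>\<^sub>2 \<alpha>))"

text \<open>
  For \<open>A : X \<rightarrow> Y\<close>, \<open>delta_r\<close> is the canonical 2-cell \<open>A \<rightarrow> (\<D> Y \<lhd> A) \<rhd> \<D> Y\<close> and
  \<open>delta_l\<close> is the canonical 2-cell \<open>A \<rightarrow> \<D> X \<lhd> (A \<rhd> \<D> X)\<close>.
\<close>

definition delta_r :: "('o \<Rightarrow> 'm) \<Rightarrow> 'm \<Rightarrow> 'c" where
  "delta_r \<D> A =
     rext_transpose (rlift (\<D> (trg B A)) A) (\<D> (trg B A)) A (rlift_ev (\<D> (trg B A)) A)"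

definition delta_l :: "('o \<Rightarrow> 'm) \<Rightarrow> 'm \<Rightarrow> 'c" where
  "delta_l \<D> A =
     rlift_transpose (\<D> (src B A)) (rext A (\<D> (src B A))) A (rext_ev A (\<D> (src B A)))"

definition dualizing :: "('o \<Rightarrow> 'm) \<Rightarrow> bool" where
  "dualizing \<D> \<longleftrightarrow>
     (\<forall>X \<in> cells0 B. \<D> X \<in> hom1 B X X) \<and>
     (\<forall>A \<in> cells1 B.
        delta_r \<D> A \<in> iso2 B A (rext (rlift (\<D> (trg B A)) A) (\<D> (trg B A))) \<and>
        delta_l \<D> A \<in> iso2 B A (rlift (\<D> (src B A)) (rext A (\<D> (src B A)))))"

definition cyclic_dualizing :: "('o \<Rightarrow> 'm) \<Rightarrow> bool" where
  "cyclic_dualizing \<D> \<longleftrightarrow>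
     dualizing \<D> \<and>
     (\<exists>\<theta>. (\<forall>A \<in> cells1 B. \<theta> A \<in> iso2 B (rlift (\<D> (trg B A)) A) (rext A (\<D> (src B A)))) \<and>
          (\<forall>A \<in> cells1 B. \<forall>A' \<in> cells1 B. \<forall>\<alpha> \<in> hom2 B A A'.
             \<theta> A \<cdot> rlift_map (\<D> (trg B A)) \<alpha> = rext_map \<alpha> (\<D> (src B A)) \<cdot> \<theta> A') \<and>
          (\<forall>A \<in> cells1 B.
             \<theta> (rlift (\<D> (trg B A)) A) \<cdot> rlift_map (\<D> (src B A)) (\<theta> A) \<cdot> delta_l \<D> A = delta_r \<D> A))"

end

locale cyclic_star_autonomous_bicategory =
  biclosed_bicategory B for B :: "('o, 'm, 'c) bicat" (structure) +
  assumes cyclic_dualizing_exists: "\<exists>\<D>. cyclic_dualizing \<D>"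


section \<open>Universes\<close>

text \<open>
  All structures below have as carrier a subset of a fixed type \<open>'u\<close> which is strictly smaller than
  \<open>'u\<close>.  If the cardinality of \<open>'u\<close> is a strong limit, this plays the role of the universe of
  small sets: it is closed under the products, powersets and function sets needed to form tensor
  products and homs of modules.  In particular this covers \<open>'u\<close> of inaccessible cardinality, in which
  case, up to isomorphism, all structures in a Grothendieck universe are obtained.
\<close>

definition small :: "'u set \<Rightarrow> bool" where
  "small X \<longleftrightarrow> X \<prec> (UNIV :: 'u set)"

definition strong_limit_type :: "'u itself \<Rightarrow> bool" where
  "strong_limit_type _ \<longleftrightarrow> (\<forall>X :: 'u set. X \<prec> (UNIV :: 'u set) \<longrightarrow> Pow X \<prec> (UNIV :: 'u set))"


section \<open>Quantales and modules\<close>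

definition suplattice :: "('u, 'x) gorder_scheme \<Rightarrow> bool" where
  "suplattice L \<longleftrightarrow> complete_lattice L \<and> small (carrier L)"

definition sup_map :: "('u, 'x) gorder_scheme \<Rightarrow> ('u, 'y) gorder_scheme \<Rightarrow> ('u \<Rightarrow> 'u) \<Rightarrow> bool" where
  "sup_map L M f \<longleftrightarrow> f \<in> carrier L \<rightarrow> carrier M \<and> sup_pres L M f"

definition sup_bimap ::
  "('u, 'x) gorder_scheme \<Rightarrow> ('u, 'y) gorder_scheme \<Rightarrow> ('u, 'z) gorder_scheme
    \<Rightarrow> ('u \<Rightarrow> 'u \<Rightarrow> 'u) \<Rightarrow> bool" where
  "sup_bimap L M N f \<longleftrightarrow>
     (\<forall>x \<in> carrier L. sup_map M N (\<lambda>y. f x y)) \<and> (\<forall>y \<in> carrier M. sup_map L N (\<lambda>x. f x y))"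

record 'u quantale = "'u gorder" +
  qmult :: "'u \<Rightarrow> 'u \<Rightarrow> 'u"
  qunit :: "'u"

definition unital_quantale :: "'u quantale \<Rightarrow> bool" where
  "unital_quantale Q \<longleftrightarrow>
     suplattice Q \<and> sup_bimap Q Q Q (qmult Q) \<and> qunit Q \<in> carrier Q \<and>
     (\<forall>x \<in> carrier Q. \<forall>y \<in> carrier Q. \<forall>z \<in> carrier Q.
        qmult Q (qmult Q x y) z = qmult Q x (qmult Q y z)) \<and>
     (\<forall>x \<in> carrier Q. qmult Q (qunit Q) x = x \<and> qmult Q x (qunit Q) = x)"

record 'u qmodule = "'u gorder" +
  lquant :: "'u quantale"
  rquant :: "'u quantale"
  lact :: "'u \<Rightarrow> 'u \<Rightarrow> 'u"
  ract :: "'u \<Rightarrow> 'u \<Rightarrow> 'u"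

definition is_qmodule :: "'u qmodule \<Rightarrow> bool" where
  "is_qmodule A \<longleftrightarrow>
     unital_quantale (lquant A) \<and> unital_quantale (rquant A) \<and> suplattice A \<and>
     sup_bimap (lquant A) A A (lact A) \<and> sup_bimap A (rquant A) A (ract A) \<and>
     (\<forall>q \<in> carrier (lquant A). \<forall>q' \<in> carrier (lquant A). \<forall>a \<in> carrier A.
        lact A (qmult (lquant A) q q') a = lact A q (lact A q' a)) \<and>
     (\<forall>a \<in> carrier A. \<forall>r \<in> carrier (rquant A). \<forall>r' \<in> carrier (rquant A).
        ract A a (qmult (rquant A) r r') = ract A (ract A a r) r') \<and>
     (\<forall>a \<in> carrier A. lact A (qunit (lquant A)) a = a) \<and>
     (\<forall>a \<in> carrier A. ract A a (qunit (rquant A)) = a) \<and>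
     (\<forall>q \<in> carrier (lquant A). \<forall>a \<in> carrier A. \<forall>r \<in> carrier (rquant A).
        ract A (lact A q a) r = lact A q (ract A a r))"

text \<open>
  The underlying function of a module homomorphism is required to be \<open>undefined\<close> outside the carrier
  of its domain, so that equality of 2-cells is equality of functions on that carrier.
\<close>

record 'u qmodule_hom =
  hdom :: "'u qmodule"
  hcod :: "'u qmodule"
  hmap :: "'u \<Rightarrow> 'u"

definition is_qmodule_hom :: "'u qmodule_hom \<Rightarrow> bool" where
  "is_qmodule_hom f \<longleftrightarrow>
     is_qmodule (hdom f) \<and> is_qmodule (hcod f) \<and>
     lquant (hdom f) = lquant (hcod f) \<and> rquant (hdom f) = rquant (hcod f) \<and>
     hmap f \<in> extensional (carrier (hdom f)) \<and> sup_map (hdom f) (hcod f) (hmap f) \<and>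
     (\<forall>q \<in> carrier (lquant (hdom f)). \<forall>a \<in> carrier (hdom f).
        hmap f (lact (hdom f) q a) = lact (hcod f) q (hmap f a)) \<and>
     (\<forall>a \<in> carrier (hdom f). \<forall>r \<in> carrier (rquant (hdom f)).
        hmap f (ract (hdom f) a r) = ract (hcod f) (hmap f a) r)"

definition qmodule_homs :: "'u qmodule \<Rightarrow> 'u qmodule \<Rightarrow> 'u qmodule_hom set" where
  "qmodule_homs A A' = {f. is_qmodule_hom f \<and> hdom f = A \<and> hcod f = A'}"

definition id_qmodule :: "'u quantale \<Rightarrow> 'u qmodule" where
  "id_qmodule Q =
     \<lparr>carrier = carrier Q, eq = eq Q, le = le Q,
      lquant = Q, rquant = Q, lact = qmult Q, ract = qmult Q\<rparr>"


section \<open>Tensor products of modules\<close>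

text \<open>
  Sup-preserving maps out of the tensor product of suplattices \<open>A \<otimes> C\<close> are the maps on \<open>A \<times> C\<close> that
  preserve suprema in each variable; such a map coequalizes \<open>A \<otimes> R \<otimes> C \<rightrightarrows> A \<otimes> C\<close> iff it is
  balanced.  So the coequalizer \<open>A \<otimes>\<^sub>R C\<close> is the suplattice with the universal balanced map, and its
  outer actions are the ones induced by those on \<open>A\<close> and \<open>C\<close>.  It is determined up to unique
  isomorphism, and we fix a choice.
\<close>

definition balanced ::
  "'u qmodule \<Rightarrow> 'u qmodule \<Rightarrow> ('u, 'x) gorder_scheme \<Rightarrow> ('u \<Rightarrow> 'u \<Rightarrow> 'u) \<Rightarrow> bool" where
  "balanced A C L f \<longleftrightarrow>
     sup_bimap A C L f \<and>
     (\<forall>a \<in> carrier A. \<forall>r \<in> carrier (rquant A). \<forall>c \<in> carrier C. f (ract A a r) c = f a (lact C r c))"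

definition is_tensor :: "'u qmodule \<Rightarrow> 'u qmodule \<Rightarrow> 'u qmodule \<Rightarrow> ('u \<Rightarrow> 'u \<Rightarrow> 'u) \<Rightarrow> bool" where
  "is_tensor A C T t \<longleftrightarrow>
     is_qmodule T \<and> lquant T = lquant A \<and> rquant T = rquant C \<and>
     balanced A C T t \<and>
     (\<forall>L :: 'u gorder. \<forall>f. suplattice L \<and> balanced A C L f \<longrightarrow>
        (\<exists>!h. h \<in> extensional (carrier T) \<and> sup_map T L h \<and>
              (\<forall>a \<in> carrier A. \<forall>c \<in> carrier C. h (t a c) = f a c))) \<and>
     (\<forall>q \<in> carrier (lquant A). \<forall>a \<in> carrier A. \<forall>c \<in> carrier C.
        lact T q (t a c) = t (lact A q a) c) \<and>
     (\<forall>a \<in> carrier A. \<forall>c \<in> carrier C. \<forall>s \<in> carrier (rquant C).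
        ract T (t a c) s = t a (ract C c s))"

definition tensor :: "'u qmodule \<Rightarrow> 'u qmodule \<Rightarrow> 'u qmodule" where
  "tensor A C = fst (SOME (T, t). is_tensor A C T t)"

definition tens :: "'u qmodule \<Rightarrow> 'u qmodule \<Rightarrow> 'u \<Rightarrow> 'u \<Rightarrow> 'u" where
  "tens A C = snd (SOME (T, t). is_tensor A C T t)"

definition tensor_hom :: "'u qmodule_hom \<Rightarrow> 'u qmodule_hom \<Rightarrow> 'u qmodule_hom" where
  "tensor_hom f g =
     (THE h. h \<in> qmodule_homs (tensor (hdom f) (hdom g)) (tensor (hcod f) (hcod g)) \<and>
        (\<forall>a \<in> carrier (hdom f). \<forall>c \<in> carrier (hdom g).
           hmap h (tens (hdom f) (hdom g) a c) = tens (hcod f) (hcod g) (hmap f a) (hmap g c)))"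

definition tensor_assoc :: "'u qmodule \<Rightarrow> 'u qmodule \<Rightarrow> 'u qmodule \<Rightarrow> 'u qmodule_hom" where
  "tensor_assoc A C D =
     (THE h. h \<in> qmodule_homs (tensor (tensor A C) D) (tensor A (tensor C D)) \<and>
        (\<forall>a \<in> carrier A. \<forall>c \<in> carrier C. \<forall>d \<in> carrier D.
           hmap h (tens (tensor A C) D (tens A C a c) d) = tens A (tensor C D) a (tens C D c d)))"

definition tensor_lunit :: "'u qmodule \<Rightarrow> 'u qmodule_hom" where
  "tensor_lunit A =
     (THE h. h \<in> qmodule_homs (tensor (id_qmodule (lquant A)) A) A \<and>
        (\<forall>q \<in> carrier (lquant A). \<forall>a \<in> carrier A.
           hmap h (tens (id_qmodule (lquant A)) A q a) = lact A q a))"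

definition tensor_runit :: "'u qmodule \<Rightarrow> 'u qmodule_hom" where
  "tensor_runit A =
     (THE h. h \<in> qmodule_homs (tensor A (id_qmodule (rquant A))) A \<and>
        (\<forall>a \<in> carrier A. \<forall>r \<in> carrier (rquant A).
           hmap h (tens A (id_qmodule (rquant A)) a r) = ract A a r))"


section \<open>The bicategory of unital quantales\<close>

definition Quant :: "('u quantale, 'u qmodule, 'u qmodule_hom) bicat" where
  "Quant =
     \<lparr>cells0 = {Q. unital_quantale Q},
      cells1 = {A. is_qmodule A},
      cells2 = {f. is_qmodule_hom f},
      src = lquant,
      trg = rquant,
      dom2 = hdom,
      cod2 = hcod,
      vid = (\<lambda>A. \<lparr>hdom = A, hcod = A, hmap = restrict (\<lambda>a. a) (carrier A)\<rparr>),
      vcomp = (\<lambda>g f. \<lparr>hdom = hdom f, hcod = hcod g,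
                      hmap = compose (carrier (hdom f)) (hmap g) (hmap f)\<rparr>),
      ident = id_qmodule,
      hcomp1 = tensor,
      hcomp2 = tensor_hom,
      assoc = tensor_assoc,
      lunit = tensor_lunit,
      runit = tensor_runit\<rparr>"

end

theory Submission
  imports Defs
begin

text \<open>
  The tensor product of modules is a lattice of two-sided ideals of pairs, and coherence of the
  bicategory holds because all maps involved are determined by their values on pure tensors.  A right
  extension \<open>A \<rhd> C\<close> is the module of left module homomorphisms \<open>A \<rightarrow> C\<close>, and passing to opposite
  quantales turns right liftings into right extensions.

  The dualizing object \<open>\<bottom>\<^sub>Q\<close> is \<open>Q\<close> with the reversed order.  Left module homomorphisms
  \<open>A \<rightarrow> \<bottom>\<^sub>Q\<close> correspond to sup-preserving maps from \<open>A\<close> to the two-element lattice, hence to elements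
  of \<open>A\<close>, so both \<open>A \<rhd> \<bottom>\<^sub>Q\<close> and \<open>\<bottom>\<^sub>R \<lhd> A\<close> are \<open>A\<close> with the reversed order.  This is expressed by
  two-valued perfect pairings of both modules with \<open>A\<close>.  The isomorphism \<open>\<theta>\<close> is the map compatible
  with these pairings, and the required identities are checked by pairing with arbitrary elements.
\<close>

section \<open>Suplattices\<close>

text \<open>Tensor products, right extensions and right liftings are fixed only by choice, so their
  elements are accessible through universal properties alone. This is why duals are handled by
  relations: a perfect pairing with \<open>A\<close> pins down a module up to unique isomorphism,
  whatever its elements are, and maps are defined and compared by their effect on the pairing. The
  relation between \<open>a\<close> and \<open>e\<close> is 1 \<le> ev a e in the original order of
  Q: it evaluates a functional in [Q, 2] at the unit and records whether the result is 0. The left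
  and the right dual thus carry relations of the same shape, and the cyclic condition says that two
  composites preserve them. The second obstacle is size. All carriers are subsets of one type
  \<open>'u\<close>, while the tensor product consists of sets of pairs and the hom modules of
  functions. Both inject into a powerset of a product of two carriers, which the strong limit
  hypothesis keeps smaller than \<open>'u\<close>; the lattice is then copied into
  \<open>'u\<close>.\<close>

lemma (in complete_lattice) lub_closed: "X \<subseteq> carrier L \<Longrightarrow> \<Squnion>X \<in> carrier L"
  by (rule weak.sup_closed)

text \<open>The universal property of the supremum as one equivalence. Together with
  \<open>eq_by_upper\<close> it lets equations between suprema be proved by rewriting upper bounds
  instead of by two inequalities.\<close>

lemma (in complete_lattice) lub_le_iff:
  assumes "X \<subseteq> carrier L" "y \<in> carrier L"
  shows "\<Squnion>X \<sqsubseteq> y \<longleftrightarrow> (\<forall>x \<in> X. x \<sqsubseteq> y)"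
proof
  assume "\<Squnion>X \<sqsubseteq> y"
  then show "\<forall>x \<in> X. x \<sqsubseteq> y"
    using assms lub_closed[OF assms(1)] by (meson le_trans subsetD weak.sup_upper)
next
  assume "\<forall>x \<in> X. x \<sqsubseteq> y"
  then show "\<Squnion>X \<sqsubseteq> y"
    using assms by (intro weak.sup_least) (auto simp: Upper_def)
qed

lemma (in partial_order) eq_by_upper:
  assumes "x \<in> carrier L" "y \<in> carrier L" "\<And>z. z \<in> carrier L \<Longrightarrow> x \<sqsubseteq> z \<longleftrightarrow> y \<sqsubseteq> z"
  shows "x = y"
  using assms by (meson le_antisym le_refl)

lemma (in partial_order) eq_by_lower:
  assumes "x \<in> carrier L" "y \<in> carrier L" "\<And>z. z \<in> carrier L \<Longrightarrow> z \<sqsubseteq> x \<longleftrightarrow> z \<sqsubseteq> y"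
  shows "x = y"
  using assms by (meson le_antisym le_refl)

lemma (in complete_lattice) lub_pair_eq:
  assumes xy: "x \<in> carrier L" "y \<in> carrier L" "x \<sqsubseteq> y"
  shows "\<Squnion>{x, y} = y"
proof -
  have sub: "{x, y} \<subseteq> carrier L" using xy by simp
  show ?thesis
    using lub_closed[OF sub] lub_le_iff[OF sub] xy by (intro eq_by_upper) (auto intro: le_trans)
qed

text \<open>The infimum of \<open>X\<close> is the supremum of its lower bounds, so only suprema
  have to be supplied for a constructed lattice.\<close>

lemma (in partial_order) complete_lattice_by_lubs:
  assumes lub: "\<And>X. X \<subseteq> carrier L \<Longrightarrow> \<exists>s \<in> carrier L. \<forall>y \<in> carrier L. s \<sqsubseteq> y \<longleftrightarrow> (\<forall>x \<in> X. x \<sqsubseteq> y)"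
  shows "complete_lattice L"
proof (rule complete_latticeI)
  fix X assume X: "X \<subseteq> carrier L"
  obtain s where s: "s \<in> carrier L" "\<forall>y \<in> carrier L. s \<sqsubseteq> y \<longleftrightarrow> (\<forall>x \<in> X. x \<sqsubseteq> y)"
    using lub[OF X] by blast
  have "least L s (Upper L X)"
    unfolding least_def Upper_def using s X by (auto intro: le_refl)
  then show "\<exists>s. least L s (Upper L X)" by blast
next
  fix X assume X: "X \<subseteq> carrier L"
  have sub: "Lower L X \<subseteq> carrier L" by (auto simp: Lower_def)
  obtain s where s: "s \<in> carrier L" "\<forall>y \<in> carrier L. s \<sqsubseteq> y \<longleftrightarrow> (\<forall>x \<in> Lower L X. x \<sqsubseteq> y)"
    using lub[OF sub] by blast
  have "greatest L s (Lower L X)"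
    unfolding greatest_def
  proof (intro conjI ballI sub)
    show "s \<in> Lower L X" using s X by (auto simp: Lower_def)
    show "x \<sqsubseteq> s" if "x \<in> Lower L X" for x using s that le_refl by blast
  qed
  then show "\<exists>i. greatest L i (Lower L X)" by blast
qed

text \<open>Suprema of the dual are infima, obtained once more as suprema of sets of lower bounds.
  The dualizing object carries the reversed order and takes its completeness from here.\<close>

lemma (in complete_lattice) dual_complete_lattice: "complete_lattice (inv_gorder L)"
proof -
  interpret D: partial_order "inv_gorder L" by (rule dual_order)
  show ?thesis
  proof (rule D.complete_lattice_by_lubs)
    fix X assume "X \<subseteq> carrier (inv_gorder L)"
    then have X: "X \<subseteq> carrier L" by simp
    have sub: "Lower L X \<subseteq> carrier L" by (auto simp: Lower_def)
    have "y \<sqsubseteq> \<Squnion>(Lower L X) \<longleftrightarrow> (\<forall>x \<in> X. y \<sqsubseteq> x)" if y: "y \<in> carrier L" for y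
    proof
      have lb: "\<Squnion>(Lower L X) \<sqsubseteq> x" if "x \<in> X" for x
        using that X sub by (subst lub_le_iff) (auto simp: Lower_def)
      show "\<forall>x \<in> X. y \<sqsubseteq> x" if "y \<sqsubseteq> \<Squnion>(Lower L X)"
        using that lb y X lub_closed[OF sub] by (meson le_trans subsetD)
      assume "\<forall>x \<in> X. y \<sqsubseteq> x"
      then have "y \<in> Lower L X" using y by (auto simp: Lower_def)
      then show "y \<sqsubseteq> \<Squnion>(Lower L X)" using sub by (simp add: weak.sup_upper)
    qed
    then show "\<exists>s\<in>carrier (inv_gorder L). \<forall>y\<in>carrier (inv_gorder L).
        (s \<sqsubseteq>\<^bsub>inv_gorder L\<^esub> y) = (\<forall>x\<in>X. x \<sqsubseteq>\<^bsub>inv_gorder L\<^esub> y)"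
      using lub_closed[OF sub] by (intro bexI[of _ "\<Squnion>(Lower L X)"]) auto
  qed
qed

text \<open>\<open>is_tensor\<close> quantifies over bare records of type \<open>'u gorder\<close>,
  while the targets of interest are modules. \<open>gorder.truncate\<close> forgets the module
  fields, so that the universal property becomes applicable to them.\<close>

lemma truncate_simps [simp]:
  "carrier (gorder.truncate L) = carrier L" "eq (gorder.truncate L) = eq L"
  "le (gorder.truncate L) = le L"
  by (simp_all add: gorder.truncate_def)

text \<open>Lattice notions read only \<open>carrier\<close>, \<open>eq\<close> and
  \<open>le\<close>, but records of different extension types cannot be equated. The congruence
  rules of this group carry facts between such records.\<close>

lemma lub_cong_order:
  assumes "carrier L = carrier M" "le L = le M"
  shows "\<Squnion>\<^bsub>L\<^esub> X = \<Squnion>\<^bsub>M\<^esub> X"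
  using assms by (simp add: sup_def least_def Upper_def)

lemma complete_lattice_cong_order:
  assumes "carrier L = carrier M" "eq L = eq M" "le L = le M"
  shows "complete_lattice L \<longleftrightarrow> complete_lattice M"
  using assms by (simp add: complete_lattice_def complete_lattice_axioms_def partial_order_def
      partial_order_axioms_def weak_partial_order_def weak_partial_order_axioms_def
      equivalence_def least_def greatest_def Upper_def Lower_def)

lemma suplattice_cong_order:
  assumes "carrier L = carrier M" "eq L = eq M" "le L = le M"
  shows "suplattice L \<longleftrightarrow> suplattice M"
  using complete_lattice_cong_order[OF assms] assms by (simp add: suplattice_def)

lemma sup_map_cong_order:
  assumes "carrier L = carrier L'" "eq L = eq L'" "le L = le L'"
    and "carrier M = carrier M'" "eq M = eq M'" "le M = le M'"
  shows "sup_map L M f \<longleftrightarrow> sup_map L' M' f"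
  using complete_lattice_cong_order[OF assms(1-3)] complete_lattice_cong_order[OF assms(4-6)]
    lub_cong_order[OF assms(1,3)] lub_cong_order[OF assms(4,6)] assms
  by (simp add: sup_map_def sup_pres_def)

lemma sup_map_truncate [simp]: "sup_map L (gorder.truncate M) f \<longleftrightarrow> sup_map L M f"
  by (rule sup_map_cong_order) simp_all

lemma suplattice_truncate [simp]: "suplattice (gorder.truncate M) \<longleftrightarrow> suplattice M"
  by (rule suplattice_cong_order) simp_all

text \<open>Elements of \<open>M\<close> are determined by their upper bounds, so preservation of
  suprema can be tested against an arbitrary \<open>y\<close>. This is the form in which adjunctions
  deliver it.\<close>

lemma sup_mapI:
  assumes "complete_lattice L" "complete_lattice M"
    and f: "\<And>x. x \<in> carrier L \<Longrightarrow> f x \<in> carrier M"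
    and le: "\<And>X y. X \<subseteq> carrier L \<Longrightarrow> y \<in> carrier M
        \<Longrightarrow> f (\<Squnion>\<^bsub>L\<^esub> X) \<sqsubseteq>\<^bsub>M\<^esub> y \<longleftrightarrow> (\<forall>x \<in> X. f x \<sqsubseteq>\<^bsub>M\<^esub> y)"
  shows "sup_map L M f"
proof -
  interpret L: complete_lattice L by fact
  interpret M: complete_lattice M by fact
  have "f (\<Squnion>\<^bsub>L\<^esub> X) = \<Squnion>\<^bsub>M\<^esub> (f ` X)" if X: "X \<subseteq> carrier L" for X
  proof (rule M.eq_by_upper)
    have sub: "f ` X \<subseteq> carrier M" using f X by auto
    then show "\<Squnion>\<^bsub>M\<^esub> (f ` X) \<in> carrier M" by (rule M.lub_closed)
    show "f (\<Squnion>\<^bsub>L\<^esub> X) \<in> carrier M" using f L.lub_closed[OF X] by blast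
    show "f (\<Squnion>\<^bsub>L\<^esub> X) \<sqsubseteq>\<^bsub>M\<^esub> z \<longleftrightarrow> \<Squnion>\<^bsub>M\<^esub> (f ` X) \<sqsubseteq>\<^bsub>M\<^esub> z" if "z \<in> carrier M" for z
      using le[OF X that] M.lub_le_iff[OF sub that] by auto
  qed
  then show ?thesis using assms by (simp add: sup_map_def sup_pres_def)
qed

lemma sup_map_complete_lattice:
  assumes "sup_map L M f"
  shows "complete_lattice L" "complete_lattice M"
  using assms by (auto simp: sup_map_def sup_pres_def)

lemma sup_map_closed: "sup_map L M f \<Longrightarrow> x \<in> carrier L \<Longrightarrow> f x \<in> carrier M"
  by (auto simp: sup_map_def)

lemma sup_map_lub: "sup_map L M f \<Longrightarrow> X \<subseteq> carrier L \<Longrightarrow> f (\<Squnion>\<^bsub>L\<^esub> X) = \<Squnion>\<^bsub>M\<^esub> (f ` X)"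
  by (auto simp: sup_map_def sup_pres_def)

lemma sup_map_lub_le_iff:
  assumes f: "sup_map L M f" and X: "X \<subseteq> carrier L" "y \<in> carrier M"
  shows "f (\<Squnion>\<^bsub>L\<^esub> X) \<sqsubseteq>\<^bsub>M\<^esub> y \<longleftrightarrow> (\<forall>x \<in> X. f x \<sqsubseteq>\<^bsub>M\<^esub> y)"
proof -
  interpret M: complete_lattice M by (rule sup_map_complete_lattice[OF f])
  have "f ` X \<subseteq> carrier M" using f X by (auto intro: sup_map_closed)
  then show ?thesis using sup_map_lub[OF f X(1)] M.lub_le_iff X by simp
qed

text \<open>Left adjoints preserve suprema: transposing along \<open>adj\<close> turns an upper
  bound \<open>y\<close> of the image into the upper bound \<open>g y\<close> of the original
  set.\<close>

lemma sup_mapI_adjoint: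
  assumes L: "complete_lattice L" and M: "complete_lattice M"
    and f: "\<And>x. x \<in> carrier L \<Longrightarrow> f x \<in> carrier M"
    and g: "\<And>y. y \<in> carrier M \<Longrightarrow> g y \<in> carrier L"
    and adj: "\<And>x y. x \<in> carrier L \<Longrightarrow> y \<in> carrier M \<Longrightarrow> f x \<sqsubseteq>\<^bsub>M\<^esub> y \<longleftrightarrow> x \<sqsubseteq>\<^bsub>L\<^esub> g y"
  shows "sup_map L M f"
proof (rule sup_mapI[OF L M f], assumption)
  interpret L: complete_lattice L by fact
  fix X y assume X: "X \<subseteq> carrier L" and y: "y \<in> carrier M"
  show "f (\<Squnion>\<^bsub>L\<^esub> X) \<sqsubseteq>\<^bsub>M\<^esub> y \<longleftrightarrow> (\<forall>x \<in> X. f x \<sqsubseteq>\<^bsub>M\<^esub> y)"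
    using L.lub_le_iff[OF X g[OF y]] X y by (simp add: adj L.lub_closed subset_iff)
qed

lemma sup_map_comp:
  assumes f: "sup_map L M f" and g: "sup_map M N g"
  shows "sup_map L N (\<lambda>x. g (f x))"
proof -
  have "g (f (\<Squnion>\<^bsub>L\<^esub> X)) = \<Squnion>\<^bsub>N\<^esub> ((\<lambda>x. g (f x)) ` X)" if X: "X \<subseteq> carrier L" for X
  proof -
    have "f ` X \<subseteq> carrier M" using f X by (auto intro: sup_map_closed)
    then show ?thesis
      using sup_map_lub[OF f X] sup_map_lub[OF g] by (simp add: image_image)
  qed
  then show ?thesis using f g by (auto simp: sup_map_def sup_pres_def)
qed

lemma sup_map_cong:
  assumes "\<And>x. x \<in> carrier L \<Longrightarrow> f x = g x"
  shows "sup_map L M f \<longleftrightarrow> sup_map L M g"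
proof -
  have "sup_map L M g" if f: "sup_map L M f" and eq: "\<And>x. x \<in> carrier L \<Longrightarrow> f x = g x" for f g
  proof (rule sup_mapI[OF sup_map_complete_lattice[OF f]])
    interpret L: complete_lattice L by (rule sup_map_complete_lattice[OF f])
    show "g x \<in> carrier M" if "x \<in> carrier L" for x
      using sup_map_closed[OF f that] eq[OF that] by simp
    show "g (\<Squnion>\<^bsub>L\<^esub> X) \<sqsubseteq>\<^bsub>M\<^esub> y \<longleftrightarrow> (\<forall>x \<in> X. g x \<sqsubseteq>\<^bsub>M\<^esub> y)"
      if "X \<subseteq> carrier L" "y \<in> carrier M" for X y
      using sup_map_lub_le_iff[OF f that] eq L.lub_closed[OF that(1)] that by (metis subsetD)
  qed
  from this[of f g] this[of g f] assms show ?thesis by metis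
qed

lemma sup_map_restrict [simp]: "sup_map L M (restrict f (carrier L)) \<longleftrightarrow> sup_map L M f"
  by (rule sup_map_cong) simp

lemma sup_map_ident: "complete_lattice L \<Longrightarrow> sup_map L L (\<lambda>x. x)"
  by (simp add: sup_map_def sup_pres_def)

lemma sup_map_mono:
  assumes f: "sup_map L M f" and xy: "x \<in> carrier L" "y \<in> carrier L" "x \<sqsubseteq>\<^bsub>L\<^esub> y"
  shows "f x \<sqsubseteq>\<^bsub>M\<^esub> f y"
proof -
  interpret L: complete_lattice L by (rule sup_map_complete_lattice[OF f])
  interpret M: complete_lattice M by (rule sup_map_complete_lattice[OF f])
  have sub: "{x, y} \<subseteq> carrier L" using xy by simp
  show ?thesis
    using L.lub_pair_eq[OF xy] sup_map_lub_le_iff[OF f sub, of "f y"] xy sup_map_closed[OF f, of y] by auto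
qed

text \<open>Suprema commute with suprema. This gives the lattice structure on homomorphisms and also
  the dependence on a parameter in \<open>sup_tensor_param_lift\<close>.\<close>

lemma sup_map_SUP:
  assumes L: "complete_lattice L" and M: "complete_lattice M"
    and f: "\<And>i. i \<in> I \<Longrightarrow> sup_map L M (f i)"
  shows "sup_map L M (\<lambda>x. \<Squnion>\<^bsub>M\<^esub> ((\<lambda>i. f i x) ` I))"
proof (rule sup_mapI[OF L M])
  interpret L: complete_lattice L by fact
  interpret M: complete_lattice M by fact
  have sub: "(\<lambda>i. f i x) ` I \<subseteq> carrier M" if "x \<in> carrier L" for x
    using f that by (auto intro: sup_map_closed)
  show "\<Squnion>\<^bsub>M\<^esub> ((\<lambda>i. f i x) ` I) \<in> carrier M" if "x \<in> carrier L" for x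
    using sub[OF that] by (rule M.lub_closed)
  fix X y assume X: "X \<subseteq> carrier L" and y: "y \<in> carrier M"
  have "\<Squnion>\<^bsub>M\<^esub> ((\<lambda>i. f i (\<Squnion>\<^bsub>L\<^esub> X)) ` I) \<sqsubseteq>\<^bsub>M\<^esub> y \<longleftrightarrow> (\<forall>i \<in> I. f i (\<Squnion>\<^bsub>L\<^esub> X) \<sqsubseteq>\<^bsub>M\<^esub> y)"
    using M.lub_le_iff[OF sub[OF L.lub_closed[OF X]] y] by auto
  also have "\<dots> \<longleftrightarrow> (\<forall>i \<in> I. \<forall>x \<in> X. f i x \<sqsubseteq>\<^bsub>M\<^esub> y)"
    by (simp add: sup_map_lub_le_iff[OF f X y])
  also have "\<dots> \<longleftrightarrow> (\<forall>x \<in> X. \<Squnion>\<^bsub>M\<^esub> ((\<lambda>i. f i x) ` I) \<sqsubseteq>\<^bsub>M\<^esub> y)"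
    using M.lub_le_iff[OF sub y] X by (auto simp: subset_iff)
  finally show "\<Squnion>\<^bsub>M\<^esub> ((\<lambda>i. f i (\<Squnion>\<^bsub>L\<^esub> X)) ` I) \<sqsubseteq>\<^bsub>M\<^esub> y
      \<longleftrightarrow> (\<forall>x \<in> X. \<Squnion>\<^bsub>M\<^esub> ((\<lambda>i. f i x) ` I) \<sqsubseteq>\<^bsub>M\<^esub> y)" .
qed

lemma sup_map_inv_into:
  assumes f: "sup_map L M f" and bij: "bij_betw f (carrier L) (carrier M)"
  shows "sup_map M L (inv_into (carrier L) f)"
proof -
  let ?g = "inv_into (carrier L) f"
  interpret L: complete_lattice L by (rule sup_map_complete_lattice[OF f])
  have g: "?g y \<in> carrier L" "f (?g y) = y" if "y \<in> carrier M" for y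
    using bij that by (auto simp: bij_betw_def inv_into_into f_inv_into_f)
  have "?g (\<Squnion>\<^bsub>M\<^esub> Y) = \<Squnion>\<^bsub>L\<^esub> (?g ` Y)" if Y: "Y \<subseteq> carrier M" for Y
  proof -
    have sub: "?g ` Y \<subseteq> carrier L" using g Y by auto
    have "f ` ?g ` Y = Y" using Y by (simp add: image_image g(2) subset_iff)
    then have "f (\<Squnion>\<^bsub>L\<^esub> (?g ` Y)) = \<Squnion>\<^bsub>M\<^esub> Y" using sup_map_lub[OF f sub] by simp
    then show ?thesis
      using bij L.lub_closed[OF sub] by (metis bij_betw_def inv_into_f_f)
  qed
  then show ?thesis
    using g sup_map_complete_lattice[OF f] by (simp add: sup_map_def sup_pres_def)
qed

lemma sup_bimapI:
  assumes "\<And>x. x \<in> carrier L \<Longrightarrow> sup_map M N (f x)"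
    and "\<And>y. y \<in> carrier M \<Longrightarrow> sup_map L N (\<lambda>x. f x y)"
  shows "sup_bimap L M N f"
  using assms by (simp add: sup_bimap_def)

lemma sup_bimapD:
  assumes "sup_bimap L M N f"
  shows "x \<in> carrier L \<Longrightarrow> sup_map M N (f x)" "y \<in> carrier M \<Longrightarrow> sup_map L N (\<lambda>x. f x y)"
  using assms by (simp_all add: sup_bimap_def)

lemma sup_bimap_closed:
  "sup_bimap L M N f \<Longrightarrow> x \<in> carrier L \<Longrightarrow> y \<in> carrier M \<Longrightarrow> f x y \<in> carrier N"
  by (blast dest: sup_bimapD sup_map_closed)

section \<open>Size bounds and copies of lattices inside the universe\<close>

lemma strong_limit_infinite:
  assumes sl: "strong_limit_type TYPE('u)"
  shows "infinite (UNIV :: 'u set)"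
proof
  assume fin: "finite (UNIV :: 'u set)"
  \<comment> \<open>Removing one point from a type with \<open>n\<close> elements leaves
    \<open>n - 1\<close>, and \<open>n \<le> 2 ^ (n - 1)\<close>. So no finite type satisfies the
    strong limit condition, not even for \<open>n = 1\<close>.\<close>
  obtain X :: "'u set" where X: "card X = card (UNIV :: 'u set) - 1"
    by (metis card_Diff_singleton UNIV_I)
  have finX: "finite X" using fin by (rule finite_subset[rotated]) simp
  have pos: "card (UNIV :: 'u set) > 0" using fin by (simp add: card_gt_0_iff)
  have "X \<prec> (UNIV :: 'u set)"
    unfolding lesspoll_def
  proof
    show "X \<lesssim> (UNIV :: 'u set)" by (simp add: subset_imp_lepoll)
    show "\<not> X \<approx> (UNIV :: 'u set)" using eqpoll_iff_card[OF finX fin] X pos by simp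
  qed
  then have "Pow X \<prec> (UNIV :: 'u set)" using sl by (simp add: strong_limit_type_def)
  then have "\<not> card (UNIV :: 'u set) \<le> card (Pow X)"
    using lepoll_iff_card_le[OF fin] finX by (metis finite_Pow_iff lepoll_antisym lesspoll_def)
  moreover have "card (UNIV :: 'u set) \<le> 2 ^ (card (UNIV :: 'u set) - 1)"
    using less_exp[of "card (UNIV :: 'u set) - 1"] pos by linarith
  ultimately show False using X finX by (simp add: card_Pow)
qed

text \<open>The hypothesis speaks of subsets of \<open>'u\<close> only, whereas the product lives in
  another type. If the larger factor is infinite, its square is equipollent to it, so its own
  powerset bounds everything; if it is finite, the infinity of \<open>'u\<close> suffices.\<close>

lemma lesspoll_Pow_Times:
  fixes X Y :: "'u set"
  assumes sl: "strong_limit_type TYPE('u)" and X: "small X" and Y: "small Y"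
  shows "Pow (X \<times> Y) \<prec> (UNIV :: 'u set)"
proof -
  have main: "Pow (X \<times> Y) \<prec> (UNIV :: 'u set)" "Pow (Y \<times> X) \<prec> (UNIV :: 'u set)"
    if X: "small X" and YX: "Y \<lesssim> X" for X Y :: "'u set"
  proof -
    have "Pow (X \<times> X) \<prec> (UNIV :: 'u set)"
    proof (cases "finite X")
      case True
      then show ?thesis using strong_limit_infinite[OF sl] by (simp add: finite_lesspoll_infinite)
    next
      case False
      then have "X \<times> X \<approx> X"
        by (simp add: card_of_Times_same_infinite eqpoll_iff_card_of_ordIso)
      then have "Pow (X \<times> X) \<lesssim> Pow X"
        by (meson bij_betw_Pow eqpoll_def eqpoll_imp_lepoll)
      then show ?thesis
        using X sl by (auto simp: small_def strong_limit_type_def intro: lesspoll_trans1)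
    qed
    moreover have "X \<times> Y \<lesssim> X \<times> X" "Y \<times> X \<lesssim> X \<times> X"
      using YX by (simp_all add: times_lepoll_mono)
    then have "Pow (X \<times> Y) \<lesssim> Pow (X \<times> X)" "Pow (Y \<times> X) \<lesssim> Pow (X \<times> X)"
      by (meson lepoll_def image_Pow_mono inj_on_image_Pow)+
    ultimately show "Pow (X \<times> Y) \<prec> (UNIV :: 'u set)" "Pow (Y \<times> X) \<prec> (UNIV :: 'u set)"
      by (meson lesspoll_trans1)+
  qed
  \<comment> \<open>Comparability of cardinals decides which factor is the larger one; this is why
    \<open>main\<close> treats both orders of the product.\<close>
  have "Y \<lesssim> X \<or> X \<lesssim> Y"
    by (metis card_of_ordLeq lepoll_def ordLeq_total card_of_Well_order)
  then show ?thesis using main X Y by blast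
qed

text \<open>A lattice can be built on any convenient type, such as sets of pairs or functions, and
  then copied along an injection into \<open>'u\<close>. Later arguments see only the decoding
  bijection \<open>dec\<close>.\<close>

lemma suplattice_encoding:
  fixes P :: "'b set" and r :: "'b \<Rightarrow> 'b \<Rightarrow> bool"
  assumes P: "P \<prec> (UNIV :: 'u set)"
    and refl: "\<And>x. x \<in> P \<Longrightarrow> r x x"
    and antisym: "\<And>x y. x \<in> P \<Longrightarrow> y \<in> P \<Longrightarrow> r x y \<Longrightarrow> r y x \<Longrightarrow> x = y"
    and trans: "\<And>x y z. x \<in> P \<Longrightarrow> y \<in> P \<Longrightarrow> z \<in> P \<Longrightarrow> r x y \<Longrightarrow> r y z \<Longrightarrow> r x z"
    and lub: "\<And>X. X \<subseteq> P \<Longrightarrow> \<exists>s \<in> P. \<forall>y \<in> P. r s y \<longleftrightarrow> (\<forall>x \<in> X. r x y)"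
  obtains L :: "'u gorder" and dec where
    "suplattice L" "bij_betw dec (carrier L) P"
    "\<And>x y. x \<in> carrier L \<Longrightarrow> y \<in> carrier L \<Longrightarrow> x \<sqsubseteq>\<^bsub>L\<^esub> y \<longleftrightarrow> r (dec x) (dec y)"
proof -
  obtain enc :: "'b \<Rightarrow> 'u" where inj: "inj_on enc P"
    using P by (auto simp: lesspoll_def lepoll_def)
  define dec where "dec = inv_into P enc"
  define L :: "'u gorder" where "L = \<lparr>carrier = enc ` P, eq = (=), le = (\<lambda>x y. r (dec x) (dec y))\<rparr>"
  have dec_enc [simp]: "dec (enc p) = p" if "p \<in> P" for p
    using inj that by (simp add: dec_def)
  interpret L: partial_order L
  proof
    show "(.=\<^bsub>L\<^esub>) = (=)" by (simp add: L_def)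
  qed (auto simp: L_def refl intro: trans dest: antisym)
  have "complete_lattice L"
  proof (rule L.complete_lattice_by_lubs)
    fix X assume "X \<subseteq> carrier L"
    then obtain Y where Y: "X = enc ` Y" "Y \<subseteq> P" by (auto simp: L_def subset_image_iff)
    obtain s where "s \<in> P" "\<forall>y \<in> P. r s y \<longleftrightarrow> (\<forall>x \<in> Y. r x y)" using lub[OF Y(2)] by blast
    then show "\<exists>s \<in> carrier L. \<forall>y \<in> carrier L. s \<sqsubseteq>\<^bsub>L\<^esub> y \<longleftrightarrow> (\<forall>x \<in> X. x \<sqsubseteq>\<^bsub>L\<^esub> y)"
      using Y by (intro bexI[of _ "enc s"]) (auto simp: L_def subset_iff)
  qed
  moreover have "small (carrier L)"
    using P inj by (simp add: L_def small_def)
  moreover have "bij_betw dec (carrier L) P"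
    using inj by (simp add: L_def dec_def inj_on_imp_bij_betw bij_betw_inv_into)
  ultimately show ?thesis
    by (intro that[of L dec]) (simp_all add: suplattice_def L_def)
qed

section \<open>Modules over quantales\<close>

lemma suplattice_complete_lattice: "suplattice L \<Longrightarrow> complete_lattice L"
  by (simp add: suplattice_def)

lemma unital_quantaleD:
  assumes "unital_quantale Q"
  shows "suplattice Q" "complete_lattice Q" "qunit Q \<in> carrier Q" "sup_bimap Q Q Q (qmult Q)"
    and "x \<in> carrier Q \<Longrightarrow> sup_map Q Q (qmult Q x)"
    and "x \<in> carrier Q \<Longrightarrow> sup_map Q Q (\<lambda>y. qmult Q y x)"
    and "x \<in> carrier Q \<Longrightarrow> y \<in> carrier Q \<Longrightarrow> qmult Q x y \<in> carrier Q"
    and "x \<in> carrier Q \<Longrightarrow> y \<in> carrier Q \<Longrightarrow> z \<in> carrier Q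
      \<Longrightarrow> qmult Q (qmult Q x y) z = qmult Q x (qmult Q y z)"
    and "x \<in> carrier Q \<Longrightarrow> qmult Q (qunit Q) x = x"
    and "x \<in> carrier Q \<Longrightarrow> qmult Q x (qunit Q) = x"
  using assms sup_bimap_closed[of Q Q Q "qmult Q"]
  by (auto simp: unital_quantale_def sup_bimap_def suplattice_def)

lemma qmoduleD:
  assumes "is_qmodule A"
  shows "unital_quantale (lquant A)" "unital_quantale (rquant A)"
    and "suplattice A" "complete_lattice A"
    and "sup_bimap (lquant A) A A (lact A)" "sup_bimap A (rquant A) A (ract A)"
  using assms by (auto simp: is_qmodule_def suplattice_def)

lemma lact_closed:
  "is_qmodule A \<Longrightarrow> q \<in> carrier (lquant A) \<Longrightarrow> a \<in> carrier A \<Longrightarrow> lact A q a \<in> carrier A"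
  by (meson qmoduleD(5) sup_bimap_closed)

lemma ract_closed:
  "is_qmodule A \<Longrightarrow> a \<in> carrier A \<Longrightarrow> r \<in> carrier (rquant A) \<Longrightarrow> ract A a r \<in> carrier A"
  by (meson qmoduleD(6) sup_bimap_closed)

lemma sup_map_lact:
  assumes "is_qmodule A"
  shows "q \<in> carrier (lquant A) \<Longrightarrow> sup_map A A (lact A q)"
    and "a \<in> carrier A \<Longrightarrow> sup_map (lquant A) A (\<lambda>q. lact A q a)"
  using qmoduleD(5)[OF assms] by (auto dest: sup_bimapD)

lemma sup_map_ract:
  assumes "is_qmodule A"
  shows "r \<in> carrier (rquant A) \<Longrightarrow> sup_map A A (\<lambda>a. ract A a r)"
    and "a \<in> carrier A \<Longrightarrow> sup_map (rquant A) A (ract A a)"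
  using qmoduleD(6)[OF assms] by (auto dest: sup_bimapD)

lemma lact_qmult:
  "is_qmodule A \<Longrightarrow> q \<in> carrier (lquant A) \<Longrightarrow> q' \<in> carrier (lquant A) \<Longrightarrow> a \<in> carrier A
    \<Longrightarrow> lact A (qmult (lquant A) q q') a = lact A q (lact A q' a)"
  by (simp add: is_qmodule_def)

lemma ract_qmult:
  "is_qmodule A \<Longrightarrow> a \<in> carrier A \<Longrightarrow> r \<in> carrier (rquant A) \<Longrightarrow> r' \<in> carrier (rquant A)
    \<Longrightarrow> ract A a (qmult (rquant A) r r') = ract A (ract A a r) r'"
  by (simp add: is_qmodule_def)

lemma lact_qunit: "is_qmodule A \<Longrightarrow> a \<in> carrier A \<Longrightarrow> lact A (qunit (lquant A)) a = a"
  by (simp add: is_qmodule_def)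

lemma ract_qunit: "is_qmodule A \<Longrightarrow> a \<in> carrier A \<Longrightarrow> ract A a (qunit (rquant A)) = a"
  by (simp add: is_qmodule_def)

lemma lact_ract:
  "is_qmodule A \<Longrightarrow> q \<in> carrier (lquant A) \<Longrightarrow> a \<in> carrier A \<Longrightarrow> r \<in> carrier (rquant A)
    \<Longrightarrow> ract A (lact A q a) r = lact A q (ract A a r)"
  by (simp add: is_qmodule_def)

lemma id_qmodule_simps [simp]:
  "carrier (id_qmodule Q) = carrier Q" "le (id_qmodule Q) = le Q" "eq (id_qmodule Q) = eq Q"
  "lquant (id_qmodule Q) = Q" "rquant (id_qmodule Q) = Q"
  "lact (id_qmodule Q) = qmult Q" "ract (id_qmodule Q) = qmult Q"
  by (simp_all add: id_qmodule_def)

lemma sup_map_id_qmodule [simp]: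
  "sup_map (id_qmodule Q) M f \<longleftrightarrow> sup_map Q M f"
  "sup_map M (id_qmodule Q) f \<longleftrightarrow> sup_map M Q f"
  by (rule sup_map_cong_order; simp)+

lemma suplattice_id_qmodule [simp]: "suplattice (id_qmodule Q) \<longleftrightarrow> suplattice Q"
  by (rule suplattice_cong_order) simp_all

lemma is_qmodule_id_qmodule: "unital_quantale Q \<Longrightarrow> is_qmodule (id_qmodule Q)"
  by (simp add: is_qmodule_def sup_bimap_def unital_quantaleD)

text \<open>
  \<open>lin A B f\<close>: \<open>f\<close> restricts to a module homomorphism; unlike in \<open>is_qmodule_hom\<close>, its values
  outside the carrier are arbitrary.
\<close>

definition lin :: "'u qmodule \<Rightarrow> 'u qmodule \<Rightarrow> ('u \<Rightarrow> 'u) \<Rightarrow> bool" where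
  "lin A B f \<longleftrightarrow>
     is_qmodule A \<and> is_qmodule B \<and> lquant A = lquant B \<and> rquant A = rquant B \<and> sup_map A B f \<and>
     (\<forall>q \<in> carrier (lquant A). \<forall>a \<in> carrier A. f (lact A q a) = lact B q (f a)) \<and>
     (\<forall>a \<in> carrier A. \<forall>r \<in> carrier (rquant A). f (ract A a r) = ract B (f a) r)"

lemma linD:
  assumes "lin A B f"
  shows "is_qmodule A" "is_qmodule B" "lquant B = lquant A" "rquant B = rquant A" "sup_map A B f"
    and "a \<in> carrier A \<Longrightarrow> f a \<in> carrier B"
    and "q \<in> carrier (lquant A) \<Longrightarrow> a \<in> carrier A \<Longrightarrow> f (lact A q a) = lact B q (f a)"
    and "a \<in> carrier A \<Longrightarrow> r \<in> carrier (rquant A) \<Longrightarrow> f (ract A a r) = ract B (f a) r"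
  using assms by (auto simp: lin_def intro: sup_map_closed)

lemma lin_cong:
  assumes "\<And>a. a \<in> carrier A \<Longrightarrow> f a = g a"
  shows "lin A B f \<longleftrightarrow> lin A B g"
  using sup_map_cong[of A f g B] assms unfolding lin_def
  by (auto simp: lact_closed ract_closed)

lemma lin_restrict [simp]: "lin A B (restrict f (carrier A)) \<longleftrightarrow> lin A B f"
  by (rule lin_cong) simp

lemma lin_ident: "is_qmodule A \<Longrightarrow> lin A A (\<lambda>a. a)"
  by (simp add: lin_def sup_map_ident qmoduleD)

lemma lin_comp: "lin A B f \<Longrightarrow> lin B C g \<Longrightarrow> lin A C (\<lambda>a. g (f a))"
  by (auto simp: lin_def intro: sup_map_comp dest: sup_map_closed)

lemma lin_inv_into:
  assumes f: "lin A B f" and bij: "bij_betw f (carrier A) (carrier B)"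
  shows "lin B A (inv_into (carrier A) f)"
proof -
  let ?g = "inv_into (carrier A) f"
  note [simp] = linD[OF f]
  have g: "?g b \<in> carrier A" "f (?g b) = b" if "b \<in> carrier B" for b
    using bij that by (auto simp: bij_betw_def inv_into_into f_inv_into_f)
  have g': "?g b = a" if "a \<in> carrier A" "f a = b" for a b
    using bij that by (auto simp: bij_betw_def)
  show ?thesis
    unfolding lin_def
    using sup_map_inv_into[OF _ bij]
    by (auto intro!: g' simp: g lact_closed ract_closed)
qed

definition qhom_of :: "'u qmodule \<Rightarrow> 'u qmodule \<Rightarrow> ('u \<Rightarrow> 'u) \<Rightarrow> 'u qmodule_hom" where
  "qhom_of A B f = \<lparr>hdom = A, hcod = B, hmap = restrict f (carrier A)\<rparr>"

lemma qhom_of_simps [simp]: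
  "hdom (qhom_of A B f) = A" "hcod (qhom_of A B f) = B"
  "hmap (qhom_of A B f) = restrict f (carrier A)"
  by (simp_all add: qhom_of_def)

lemma is_qmodule_hom_iff_lin:
  "is_qmodule_hom f \<longleftrightarrow> lin (hdom f) (hcod f) (hmap f) \<and> hmap f \<in> extensional (carrier (hdom f))"
  by (auto simp: is_qmodule_hom_def lin_def)

lemma qmodule_homsD:
  assumes "f \<in> qmodule_homs A B"
  shows "lin A B (hmap f)" "hdom f = A" "hcod f = B" "hmap f \<in> extensional (carrier A)"
  using assms by (auto simp: qmodule_homs_def is_qmodule_hom_iff_lin)

lemma qhom_of_in_qmodule_homs [simp]: "qhom_of A B f \<in> qmodule_homs A B \<longleftrightarrow> lin A B f"
  by (simp add: qmodule_homs_def is_qmodule_hom_iff_lin)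

lemma qmodule_homs_eqI:
  assumes "f \<in> qmodule_homs A B" "g \<in> qmodule_homs A B"
    and "\<And>a. a \<in> carrier A \<Longrightarrow> hmap f a = hmap g a"
  shows "f = g"
proof -
  have "hmap f = hmap g"
    using assms qmodule_homsD(4) by (blast intro: extensionalityI)
  then show ?thesis using assms qmodule_homsD(2,3) by (metis (full_types) qmodule_hom.surjective old.unit.exhaust)
qed


section \<open>Tensor products\<close>

lemma balancedD:
  assumes "balanced A C L f"
  shows "sup_bimap A C L f"
    and "a \<in> carrier A \<Longrightarrow> sup_map C L (f a)" "c \<in> carrier C \<Longrightarrow> sup_map A L (\<lambda>a. f a c)"
    and "a \<in> carrier A \<Longrightarrow> c \<in> carrier C \<Longrightarrow> f a c \<in> carrier L"
    and "a \<in> carrier A \<Longrightarrow> r \<in> carrier (rquant A) \<Longrightarrow> c \<in> carrier C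
      \<Longrightarrow> f (ract A a r) c = f a (lact C r c)"
  using assms sup_bimap_closed[of A C L f] by (auto simp: balanced_def dest: sup_bimapD)

lemma balancedI:
  assumes "\<And>a. a \<in> carrier A \<Longrightarrow> sup_map C L (f a)"
    and "\<And>c. c \<in> carrier C \<Longrightarrow> sup_map A L (\<lambda>a. f a c)"
    and "\<And>a r c. a \<in> carrier A \<Longrightarrow> r \<in> carrier (rquant A) \<Longrightarrow> c \<in> carrier C
      \<Longrightarrow> f (ract A a r) c = f a (lact C r c)"
  shows "balanced A C L f"
  using assms by (simp add: balanced_def sup_bimap_def)

lemma balanced_comp: "balanced A C L f \<Longrightarrow> sup_map L M g \<Longrightarrow> balanced A C M (\<lambda>a c. g (f a c))"
  by (intro balancedI) (auto dest: balancedD intro: sup_map_comp)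

lemma balanced_truncate [simp]: "balanced A C (gorder.truncate L) f \<longleftrightarrow> balanced A C L f"
  by (simp add: balanced_def sup_bimap_def)

text \<open>The universal property of \<open>is_tensor\<close> stripped of the outer actions, for
  any record extension of the lattice. It makes sense before the actions exist, and their
  construction relies on it.\<close>

definition sup_tensor ::
  "'u qmodule \<Rightarrow> 'u qmodule \<Rightarrow> ('u, 'x) gorder_scheme \<Rightarrow> ('u \<Rightarrow> 'u \<Rightarrow> 'u) \<Rightarrow> bool" where
  "sup_tensor A C T t \<longleftrightarrow>
     suplattice T \<and> balanced A C T t \<and>
     (\<forall>L :: 'u gorder. \<forall>f. suplattice L \<and> balanced A C L f \<longrightarrow>
        (\<exists>!h. h \<in> extensional (carrier T) \<and> sup_map T L h \<and>
              (\<forall>a \<in> carrier A. \<forall>c \<in> carrier C. h (t a c) = f a c)))"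

lemma sup_tensorD:
  assumes "sup_tensor A C T t"
  shows "suplattice T" "complete_lattice T" "balanced A C T t"
  using assms by (auto simp: sup_tensor_def suplattice_def)

lemma sup_tensor_universal:
  assumes T: "sup_tensor A C T t" and M: "suplattice M" and f: "balanced A C M f"
  shows "\<exists>!h. h \<in> extensional (carrier T) \<and> sup_map T M h \<and>
    (\<forall>a \<in> carrier A. \<forall>c \<in> carrier C. h (t a c) = f a c)"
proof -
  have "\<forall>L :: 'a gorder. \<forall>f. suplattice L \<and> balanced A C L f \<longrightarrow>
      (\<exists>!h. h \<in> extensional (carrier T) \<and> sup_map T L h \<and>
        (\<forall>a \<in> carrier A. \<forall>c \<in> carrier C. h (t a c) = f a c))"
    using T by (simp add: sup_tensor_def)
  from spec[OF spec[OF this, of "gorder.truncate M"], of f] show ?thesis using M f by simp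
qed

lemma sup_tensor_lift:
  assumes "sup_tensor A C T t" "suplattice M" "balanced A C M f"
  obtains h where "sup_map T M h"
    "\<And>a c. a \<in> carrier A \<Longrightarrow> c \<in> carrier C \<Longrightarrow> h (t a c) = f a c"
  using sup_tensor_universal[OF assms] by blast

text \<open>The uniqueness half of the universal property, applied to the balanced map obtained by
  composing \<open>g\<close> with \<open>t\<close>. Uniqueness holds among extensional functions, so
  both maps are first restricted to the carrier.\<close>

lemma sup_tensor_ext:
  assumes T: "sup_tensor A C T t" and M: "suplattice M"
    and g: "sup_map T M g" and h: "sup_map T M h"
    and eq: "\<And>a c. a \<in> carrier A \<Longrightarrow> c \<in> carrier C \<Longrightarrow> g (t a c) = h (t a c)"
    and u: "u \<in> carrier T"
  shows "g u = h u"
proof -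
  let ?T = "carrier T"
  have t: "t a c \<in> carrier T" if "a \<in> carrier A" "c \<in> carrier C" for a c
    using balancedD(4)[OF sup_tensorD(3)[OF T]] that by simp
  let ?P = "\<lambda>k. k \<in> extensional ?T \<and> sup_map T M k \<and>
    (\<forall>a \<in> carrier A. \<forall>c \<in> carrier C. k (t a c) = g (t a c))"
  have "\<exists>!k. ?P k"
    using sup_tensor_universal[OF T M balanced_comp[OF sup_tensorD(3)[OF T] g]] .
  moreover have "?P (restrict g ?T)" "?P (restrict h ?T)" using g h eq t by simp_all
  ultimately have "restrict g ?T = restrict h ?T" by blast
  then show ?thesis using u by (metis restrict_apply')
qed

text \<open>Lift separately for each \<open>d\<close>, then recover preservation of suprema in
  \<open>d\<close> from uniqueness. For outer actions the parameter is the scalar; for threefold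
  tensors it is the remaining module element.\<close>

lemma sup_tensor_param_lift:
  assumes T: "sup_tensor A C T t" and M: "suplattice M" and D: "complete_lattice D"
    and f: "\<And>d. d \<in> carrier D \<Longrightarrow> balanced A C M (\<lambda>a c. f a c d)"
    and fD: "\<And>a c. a \<in> carrier A \<Longrightarrow> c \<in> carrier C \<Longrightarrow> sup_map D M (f a c)"
  obtains k where "sup_bimap T D M k"
    "\<And>a c d. a \<in> carrier A \<Longrightarrow> c \<in> carrier C \<Longrightarrow> d \<in> carrier D \<Longrightarrow> k (t a c) d = f a c d"
proof -
  interpret D: complete_lattice D by fact
  note MC = suplattice_complete_lattice[OF M] and TC = sup_tensorD(2)[OF T]
  interpret M: complete_lattice M by (rule MC)
  have "\<exists>h. sup_map T M h \<and> (\<forall>a \<in> carrier A. \<forall>c \<in> carrier C. h (t a c) = f a c d)"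
    if "d \<in> carrier D" for d
    by (rule sup_tensor_lift[OF T M f[OF that]]) blast
  then obtain k where k: "\<And>d. d \<in> carrier D \<Longrightarrow> sup_map T M (k d)"
    and kt: "\<And>a c d. d \<in> carrier D \<Longrightarrow> a \<in> carrier A \<Longrightarrow> c \<in> carrier C \<Longrightarrow> k d (t a c) = f a c d"
    by metis
  have "sup_map D M (\<lambda>d. k d u)" if u: "u \<in> carrier T" for u
  proof (rule sup_mapI[OF D MC])
    show "k d u \<in> carrier M" if "d \<in> carrier D" for d
      using sup_map_closed[OF k[OF that] u] .
    fix X y assume X: "X \<subseteq> carrier D" and y: "y \<in> carrier M"
    have DX: "\<Squnion>\<^bsub>D\<^esub> X \<in> carrier D" using X by (rule D.lub_closed)
    \<comment> \<open>As a function of \<open>u\<close> the right side is a pointwise supremum of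
      sup-preserving maps, so both sides can be compared on pure tensors, where the claim is
      \<open>fD\<close>.\<close>
    have "k (\<Squnion>\<^bsub>D\<^esub> X) u = \<Squnion>\<^bsub>M\<^esub> ((\<lambda>d. k d u) ` X)"
    proof (rule sup_tensor_ext[OF T M k[OF DX] sup_map_SUP[OF TC MC] _ u])
      show "sup_map T M (k d)" if "d \<in> X" for d using X that by (intro k) blast
      fix a c assume ac: "a \<in> carrier A" "c \<in> carrier C"
      have "(\<lambda>d. k d (t a c)) ` X = f a c ` X" using X ac kt by (intro image_cong) auto
      then show "k (\<Squnion>\<^bsub>D\<^esub> X) (t a c) = \<Squnion>\<^bsub>M\<^esub> ((\<lambda>d. k d (t a c)) ` X)"
        using sup_map_lub[OF fD[OF ac] X] kt[OF DX ac] by simp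
    qed
    moreover have "(\<lambda>d. k d u) ` X \<subseteq> carrier M" using X k u by (auto intro: sup_map_closed)
    ultimately show "k (\<Squnion>\<^bsub>D\<^esub> X) u \<sqsubseteq>\<^bsub>M\<^esub> y \<longleftrightarrow> (\<forall>d \<in> X. k d u \<sqsubseteq>\<^bsub>M\<^esub> y)"
      using M.lub_le_iff y by simp
  qed
  then show ?thesis
    using k kt by (intro that[of "\<lambda>u d. k d u"]) (auto intro: sup_bimapI)
qed

text \<open>
  The tensor product is the lattice of the sets \<open>S \<subseteq> A \<times> C\<close> with this property, ordered by
  inclusion: the pure tensor of \<open>a\<close> and \<open>c\<close> is the least such set containing \<open>(a, c)\<close>, and a balanced
  map \<open>f\<close> corresponds to the sup-preserving map whose right adjoint is \<open>y \<mapsto> {(a, c). f a c \<le> y}\<close>.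
\<close>

definition bi_ideal :: "'u qmodule \<Rightarrow> 'u qmodule \<Rightarrow> ('u \<times> 'u) set \<Rightarrow> bool" where
  "bi_ideal A C S \<longleftrightarrow> S \<subseteq> carrier A \<times> carrier C \<and>
     (\<forall>X c. X \<subseteq> carrier A \<longrightarrow> c \<in> carrier C \<longrightarrow> (\<Squnion>\<^bsub>A\<^esub> X, c) \<in> S \<longleftrightarrow> (\<forall>x \<in> X. (x, c) \<in> S)) \<and>
     (\<forall>a Y. a \<in> carrier A \<longrightarrow> Y \<subseteq> carrier C \<longrightarrow> (a, \<Squnion>\<^bsub>C\<^esub> Y) \<in> S \<longleftrightarrow> (\<forall>y \<in> Y. (a, y) \<in> S)) \<and>
     (\<forall>a \<in> carrier A. \<forall>r \<in> carrier (rquant A). \<forall>c \<in> carrier C.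
        (ract A a r, c) \<in> S \<longleftrightarrow> (a, lact C r c) \<in> S)"

text \<open>Each closure clause of \<open>bi_ideal\<close> is an equivalence between memberships and
  therefore survives intersection. The explicit factor \<open>carrier A \<times> carrier C\<close>
  takes care of an empty family, whose intersection would be everything.\<close>

lemma bi_ideal_Inter:
  assumes A: "is_qmodule A" and C: "is_qmodule C" and AC: "rquant A = lquant C"
    and F: "\<And>S. S \<in> F \<Longrightarrow> bi_ideal A C S"
  shows "bi_ideal A C ((carrier A \<times> carrier C) \<inter> \<Inter>F)"
proof -
  interpret A: complete_lattice A using A by (rule qmoduleD)
  interpret C: complete_lattice C using C by (rule qmoduleD)
  let ?S = "(carrier A \<times> carrier C) \<inter> \<Inter>F"
  have "(\<Squnion>\<^bsub>A\<^esub> X, c) \<in> ?S \<longleftrightarrow> (\<forall>x \<in> X. (x, c) \<in> ?S)"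
    if X: "X \<subseteq> carrier A" and c: "c \<in> carrier C" for X c
  proof -
    have "(\<Squnion>\<^bsub>A\<^esub> X, c) \<in> S \<longleftrightarrow> (\<forall>x \<in> X. (x, c) \<in> S)" if "S \<in> F" for S
      using F[OF that] X c by (simp add: bi_ideal_def)
    then show ?thesis using A.lub_closed[OF X] X c by auto
  qed
  moreover have "(a, \<Squnion>\<^bsub>C\<^esub> Y) \<in> ?S \<longleftrightarrow> (\<forall>y \<in> Y. (a, y) \<in> ?S)"
    if Y: "Y \<subseteq> carrier C" and a: "a \<in> carrier A" for Y a
  proof -
    have "(a, \<Squnion>\<^bsub>C\<^esub> Y) \<in> S \<longleftrightarrow> (\<forall>y \<in> Y. (a, y) \<in> S)" if "S \<in> F" for S
      using F[OF that] Y a by (simp add: bi_ideal_def)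
    then show ?thesis using C.lub_closed[OF Y] Y a by auto
  qed
  moreover have "(ract A a r, c) \<in> ?S \<longleftrightarrow> (a, lact C r c) \<in> ?S"
    if *: "a \<in> carrier A" "r \<in> carrier (rquant A)" "c \<in> carrier C" for a r c
  proof -
    have "(ract A a r, c) \<in> S \<longleftrightarrow> (a, lact C r c) \<in> S" if "S \<in> F" for S
      using F[OF that] * by (simp add: bi_ideal_def)
    then show ?thesis using A C AC * by (auto simp: lact_closed ract_closed)
  qed
  ultimately show ?thesis by (simp add: bi_ideal_def)
qed

lemma sup_tensor_exists:
  fixes A C :: "'u qmodule"
  assumes sl: "strong_limit_type TYPE('u)"
    and A: "is_qmodule A" and C: "is_qmodule C" and AC: "rquant A = lquant C"
  obtains T :: "'u gorder" and t where "sup_tensor A C T t"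
proof -
  let ?P = "{S. bi_ideal A C S}"
  interpret A: complete_lattice A using A by (rule qmoduleD)
  interpret C: complete_lattice C using C by (rule qmoduleD)
  have P: "?P \<prec> (UNIV :: 'u set)"
  proof (rule lesspoll_trans1)
    show "?P \<lesssim> Pow (carrier A \<times> carrier C)"
      by (rule subset_imp_lepoll) (auto simp: bi_ideal_def)
    show "Pow (carrier A \<times> carrier C) \<prec> (UNIV :: 'u set)"
      using qmoduleD(3)[OF A] qmoduleD(3)[OF C]
      by (intro lesspoll_Pow_Times[OF sl]) (simp_all add: suplattice_def)
  qed
  \<comment> \<open>A union of bi-ideals need not be one, so the supremum is the intersection of all
    bi-ideals above the family.\<close>
  have lub: "\<exists>S \<in> ?P. \<forall>U \<in> ?P. S \<subseteq> U \<longleftrightarrow> (\<forall>V \<in> X. V \<subseteq> U)" if "X \<subseteq> ?P" for X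
  proof
    let ?F = "{U \<in> ?P. \<forall>V \<in> X. V \<subseteq> U}"
    let ?S = "(carrier A \<times> carrier C) \<inter> \<Inter>?F"
    show "?S \<in> ?P" using bi_ideal_Inter[OF A C AC, of ?F] by simp
    have "V \<subseteq> ?S" if "V \<in> X" for V
    proof (rule Int_greatest)
      show "V \<subseteq> carrier A \<times> carrier C" using that \<open>X \<subseteq> ?P\<close> by (auto simp: bi_ideal_def)
      show "V \<subseteq> \<Inter>?F" using that by blast
    qed
    then show "\<forall>U \<in> ?P. ?S \<subseteq> U \<longleftrightarrow> (\<forall>V \<in> X. V \<subseteq> U)" by blast
  qed
  obtain T :: "'u gorder" and dec where T: "suplattice T" and dec: "bij_betw dec (carrier T) ?P"
    and leT: "\<And>x y. x \<in> carrier T \<Longrightarrow> y \<in> carrier T \<Longrightarrow> x \<sqsubseteq>\<^bsub>T\<^esub> y \<longleftrightarrow> dec x \<subseteq> dec y"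
    by (rule suplattice_encoding[OF P, of "(\<subseteq>)"]) (use lub in auto)
  interpret T: complete_lattice T using T by (rule suplattice_complete_lattice)
  define enc where "enc = inv_into (carrier T) dec"
  have enc: "enc S \<in> carrier T" "dec (enc S) = S" if "bi_ideal A C S" for S
    using dec that by (auto simp: enc_def bij_betw_def inv_into_into f_inv_into_f)
  have dec_bi: "bi_ideal A C (dec u)" if "u \<in> carrier T" for u
    using dec that by (auto simp: bij_betw_def)
  have dec_sub: "a \<in> carrier A \<and> c \<in> carrier C" if "u \<in> carrier T" "(a, c) \<in> dec u" for u a c
    using dec_bi[OF that(1)] that(2) by (auto simp: bi_ideal_def)
  define t where
    "t a c = enc ((carrier A \<times> carrier C) \<inter> \<Inter>{S. bi_ideal A C S \<and> (a, c) \<in> S})" for a c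
  have t: "t a c \<in> carrier T" for a c
    unfolding t_def by (intro enc bi_ideal_Inter[OF A C AC]) simp
  \<comment> \<open>This equivalence turns each closure clause of \<open>bi_ideal\<close> for
    \<open>dec u\<close> into a clause of \<open>balanced\<close> for \<open>t\<close>, tested
    against the upper bound \<open>u\<close>.\<close>
  have t_le: "t a c \<sqsubseteq>\<^bsub>T\<^esub> u \<longleftrightarrow> (a, c) \<in> dec u"
    if ac: "a \<in> carrier A" "c \<in> carrier C" and u: "u \<in> carrier T" for a c u
  proof -
    let ?S = "(carrier A \<times> carrier C) \<inter> \<Inter>{S. bi_ideal A C S \<and> (a, c) \<in> S}"
    have "dec (t a c) = ?S" unfolding t_def by (intro enc bi_ideal_Inter[OF A C AC]) simp
    moreover have "?S \<subseteq> dec u \<longleftrightarrow> (a, c) \<in> dec u"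
      using ac dec_bi[OF u] by blast
    ultimately show ?thesis using leT[OF t u] by simp
  qed
  have bal: "balanced A C T t"
  proof (rule balancedI)
    show "sup_map C T (t a)" if a: "a \<in> carrier A" for a
    proof (rule sup_mapI[OF C.complete_lattice_axioms T.complete_lattice_axioms t])
      fix Y u assume Y: "Y \<subseteq> carrier C" and u: "u \<in> carrier T"
      show "t a (\<Squnion>\<^bsub>C\<^esub> Y) \<sqsubseteq>\<^bsub>T\<^esub> u \<longleftrightarrow> (\<forall>y \<in> Y. t a y \<sqsubseteq>\<^bsub>T\<^esub> u)"
        using dec_bi[OF u] a Y u C.lub_closed[OF Y] unfolding bi_ideal_def
        by (simp add: t_le subset_iff)
    qed
    show "sup_map A T (\<lambda>a. t a c)" if c: "c \<in> carrier C" for c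
    proof (rule sup_mapI[OF A.complete_lattice_axioms T.complete_lattice_axioms t])
      fix X u assume X: "X \<subseteq> carrier A" and u: "u \<in> carrier T"
      show "t (\<Squnion>\<^bsub>A\<^esub> X) c \<sqsubseteq>\<^bsub>T\<^esub> u \<longleftrightarrow> (\<forall>x \<in> X. t x c \<sqsubseteq>\<^bsub>T\<^esub> u)"
        using dec_bi[OF u] c X u A.lub_closed[OF X] unfolding bi_ideal_def
        by (simp add: t_le subset_iff)
    qed
    fix a r c assume *: "a \<in> carrier A" "r \<in> carrier (rquant A)" "c \<in> carrier C"
    show "t (ract A a r) c = t a (lact C r c)"
    proof (rule T.eq_by_upper[OF t t])
      show "t (ract A a r) c \<sqsubseteq>\<^bsub>T\<^esub> u \<longleftrightarrow> t a (lact C r c) \<sqsubseteq>\<^bsub>T\<^esub> u" if u: "u \<in> carrier T" for u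
        using dec_bi[OF u] * u A C AC unfolding bi_ideal_def
        by (simp add: t_le lact_closed ract_closed)
    qed
  qed
  \<comment> \<open>Every element is the supremum of the pure tensors below it, which makes an
    induced map unique.\<close>
  have gen: "u = \<Squnion>\<^bsub>T\<^esub> ((\<lambda>(a, c). t a c) ` dec u)" if u: "u \<in> carrier T" for u
  proof (rule T.eq_by_upper[OF u])
    have sub: "(\<lambda>(a, c). t a c) ` dec u \<subseteq> carrier T" using t by auto
    then show "\<Squnion>\<^bsub>T\<^esub> ((\<lambda>(a, c). t a c) ` dec u) \<in> carrier T" by (rule T.lub_closed)
    show "u \<sqsubseteq>\<^bsub>T\<^esub> v \<longleftrightarrow> \<Squnion>\<^bsub>T\<^esub> ((\<lambda>(a, c). t a c) ` dec u) \<sqsubseteq>\<^bsub>T\<^esub> v" if v: "v \<in> carrier T" for v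
      using T.lub_le_iff[OF sub v] leT[OF u v] t_le[OF _ _ v] dec_sub[OF u] by (auto simp: subset_iff)
  qed
  have "\<exists>!h. h \<in> extensional (carrier T) \<and> sup_map T L h \<and>
      (\<forall>a \<in> carrier A. \<forall>c \<in> carrier C. h (t a c) = f a c)"
    if L: "suplattice L" and f: "balanced A C L f" for L :: "'u gorder" and f
  proof (rule ex_ex1I)
    interpret L: complete_lattice L using L by (rule suplattice_complete_lattice)
    let ?G = "\<lambda>y. {(a, c). a \<in> carrier A \<and> c \<in> carrier C \<and> f a c \<sqsubseteq>\<^bsub>L\<^esub> y}"
    let ?F = "\<lambda>u. (\<lambda>(a, c). f a c) ` dec u"
    have G: "bi_ideal A C (?G y)" if y: "y \<in> carrier L" for y
      unfolding bi_ideal_def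
      apply (intro conjI allI impI ballI)
      subgoal by blast
      subgoal using sup_map_lub_le_iff[OF balancedD(3)[OF f]] y A.lub_closed by (auto simp: subset_iff)
      subgoal using sup_map_lub_le_iff[OF balancedD(2)[OF f]] y C.lub_closed by (auto simp: subset_iff)
      subgoal using balancedD(5)[OF f] A C AC by (auto simp: lact_closed ract_closed)
      done
    have F: "?F u \<subseteq> carrier L" if "u \<in> carrier T" for u
      using dec_sub[OF that] balancedD(4)[OF f] by auto
    \<comment> \<open>The values are forced by \<open>gen\<close>: \<open>dec u\<close> indexes the
      pure tensors whose supremum is \<open>u\<close>.\<close>
    define h where "h = restrict (\<lambda>u. \<Squnion>\<^bsub>L\<^esub> (?F u)) (carrier T)"
    have h: "h u \<in> carrier L" if "u \<in> carrier T" for u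
      using L.lub_closed[OF F[OF that]] that by (simp add: h_def)
    have adj: "h u \<sqsubseteq>\<^bsub>L\<^esub> y \<longleftrightarrow> u \<sqsubseteq>\<^bsub>T\<^esub> enc (?G y)" if u: "u \<in> carrier T" and y: "y \<in> carrier L" for u y
      using L.lub_le_iff[OF F[OF u] y] leT[OF u enc(1)[OF G[OF y]]] enc(2)[OF G[OF y]] dec_sub[OF u] u
      by (auto simp: h_def)
    have "sup_map T L h"
      by (rule sup_mapI_adjoint[OF T.complete_lattice_axioms L.complete_lattice_axioms,
            where g = "\<lambda>y. enc (?G y)"])
        (simp_all add: h enc G adj)
    moreover have "h (t a c) = f a c" if ac: "a \<in> carrier A" "c \<in> carrier C" for a c
    proof (rule L.eq_by_upper[OF h[OF t] balancedD(4)[OF f ac]])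
      show "h (t a c) \<sqsubseteq>\<^bsub>L\<^esub> y \<longleftrightarrow> f a c \<sqsubseteq>\<^bsub>L\<^esub> y" if y: "y \<in> carrier L" for y
        using adj[OF t y] t_le[OF ac enc(1)[OF G[OF y]]] enc(2)[OF G[OF y]] ac by simp
    qed
    ultimately show "\<exists>h. h \<in> extensional (carrier T) \<and> sup_map T L h \<and>
        (\<forall>a \<in> carrier A. \<forall>c \<in> carrier C. h (t a c) = f a c)"
      by (intro exI[of _ h]) (simp add: h_def)
    fix h k assume h: "h \<in> extensional (carrier T) \<and> sup_map T L h \<and>
        (\<forall>a \<in> carrier A. \<forall>c \<in> carrier C. h (t a c) = f a c)"
      and k: "k \<in> extensional (carrier T) \<and> sup_map T L k \<and>
        (\<forall>a \<in> carrier A. \<forall>c \<in> carrier C. k (t a c) = f a c)"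
    show "h = k"
    proof (rule extensionalityI)
      fix u assume u: "u \<in> carrier T"
      let ?X = "(\<lambda>(a, c). t a c) ` dec u"
      have X: "?X \<subseteq> carrier T" using t by auto
      have "h ` ?X = k ` ?X" unfolding image_image
        by (rule image_cong) (use h k dec_sub[OF u] in auto)
      then have "h (\<Squnion>\<^bsub>T\<^esub> ?X) = k (\<Squnion>\<^bsub>T\<^esub> ?X)" using sup_map_lub[OF _ X] h k by metis
      then show "h u = k u" using gen[OF u] by simp
    qed (use h k in auto)
  qed
  then have "sup_tensor A C T t" using T bal by (simp add: sup_tensor_def)
  then show ?thesis by (rule that)
qed

text \<open>An outer scalar multiplies one factor of a pure tensor, and the result is again balanced
  because the two actions of a bimodule commute. With the scalar as parameter this lifts to the
  tensor product, where the module laws hold because they hold on pure tensors.\<close>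

lemma tensor_exists:
  fixes A C :: "'u qmodule"
  assumes sl: "strong_limit_type TYPE('u)"
    and A: "is_qmodule A" and C: "is_qmodule C" and AC: "rquant A = lquant C"
  shows "\<exists>T t. is_tensor A C T t"
proof -
  obtain T0 :: "'u gorder" and t where T0: "sup_tensor A C T0 t"
    by (rule sup_tensor_exists[OF sl A C AC])
  note t = sup_tensorD(3)[OF T0] and M = sup_tensorD(1)[OF T0]
  note Q = qmoduleD(1)[OF A] and S = qmoduleD(2)[OF C]
  have "balanced A C T0 (\<lambda>a c. t (lact A q a) c)" if "q \<in> carrier (lquant A)" for q
    by (rule balancedI)
      (use that A C AC t in \<open>auto simp: lact_closed ract_closed lact_ract balancedD(5)
        intro: balancedD sup_map_comp[OF sup_map_lact(1) balancedD(3)]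
        simp flip: lact_ract balancedD(5)\<close>)
  moreover have "sup_map (lquant A) T0 (\<lambda>q. t (lact A q a) c)" if "a \<in> carrier A" "c \<in> carrier C" for a c
    using that A t by (intro sup_map_comp[OF sup_map_lact(2) balancedD(3)]) auto
  ultimately obtain l where l: "sup_bimap T0 (lquant A) T0 l"
    and lt: "\<And>a c q. a \<in> carrier A \<Longrightarrow> c \<in> carrier C \<Longrightarrow> q \<in> carrier (lquant A)
        \<Longrightarrow> l (t a c) q = t (lact A q a) c"
    using sup_tensor_param_lift[OF T0 M unital_quantaleD(2)[OF Q], of "\<lambda>a c q. t (lact A q a) c"] by metis
  have "balanced A C T0 (\<lambda>a c. t a (ract C c s))" if "s \<in> carrier (rquant C)" for s
    by (rule balancedI)
      (use that A C AC t in \<open>auto simp: lact_closed ract_closed lact_ract balancedD(5)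
        intro: balancedD sup_map_comp[OF sup_map_ract(1) balancedD(2)]\<close>)
  moreover have "sup_map (rquant C) T0 (\<lambda>s. t a (ract C c s))" if "a \<in> carrier A" "c \<in> carrier C" for a c
    using that C t by (intro sup_map_comp[OF sup_map_ract(2) balancedD(2)]) auto
  ultimately obtain r where r: "sup_bimap T0 (rquant C) T0 r"
    and rt: "\<And>a c s. a \<in> carrier A \<Longrightarrow> c \<in> carrier C \<Longrightarrow> s \<in> carrier (rquant C)
        \<Longrightarrow> r (t a c) s = t a (ract C c s)"
    using sup_tensor_param_lift[OF T0 M unital_quantaleD(2)[OF S], of "\<lambda>a c s. t a (ract C c s)"] by metis
  \<comment> \<open>\<open>sup_tensor_param_lift\<close> places the tensor before the parameter, so
    \<open>l\<close> takes the scalar last and is flipped to serve as the left action.\<close>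
  define T where "T = \<lparr>carrier = carrier T0, eq = eq T0, le = le T0, lquant = lquant A, rquant = rquant C,
    lact = \<lambda>q u. l u q, ract = r\<rparr>"
  have T_simps [simp]: "carrier T = carrier T0" "eq T = eq T0" "le T = le T0" "lquant T = lquant A"
    "rquant T = rquant C" "lact T = (\<lambda>q u. l u q)" "ract T = r"
    by (simp_all add: T_def)
  have sup_map_T [simp]: "sup_map L T f \<longleftrightarrow> sup_map L T0 f" "sup_map T L f \<longleftrightarrow> sup_map T0 L f"
    for L :: "('u, 'x) gorder_scheme" and f by (rule sup_map_cong_order; simp)+
  have supT: "suplattice T" using M suplattice_cong_order[of T T0] by simp
  have bal: "balanced A C T t" using t by (simp add: balanced_def sup_bimap_def)
  note l' = sup_bimapD(2)[OF l] and r' = sup_bimapD(2)[OF r]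
  note ext = sup_tensor_ext[OF T0 M]
  have "is_qmodule T"
    unfolding is_qmodule_def
  proof (intro conjI ballI)
    show "unital_quantale (lquant T)" "unital_quantale (rquant T)" using Q S by simp_all
    show "sup_bimap (lquant T) T T (lact T)" "sup_bimap T (rquant T) T (ract T)"
      using l r by (simp_all add: sup_bimap_def)
    show "suplattice T" by (fact supT)
  next
    fix q q' u
    assume *: "q \<in> carrier (lquant T)" "q' \<in> carrier (lquant T)" "u \<in> carrier T"
    have "l u (qmult (lquant A) q q') = l (l u q') q"
      by (rule ext[OF l' sup_map_comp[OF l' l']])
        (use * A Q in \<open>simp_all add: lt lact_closed lact_qmult unital_quantaleD(7)\<close>)
    then show "lact T (qmult (lquant T) q q') u = lact T q (lact T q' u)" by simp
  next
    fix u s s'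
    assume *: "u \<in> carrier T" "s \<in> carrier (rquant T)" "s' \<in> carrier (rquant T)"
    have "r u (qmult (rquant C) s s') = r (r u s) s'"
      by (rule ext[OF r' sup_map_comp[OF r' r']])
        (use * C S in \<open>simp_all add: rt ract_closed ract_qmult unital_quantaleD(7)\<close>)
    then show "ract T u (qmult (rquant T) s s') = ract T (ract T u s) s'" by simp
  next
    fix u assume u: "u \<in> carrier T"
    have "l u (qunit (lquant A)) = u"
      by (rule ext[OF l' sup_map_ident[OF sup_tensorD(2)[OF T0]]])
        (use u A Q in \<open>simp_all add: lt lact_qunit unital_quantaleD(3)\<close>)
    then show "lact T (qunit (lquant T)) u = u" by simp
    have "r u (qunit (rquant C)) = u"
      by (rule ext[OF r' sup_map_ident[OF sup_tensorD(2)[OF T0]]])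
        (use u C S in \<open>simp_all add: rt ract_qunit unital_quantaleD(3)\<close>)
    then show "ract T u (qunit (rquant T)) = u" by simp
  next
    fix q u s
    assume *: "q \<in> carrier (lquant T)" "u \<in> carrier T" "s \<in> carrier (rquant T)"
    have "r (l u q) s = l (r u s) q"
      by (rule ext[OF sup_map_comp[OF l' r'] sup_map_comp[OF r' l']])
        (use * A C in \<open>simp_all add: lt rt lact_closed ract_closed\<close>)
    then show "ract T (lact T q u) s = lact T q (ract T u s)" by simp
  qed
  then have "is_tensor A C T t"
    using T0 bal lt rt by (auto simp: is_tensor_def sup_tensor_def)
  then show ?thesis by blast
qed

section \<open>Bilinear and trilinear maps as homomorphisms out of tensor products\<close>

definition bilin ::
  "'u qmodule \<Rightarrow> 'u qmodule \<Rightarrow> 'u qmodule \<Rightarrow> ('u \<Rightarrow> 'u \<Rightarrow> 'u) \<Rightarrow> bool" where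
  "bilin A C M f \<longleftrightarrow>
     is_qmodule A \<and> is_qmodule C \<and> is_qmodule M \<and>
     rquant A = lquant C \<and> lquant M = lquant A \<and> rquant M = rquant C \<and> balanced A C M f \<and>
     (\<forall>q \<in> carrier (lquant A). \<forall>a \<in> carrier A. \<forall>c \<in> carrier C. f (lact A q a) c = lact M q (f a c)) \<and>
     (\<forall>a \<in> carrier A. \<forall>c \<in> carrier C. \<forall>s \<in> carrier (rquant C). f a (ract C c s) = ract M (f a c) s)"

lemma bilinD:
  assumes "bilin A C M f"
  shows "is_qmodule A" "is_qmodule C" "is_qmodule M"
    "rquant A = lquant C" "lquant M = lquant A" "rquant M = rquant C" "balanced A C M f"
    and "q \<in> carrier (lquant A) \<Longrightarrow> a \<in> carrier A \<Longrightarrow> c \<in> carrier C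
      \<Longrightarrow> f (lact A q a) c = lact M q (f a c)"
    and "a \<in> carrier A \<Longrightarrow> c \<in> carrier C \<Longrightarrow> s \<in> carrier (rquant C)
      \<Longrightarrow> f a (ract C c s) = ract M (f a c) s"
  using assms by (simp_all add: bilin_def)

lemma bilin_closed: "bilin A C M f \<Longrightarrow> a \<in> carrier A \<Longrightarrow> c \<in> carrier C \<Longrightarrow> f a c \<in> carrier M"
  using bilinD(7) balancedD(4) by fast

lemma bilin_comp: "bilin A C M f \<Longrightarrow> lin M N g \<Longrightarrow> bilin A C N (\<lambda>a c. g (f a c))"
  using balanced_comp[of A C M f N g] balancedD(4)[of A C M f] linD[of M N g]
  by (simp add: bilin_def)

lemma bilin_precomp:
  assumes h: "bilin A C M h" and f: "lin A' A f" and g: "lin C' C g"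
  shows "bilin A' C' M (\<lambda>a c. h (f a) (g c))"
proof -
  note [simp] = linD[OF f] linD[OF g] bilinD[OF h]
  have "balanced A' C' M (\<lambda>a c. h (f a) (g c))"
  proof (rule balancedI)
    show "sup_map C' M (\<lambda>c. h (f a) (g c))" if "a \<in> carrier A'" for a
      using that by (intro sup_map_comp[OF linD(5)[OF g] balancedD(2)[OF bilinD(7)[OF h]]]) simp
    show "sup_map A' M (\<lambda>a. h (f a) (g c))" if "c \<in> carrier C'" for c
      using that by (intro sup_map_comp[OF linD(5)[OF f] balancedD(3)[OF bilinD(7)[OF h]]]) simp
    show "h (f (ract A' a r)) (g c) = h (f a) (g (lact C' r c))"
      if "a \<in> carrier A'" "r \<in> carrier (rquant A')" "c \<in> carrier C'" for a r c
    proof -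
      have "r \<in> carrier (lquant C')" using that linD(3,4)[OF f] linD(3)[OF g] bilinD(4)[OF h] by simp
      then show ?thesis
        using that balancedD(5)[OF bilinD(7)[OF h], of "f a" r "g c"] by simp
    qed
  qed
  moreover have "rquant A' = lquant C'" using linD(3,4)[OF f] linD(3)[OF g] bilinD(4)[OF h] by simp
  ultimately show ?thesis by (simp add: bilin_def)
qed

text \<open>Homomorphisms out of a threefold tensor product, neutral between the two bracketings;
  the same notion therefore serves the associator and its inverse.\<close>

definition trilin ::
  "'u qmodule \<Rightarrow> 'u qmodule \<Rightarrow> 'u qmodule \<Rightarrow> 'u qmodule \<Rightarrow> ('u \<Rightarrow> 'u \<Rightarrow> 'u \<Rightarrow> 'u) \<Rightarrow> bool" where
  "trilin A C D M f \<longleftrightarrow>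
     is_qmodule A \<and> is_qmodule C \<and> is_qmodule D \<and> is_qmodule M \<and>
     rquant A = lquant C \<and> rquant C = lquant D \<and> lquant M = lquant A \<and> rquant M = rquant D \<and>
     (\<forall>d \<in> carrier D. balanced A C M (\<lambda>a c. f a c d)) \<and> (\<forall>a \<in> carrier A. balanced C D M (f a)) \<and>
     (\<forall>q \<in> carrier (lquant A). \<forall>a \<in> carrier A. \<forall>c \<in> carrier C. \<forall>d \<in> carrier D.
        f (lact A q a) c d = lact M q (f a c d)) \<and>
     (\<forall>a \<in> carrier A. \<forall>c \<in> carrier C. \<forall>d \<in> carrier D. \<forall>s \<in> carrier (rquant D).
        f a c (ract D d s) = ract M (f a c d) s)"

lemma trilinD:
  assumes "trilin A C D M f"
  shows "is_qmodule A" "is_qmodule C" "is_qmodule D" "is_qmodule M"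
    "rquant A = lquant C" "rquant C = lquant D" "lquant M = lquant A" "rquant M = rquant D"
    and "d \<in> carrier D \<Longrightarrow> balanced A C M (\<lambda>a c. f a c d)"
    and "a \<in> carrier A \<Longrightarrow> balanced C D M (f a)"
    and "q \<in> carrier (lquant A) \<Longrightarrow> a \<in> carrier A \<Longrightarrow> c \<in> carrier C \<Longrightarrow> d \<in> carrier D
      \<Longrightarrow> f (lact A q a) c d = lact M q (f a c d)"
    and "a \<in> carrier A \<Longrightarrow> c \<in> carrier C \<Longrightarrow> d \<in> carrier D \<Longrightarrow> s \<in> carrier (rquant D)
      \<Longrightarrow> f a c (ract D d s) = ract M (f a c d) s"
  using assms by (simp_all add: trilin_def)

section \<open>Cells of the bicategory as functions between carriers\<close>

lemma Quant_simps [simp]: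
  "cells0 Quant = {Q. unital_quantale Q}" "cells1 Quant = {A. is_qmodule A}"
  "cells2 Quant = {f. is_qmodule_hom f}" "src Quant = lquant" "trg Quant = rquant"
  "dom2 Quant = hdom" "cod2 Quant = hcod" "vid Quant A = qhom_of A A (\<lambda>a. a)"
  "ident Quant = id_qmodule" "hcomp1 Quant = tensor" "hcomp2 Quant = tensor_hom"
  "assoc Quant = tensor_assoc" "lunit Quant = tensor_lunit" "runit Quant = tensor_runit"
  by (simp_all add: Quant_def qhom_of_def)

lemma hom1_Quant [simp]: "A \<in> hom1 Quant X Y \<longleftrightarrow> is_qmodule A \<and> lquant A = X \<and> rquant A = Y"
  by (simp add: hom1_def)

lemma hom2_Quant [simp]: "hom2 Quant A A' = qmodule_homs A A'"
  by (auto simp: hom2_def qmodule_homs_def)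

lemma vcomp_Quant_closed [intro]:
  "f \<in> qmodule_homs A B \<Longrightarrow> g \<in> qmodule_homs B C \<Longrightarrow> vcomp Quant g f \<in> qmodule_homs A C"
  using lin_comp[of A B "hmap f" C "hmap g"]
  by (auto simp: qmodule_homs_def is_qmodule_hom_iff_lin Quant_def compose_def)

lemma hmap_vcomp_Quant:
  "f \<in> qmodule_homs A B \<Longrightarrow> a \<in> carrier A \<Longrightarrow> hmap (vcomp Quant g f) a = hmap g (hmap f a)"
  by (auto simp: qmodule_homs_def Quant_def compose_eq)

lemma hmap_closed: "f \<in> qmodule_homs A B \<Longrightarrow> a \<in> carrier A \<Longrightarrow> hmap f a \<in> carrier B"
  using linD(6)[OF qmodule_homsD(1)] .

lemma qmodule_homsD':
  assumes "f \<in> qmodule_homs A B"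
  shows "is_qmodule A" "is_qmodule B" "lquant B = lquant A" "rquant B = rquant A"
    "sup_map A B (hmap f)"
  using linD[OF qmodule_homsD(1)[OF assms]] by simp_all

lemma iso2_QuantI:
  assumes f: "f \<in> qmodule_homs A B" and g: "lin B A g"
    and gf: "\<And>a. a \<in> carrier A \<Longrightarrow> g (hmap f a) = a"
    and fg: "\<And>b. b \<in> carrier B \<Longrightarrow> hmap f (g b) = b"
  shows "f \<in> iso2 Quant A B"
proof -
  let ?g = "qhom_of B A g"
  have g': "?g \<in> qmodule_homs B A" using g by simp
  have "vcomp Quant ?g f = qhom_of A A (\<lambda>a. a)"
    by (rule qmodule_homs_eqI[OF vcomp_Quant_closed[OF f g']])
      (use lin_ident[OF linD(2)[OF g]] hmap_closed[OF f] in
        \<open>simp_all add: hmap_vcomp_Quant[OF f] gf\<close>)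
  moreover have "vcomp Quant f ?g = qhom_of B B (\<lambda>a. a)"
    by (rule qmodule_homs_eqI[OF vcomp_Quant_closed[OF g' f]])
      (use lin_ident[OF linD(1)[OF g]] in \<open>simp_all add: hmap_vcomp_Quant[OF g'] fg\<close>)
  ultimately show ?thesis using f g' by (auto simp: iso2_def)
qed

text \<open>The structure of a module consists of operations, suprema and actions, and the inverse
  of a bijection preserving operations preserves them too. Invertibility of a 2-cell thus becomes a
  question about carriers.\<close>

lemma iso2_Quant_bij:
  assumes f: "f \<in> qmodule_homs A B" and bij: "bij_betw (hmap f) (carrier A) (carrier B)"
  shows "f \<in> iso2 Quant A B"
proof (rule iso2_QuantI[OF f lin_inv_into[OF qmodule_homsD(1)[OF f] bij]])
  show "inv_into (carrier A) (hmap f) (hmap f a) = a" if "a \<in> carrier A" for a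
    using bij that by (simp add: bij_betw_def)
  show "hmap f (inv_into (carrier A) (hmap f) b) = b" if "b \<in> carrier B" for b
    using bij that by (simp add: bij_betw_def f_inv_into_f)
qed

lemma vid_Quant_closed: "is_qmodule A \<Longrightarrow> qhom_of A A (\<lambda>a. a) \<in> qmodule_homs A A"
  by (simp add: lin_ident)

lemma bilin_lact:
  assumes A: "is_qmodule A"
  shows "bilin (id_qmodule (lquant A)) A A (lact A)"
proof -
  note Q = qmoduleD(1)[OF A]
  have "balanced (id_qmodule (lquant A)) A A (lact A)"
    by (rule balancedI) (use A Q in \<open>simp_all add: sup_map_lact lact_qmult\<close>)
  then show ?thesis
    using A Q by (simp add: bilin_def is_qmodule_id_qmodule lact_qmult lact_ract)
qed

lemma bilin_ract:
  assumes A: "is_qmodule A"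
  shows "bilin A (id_qmodule (rquant A)) A (ract A)"
proof -
  note Q = qmoduleD(2)[OF A]
  have "balanced A (id_qmodule (rquant A)) A (ract A)"
    by (rule balancedI) (use A Q in \<open>simp_all add: sup_map_ract ract_qmult\<close>)
  then show ?thesis
    using A Q by (simp add: bilin_def is_qmodule_id_qmodule ract_qmult lact_ract)
qed

section \<open>Opposite quantales and modules\<close>

definition opp_quantale :: "'u quantale \<Rightarrow> 'u quantale" where
  "opp_quantale Q = \<lparr>carrier = carrier Q, eq = eq Q, le = le Q,
     qmult = (\<lambda>x y. qmult Q y x), qunit = qunit Q\<rparr>"

text \<open>Left and right change places, so \<open>A\<close> from Q to R becomes a module from the
  opposite of R to the opposite of Q. The double opposite is the very same record, and results
  transfer in both directions by plain equations.\<close>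

definition opp_qmodule :: "'u qmodule \<Rightarrow> 'u qmodule" where
  "opp_qmodule A = \<lparr>carrier = carrier A, eq = eq A, le = le A,
     lquant = opp_quantale (rquant A), rquant = opp_quantale (lquant A),
     lact = (\<lambda>r a. ract A a r), ract = (\<lambda>a q. lact A q a)\<rparr>"

lemma opp_quantale_simps [simp]:
  "carrier (opp_quantale Q) = carrier Q" "eq (opp_quantale Q) = eq Q" "le (opp_quantale Q) = le Q"
  "qmult (opp_quantale Q) = (\<lambda>x y. qmult Q y x)" "qunit (opp_quantale Q) = qunit Q"
  "opp_quantale (opp_quantale Q) = Q"
  by (simp_all add: opp_quantale_def)

lemma opp_qmodule_simps [simp]:
  "carrier (opp_qmodule A) = carrier A" "eq (opp_qmodule A) = eq A" "le (opp_qmodule A) = le A"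
  "lquant (opp_qmodule A) = opp_quantale (rquant A)"
  "rquant (opp_qmodule A) = opp_quantale (lquant A)"
  "lact (opp_qmodule A) = (\<lambda>r a. ract A a r)" "ract (opp_qmodule A) = (\<lambda>a q. lact A q a)"
  "opp_qmodule (opp_qmodule A) = A"
  by (simp_all add: opp_qmodule_def)

lemma opp_quantale_inject [simp]: "opp_quantale Q = opp_quantale R \<longleftrightarrow> Q = R"
  by (metis opp_quantale_simps(6))

lemma suplattice_opp [simp]:
  "suplattice (opp_quantale Q) \<longleftrightarrow> suplattice Q" "suplattice (opp_qmodule A) \<longleftrightarrow> suplattice A"
  by (rule suplattice_cong_order; simp)+

lemma sup_map_opp [simp]:
  "sup_map (opp_quantale Q) L f \<longleftrightarrow> sup_map Q L f" "sup_map L (opp_quantale Q) f \<longleftrightarrow> sup_map L Q f"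
  "sup_map (opp_qmodule A) L f \<longleftrightarrow> sup_map A L f" "sup_map L (opp_qmodule A) f \<longleftrightarrow> sup_map L A f"
  by (rule sup_map_cong_order; simp)+

lemma lub_opp [simp]:
  "\<Squnion>\<^bsub>opp_quantale Q\<^esub> X = \<Squnion>\<^bsub>Q\<^esub> X" "\<Squnion>\<^bsub>opp_qmodule A\<^esub> X = \<Squnion>\<^bsub>A\<^esub> X"
  by (rule lub_cong_order; simp)+

lemma unital_quantale_opp [simp]: "unital_quantale (opp_quantale Q) \<longleftrightarrow> unital_quantale Q"
proof -
  have "unital_quantale (opp_quantale Q)" if "unital_quantale Q" for Q :: "'a quantale"
    using that by (auto simp: unital_quantale_def sup_bimap_def)
  from this[of Q] this[of "opp_quantale Q"] show ?thesis by auto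
qed

lemma is_qmodule_opp [simp]: "is_qmodule (opp_qmodule A) \<longleftrightarrow> is_qmodule A"
proof -
  have "is_qmodule (opp_qmodule A)" if "is_qmodule A" for A :: "'a qmodule"
    using that by (auto simp: is_qmodule_def sup_bimap_def)
  from this[of A] this[of "opp_qmodule A"] show ?thesis by auto
qed

lemma lin_opp [simp]: "lin (opp_qmodule A) (opp_qmodule B) f \<longleftrightarrow> lin A B f"
  by (auto simp: lin_def)

text \<open>Formulated with \<open>bilin\<close> instead of \<open>tensor\<close> because the chosen
  tensor products of opposites are tied to the original ones only by isomorphisms, whereas balanced
  maps are related by exchanging arguments.\<close>

lemma bilin_opp: "bilin A C M f \<Longrightarrow> bilin (opp_qmodule C) (opp_qmodule A) (opp_qmodule M) (\<lambda>c a. f a c)"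
  by (auto simp: bilin_def balanced_def sup_bimap_def)

lemma bilin_opp_iff: "bilin (opp_qmodule C) (opp_qmodule A) (opp_qmodule M) f \<longleftrightarrow> bilin A C M (\<lambda>a c. f c a)"
  using bilin_opp[of A C M "\<lambda>a c. f c a"]
    bilin_opp[of "opp_qmodule C" "opp_qmodule A" "opp_qmodule M" f] by auto


section \<open>Modules of homomorphisms\<close>

text \<open>Only the left actions are respected. The right actions of \<open>A\<close> and
  \<open>C\<close> remain available and become the left and the right action on the module of such
  maps.\<close>

definition left_lin :: "'u qmodule \<Rightarrow> 'u qmodule \<Rightarrow> ('u \<Rightarrow> 'u) \<Rightarrow> bool" where
  "left_lin A C f \<longleftrightarrow> sup_map A C f \<and>
     (\<forall>q \<in> carrier (lquant A). \<forall>a \<in> carrier A. f (lact A q a) = lact C q (f a))"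

text \<open>\<open>lhom A C E ev\<close>: via \<open>ev\<close>, \<open>E\<close> is the module of left module homomorphisms \<open>A \<rightarrow> C\<close>.\<close>

definition lhom :: "'u qmodule \<Rightarrow> 'u qmodule \<Rightarrow> 'u qmodule \<Rightarrow> ('u \<Rightarrow> 'u \<Rightarrow> 'u) \<Rightarrow> bool" where
  "lhom A C E ev \<longleftrightarrow> bilin A E C ev \<and>
     (\<forall>f. left_lin A C f \<longrightarrow> (\<exists>!e. e \<in> carrier E \<and> (\<forall>a \<in> carrier A. ev a e = f a)))"

lemma left_lin_bilin: "bilin A E C ev \<Longrightarrow> e \<in> carrier E \<Longrightarrow> left_lin A C (\<lambda>a. ev a e)"
  by (simp add: left_lin_def bilinD balancedD(3)[OF bilinD(7)])

lemma lhom_eqI: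
  assumes "lhom A C E ev" "e \<in> carrier E" "e' \<in> carrier E"
    and "\<And>a. a \<in> carrier A \<Longrightarrow> ev a e = ev a e'"
  shows "e = e'"
proof -
  let ?P = "\<lambda>x. x \<in> carrier E \<and> (\<forall>a \<in> carrier A. ev a x = ev a e)"
  have "left_lin A C (\<lambda>a. ev a e)" using assms(1,2) by (auto simp: lhom_def intro: left_lin_bilin)
  then have "\<exists>!x. ?P x" using assms(1) by (simp add: lhom_def)
  moreover have "?P e" "?P e'" using assms(2-) by simp_all
  ultimately show ?thesis by blast
qed

lemma lhom_ex: "lhom A C E ev \<Longrightarrow> left_lin A C f \<Longrightarrow> \<exists>e \<in> carrier E. \<forall>a \<in> carrier A. ev a e = f a"
  unfolding lhom_def by (metis (mono_tags, lifting))

text \<open>Left linear maps are closed under pointwise suprema, and evaluations detect order,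
  equality and suprema among them. All laws of the hom module are hence checked after evaluation in
  \<open>C\<close>.\<close>

lemma lhom_exists:
  fixes A C :: "'u qmodule"
  assumes sl: "strong_limit_type TYPE('u)"
    and A: "is_qmodule A" and C: "is_qmodule C" and AC: "lquant A = lquant C"
  shows "\<exists>E ev. lhom A C E ev"
proof -
  let ?P = "{f \<in> extensional (carrier A). left_lin A C f}"
  let ?r = "\<lambda>f g. \<forall>a \<in> carrier A. f a \<sqsubseteq>\<^bsub>C\<^esub> g a"
  note cA = qmoduleD(4)[OF A] and cC = qmoduleD(4)[OF C]
  interpret A: complete_lattice A by (rule cA)
  interpret C: complete_lattice C by (rule cC)
  have P_closed: "f a \<in> carrier C" if "f \<in> ?P" "a \<in> carrier A" for f a
    using that by (auto simp: left_lin_def intro: sup_map_closed)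
  have P: "?P \<prec> (UNIV :: 'u set)"
  proof (rule lesspoll_trans1)
    \<comment> \<open>Size bound: an extensional function on \<open>A\<close> is determined by its
      graph, a subset of \<open>carrier A \<times> carrier C\<close>.\<close>
    have inj: "inj_on (\<lambda>f. (\<lambda>a. (a, f a)) ` carrier A) ?P"
    proof (rule inj_onI)
      fix f g assume f: "f \<in> ?P" and g: "g \<in> ?P"
        and eq: "(\<lambda>a. (a, f a)) ` carrier A = (\<lambda>a. (a, g a)) ` carrier A"
      have "f a = g a" if "a \<in> carrier A" for a
        using that imageI[OF that, of "\<lambda>a. (a, f a)"] unfolding eq by auto
      then show "f = g" using f g by (auto intro: extensionalityI)
    qed
    have "(\<lambda>f. (\<lambda>a. (a, f a)) ` carrier A) ` ?P \<subseteq> Pow (carrier A \<times> carrier C)"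
      using P_closed by auto
    with inj show "?P \<lesssim> Pow (carrier A \<times> carrier C)" by (auto simp: lepoll_def)
    show "Pow (carrier A \<times> carrier C) \<prec> (UNIV :: 'u set)"
      using qmoduleD(3)[OF A] qmoduleD(3)[OF C]
      by (intro lesspoll_Pow_Times[OF sl]) (simp_all add: suplattice_def)
  qed
  \<comment> \<open>Pointwise suprema remain left linear since each \<open>lact C q\<close>
    preserves suprema; the restriction keeps them extensional.\<close>
  define SUPP where "SUPP X = restrict (\<lambda>a. \<Squnion>\<^bsub>C\<^esub> ((\<lambda>f. f a) ` X)) (carrier A)" for X
  have SUPP: "SUPP X \<in> ?P" if X: "X \<subseteq> ?P" for X
  proof -
    have "sup_map A C (SUPP X)"
      unfolding SUPP_def sup_map_restrict using X
      by (intro sup_map_SUP[OF cA cC]) (auto simp: left_lin_def)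
    moreover have "SUPP X (lact A q a) = lact C q (SUPP X a)"
      if q: "q \<in> carrier (lquant A)" and a: "a \<in> carrier A" for q a
    proof -
      have "(\<lambda>f. f (lact A q a)) ` X = lact C q ` (\<lambda>f. f a) ` X"
        unfolding image_image using X q a by (intro image_cong) (auto simp: left_lin_def)
      moreover have "(\<lambda>f. f a) ` X \<subseteq> carrier C" using X a P_closed by blast
      ultimately show ?thesis
        using sup_map_lub[OF sup_map_lact(1)[OF C]] q a A AC by (simp add: SUPP_def lact_closed)
    qed
    ultimately show ?thesis by (simp add: left_lin_def SUPP_def)
  qed
  have SUPP_le: "?r (SUPP X) g \<longleftrightarrow> (\<forall>f \<in> X. ?r f g)" if X: "X \<subseteq> ?P" and g: "g \<in> ?P" for X g
  proof -
    have "SUPP X a \<sqsubseteq>\<^bsub>C\<^esub> g a \<longleftrightarrow> (\<forall>f \<in> X. f a \<sqsubseteq>\<^bsub>C\<^esub> g a)" if a: "a \<in> carrier A" for a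
    proof -
      have "(\<lambda>f. f a) ` X \<subseteq> carrier C" using X a P_closed by blast
      then show ?thesis using C.lub_le_iff[OF _ P_closed[OF g a]] a by (simp add: SUPP_def)
    qed
    then have "?r (SUPP X) g \<longleftrightarrow> (\<forall>a \<in> carrier A. \<forall>f \<in> X. f a \<sqsubseteq>\<^bsub>C\<^esub> g a)"
      by (rule ball_cong[OF refl])
    then show ?thesis by auto
  qed
  obtain L :: "'u gorder" and dec where L: "suplattice L" and dec: "bij_betw dec (carrier L) ?P"
    and leL: "\<And>x y. x \<in> carrier L \<Longrightarrow> y \<in> carrier L \<Longrightarrow> x \<sqsubseteq>\<^bsub>L\<^esub> y \<longleftrightarrow> ?r (dec x) (dec y)"
  proof (rule suplattice_encoding[OF P, of ?r])
    show "?r f f" if "f \<in> ?P" for f using P_closed[OF that] by simp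
    show "f = g" if "f \<in> ?P" "g \<in> ?P" "?r f g" "?r g f" for f g
      using that P_closed[OF that(1)] P_closed[OF that(2)]
      by (intro extensionalityI[of f "carrier A"]) (auto intro: C.le_antisym)
    show "?r f h" if "f \<in> ?P" "g \<in> ?P" "h \<in> ?P" "?r f g" "?r g h" for f g h
      using that P_closed[OF that(1)] P_closed[OF that(2)] P_closed[OF that(3)]
      by (meson C.le_trans)
    show "\<exists>s \<in> ?P. \<forall>g \<in> ?P. ?r s g \<longleftrightarrow> (\<forall>f \<in> X. ?r f g)" if "X \<subseteq> ?P" for X
      using SUPP[OF that] SUPP_le[OF that] by (intro bexI[of _ "SUPP X"] ballI)
  qed blast
  interpret L: complete_lattice L using L by (rule suplattice_complete_lattice)
  define enc where "enc = inv_into (carrier L) dec"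
  define ev where "ev a e = dec e a" for a e
  have dec_P: "dec e \<in> ?P" if "e \<in> carrier L" for e
    using dec that by (auto simp: bij_betw_def)
  have ev_closed: "ev a e \<in> carrier C" if "a \<in> carrier A" "e \<in> carrier L" for a e
    unfolding ev_def using dec_P[OF that(2)] that(1) by (rule P_closed)
  have ev_sup: "sup_map A C (\<lambda>a. ev a e)" if "e \<in> carrier L" for e
    using dec_P[OF that] by (simp add: ev_def left_lin_def)
  have ev_lact: "ev (lact A q a) e = lact C q (ev a e)"
    if "q \<in> carrier (lquant A)" "a \<in> carrier A" "e \<in> carrier L" for q a e
    using dec_P[OF that(3)] that by (simp add: ev_def left_lin_def)
  have le_ev: "e \<sqsubseteq>\<^bsub>L\<^esub> e' \<longleftrightarrow> (\<forall>a \<in> carrier A. ev a e \<sqsubseteq>\<^bsub>C\<^esub> ev a e')"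
    if "e \<in> carrier L" "e' \<in> carrier L" for e e'
    using leL[OF that] by (simp add: ev_def)
  have ev_ext: "e = e'" if "e \<in> carrier L" "e' \<in> carrier L" "\<And>a. a \<in> carrier A \<Longrightarrow> ev a e = ev a e'"
    for e e' using that le_ev ev_closed by (intro L.le_antisym) simp_all
  define rep where "rep f = enc (restrict f (carrier A))" for f
  have rep: "rep f \<in> carrier L" "\<And>a. a \<in> carrier A \<Longrightarrow> ev a (rep f) = f a" if f: "left_lin A C f" for f
  proof -
    have "restrict f (carrier A) \<in> ?P"
      using f A by (auto simp: left_lin_def lact_closed)
    then have "enc (restrict f (carrier A)) \<in> carrier L"
      "dec (enc (restrict f (carrier A))) = restrict f (carrier A)"
      using dec by (auto simp: enc_def bij_betw_def inv_into_into f_inv_into_f)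
    then show "rep f \<in> carrier L" "\<And>a. a \<in> carrier A \<Longrightarrow> ev a (rep f) = f a"
      by (simp_all add: rep_def ev_def)
  qed
  have ev_sup': "sup_map L C (ev a)" if a: "a \<in> carrier A" for a
  proof (rule sup_mapI[OF L.complete_lattice_axioms cC])
    show "ev a e \<in> carrier C" if "e \<in> carrier L" for e using a that by (rule ev_closed)
    fix X y assume X: "X \<subseteq> carrier L" and y: "y \<in> carrier C"
    have decX: "dec ` X \<subseteq> ?P" using X dec_P by blast
    have "left_lin A C (SUPP (dec ` X))" using SUPP[OF decX] by blast
    note s = rep[OF this]
    have "\<Squnion>\<^bsub>L\<^esub> X = rep (SUPP (dec ` X))"
    proof (rule L.eq_by_upper[OF L.lub_closed[OF X] s(1)])
      fix z assume z: "z \<in> carrier L"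
      show "\<Squnion>\<^bsub>L\<^esub> X \<sqsubseteq>\<^bsub>L\<^esub> z \<longleftrightarrow> rep (SUPP (dec ` X)) \<sqsubseteq>\<^bsub>L\<^esub> z"
        using L.lub_le_iff[OF X z] SUPP_le[OF decX dec_P[OF z]] leL[OF _ z] X le_ev[OF s(1) z]
        by (auto simp: s(2) ev_def[of _ z] subset_iff)
    qed
    moreover have "(\<lambda>f. f a) ` dec ` X \<subseteq> carrier C" using decX a P_closed by blast
    ultimately show "ev a (\<Squnion>\<^bsub>L\<^esub> X) \<sqsubseteq>\<^bsub>C\<^esub> y \<longleftrightarrow> (\<forall>e \<in> X. ev a e \<sqsubseteq>\<^bsub>C\<^esub> y)"
      using s(2)[OF a] C.lub_le_iff[OF _ y] a by (simp add: SUPP_def ev_def)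
  qed
  \<comment> \<open>Suprema in \<open>L\<close> are pointwise, so a map into \<open>L\<close>
    preserves them once all its evaluations do. Both actions are handled this way in each of their
    variables.\<close>
  have sup_map_L: "sup_map D L g"
    if D: "complete_lattice D" and g: "\<And>d. d \<in> carrier D \<Longrightarrow> g d \<in> carrier L"
      and ev_g: "\<And>a. a \<in> carrier A \<Longrightarrow> sup_map D C (\<lambda>d. ev a (g d))"
    for D :: "('u, 'x) gorder_scheme" and g
  proof (rule sup_mapI[OF D L.complete_lattice_axioms g], assumption)
    fix X y assume X: "X \<subseteq> carrier D" and y: "y \<in> carrier L"
    have DX: "\<Squnion>\<^bsub>D\<^esub> X \<in> carrier D" using X D complete_lattice.lub_closed by blast
    have "g (\<Squnion>\<^bsub>D\<^esub> X) \<sqsubseteq>\<^bsub>L\<^esub> y \<longleftrightarrow> (\<forall>a \<in> carrier A. \<forall>d \<in> X. ev a (g d) \<sqsubseteq>\<^bsub>C\<^esub> ev a y)"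
      using le_ev[OF g[OF DX] y] sup_map_lub_le_iff[OF ev_g X ev_closed[OF _ y]] by simp
    also have "\<dots> \<longleftrightarrow> (\<forall>d \<in> X. g d \<sqsubseteq>\<^bsub>L\<^esub> y)"
      using le_ev[OF g y] X by (auto simp: subset_iff)
    finally show "g (\<Squnion>\<^bsub>D\<^esub> X) \<sqsubseteq>\<^bsub>L\<^esub> y \<longleftrightarrow> (\<forall>d \<in> X. g d \<sqsubseteq>\<^bsub>L\<^esub> y)" .
  qed
  \<comment> \<open>A scalar \<open>r\<close> acts by (r e)(a) = e(a r) and a scalar
    \<open>s\<close> by (e s)(a) = e(a) s. Multiplying arguments on the right yields a left
    action.\<close>
  define E where "E = \<lparr>carrier = carrier L, eq = eq L, le = le L, lquant = rquant A, rquant = rquant C,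
    lact = (\<lambda>r e. rep (\<lambda>a. ev (ract A a r) e)), ract = (\<lambda>e s. rep (\<lambda>a. ract C (ev a e) s))\<rparr>"
  have E_simps [simp]: "carrier E = carrier L" "eq E = eq L" "le E = le L" "lquant E = rquant A"
    "rquant E = rquant C"
    by (simp_all add: E_def)
  have sup_map_E [simp]: "sup_map D E f \<longleftrightarrow> sup_map D L f" "sup_map E D f \<longleftrightarrow> sup_map L D f"
    for D :: "('u, 'x) gorder_scheme" and f by (rule sup_map_cong_order; simp)+
  have suplattice_E: "suplattice E" using L suplattice_cong_order[of E L] by simp
  note Q = qmoduleD(2)[OF A] and S = qmoduleD(2)[OF C]
  have lE: "lact E r e \<in> carrier L" "\<And>a. a \<in> carrier A \<Longrightarrow> ev a (lact E r e) = ev (ract A a r) e"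
    if r: "r \<in> carrier (rquant A)" and e: "e \<in> carrier L" for r e
  proof -
    have "left_lin A C (\<lambda>a. ev (ract A a r) e)"
      using r e A by (auto simp: left_lin_def lact_ract ev_lact ract_closed
          intro!: sup_map_comp[OF sup_map_ract(1) ev_sup])
    from rep[OF this] show "lact E r e \<in> carrier L"
      "\<And>a. a \<in> carrier A \<Longrightarrow> ev a (lact E r e) = ev (ract A a r) e" by (simp_all add: E_def)
  qed
  have rE: "ract E e s \<in> carrier L" "\<And>a. a \<in> carrier A \<Longrightarrow> ev a (ract E e s) = ract C (ev a e) s"
    if s: "s \<in> carrier (rquant C)" and e: "e \<in> carrier L" for s e
  proof -
    have "left_lin A C (\<lambda>a. ract C (ev a e) s)"
      using s e C AC by (auto simp: left_lin_def lact_ract ev_lact ev_closed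
          intro!: sup_map_comp[OF ev_sup sup_map_ract(1)])
    from rep[OF this] show "ract E e s \<in> carrier L"
      "\<And>a. a \<in> carrier A \<Longrightarrow> ev a (ract E e s) = ract C (ev a e) s" by (simp_all add: E_def)
  qed
  have lE_sup: "sup_bimap (rquant A) L L (lact E)"
  proof (rule sup_bimapI)
    fix r assume r: "r \<in> carrier (rquant A)"
    have "sup_map L C (\<lambda>e. ev a (lact E r e))" if a: "a \<in> carrier A" for a
      by (rule sup_map_cong[THEN iffD2, OF _ ev_sup'[OF ract_closed[OF A a r]]])
        (use r a lE(2) in simp)
    then show "sup_map L L (lact E r)" using r lE(1) by (intro sup_map_L L.complete_lattice_axioms)
  next
    fix e assume e: "e \<in> carrier L"
    have "sup_map (rquant A) C (\<lambda>r. ev a (lact E r e))" if a: "a \<in> carrier A" for a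
      by (rule sup_map_cong[THEN iffD2, OF _ sup_map_comp[OF sup_map_ract(2)[OF A a] ev_sup[OF e]]])
        (use e a lE(2) in simp)
    then show "sup_map (rquant A) L (\<lambda>r. lact E r e)"
      using e lE(1) Q by (intro sup_map_L unital_quantaleD)
  qed
  have rE_sup: "sup_bimap L (rquant C) L (ract E)"
  proof (rule sup_bimapI)
    fix s assume s: "s \<in> carrier (rquant C)"
    have "sup_map L C (\<lambda>e. ev a (ract E e s))" if a: "a \<in> carrier A" for a
      by (rule sup_map_cong[THEN iffD2, OF _ sup_map_comp[OF ev_sup'[OF a] sup_map_ract(1)[OF C s]]])
        (use s a rE(2) in simp)
    then show "sup_map L L (\<lambda>e. ract E e s)" using s rE(1) by (intro sup_map_L L.complete_lattice_axioms)
  next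
    fix e assume e: "e \<in> carrier L"
    have "sup_map (rquant C) C (\<lambda>s. ev a (ract E e s))" if a: "a \<in> carrier A" for a
      by (rule sup_map_cong[THEN iffD2, OF _ sup_map_ract(2)[OF C ev_closed[OF a e]]])
        (use e a rE(2) in simp)
    then show "sup_map (rquant C) L (ract E e)"
      using e rE(1) S by (intro sup_map_L unital_quantaleD)
  qed
  have "is_qmodule E"
    unfolding is_qmodule_def
  proof (intro conjI ballI)
    show "sup_bimap (lquant E) E E (lact E)" "sup_bimap E (rquant E) E (ract E)"
      using lE_sup rE_sup by (simp_all add: sup_bimap_def)
  next
    fix q q' e assume *: "q \<in> carrier (lquant E)" "q' \<in> carrier (lquant E)" "e \<in> carrier E"
    show "lact E (qmult (lquant E) q q') e = lact E q (lact E q' e)"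
      by (rule ev_ext)
        (use * A Q in \<open>simp_all add: lE unital_quantaleD(7) ract_closed ract_qmult\<close>)
  next
    fix e s s' assume *: "e \<in> carrier E" "s \<in> carrier (rquant E)" "s' \<in> carrier (rquant E)"
    show "ract E e (qmult (rquant E) s s') = ract E (ract E e s) s'"
      by (rule ev_ext)
        (use * C S in \<open>simp_all add: rE unital_quantaleD(7) ev_closed ract_qmult\<close>)
  next
    fix e assume e: "e \<in> carrier E"
    show "lact E (qunit (lquant E)) e = e"
      by (rule ev_ext) (use e A Q in \<open>simp_all add: lE unital_quantaleD(3) ract_qunit\<close>)
    show "ract E e (qunit (rquant E)) = e"
      by (rule ev_ext) (use e C S in \<open>simp_all add: rE unital_quantaleD(3) ev_closed ract_qunit\<close>)
  next
    fix q e s assume *: "q \<in> carrier (lquant E)" "e \<in> carrier E" "s \<in> carrier (rquant E)"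
    show "ract E (lact E q e) s = lact E q (ract E e s)"
      by (rule ev_ext) (use * A C in \<open>simp_all add: lE rE ract_closed\<close>)
  qed (use Q S suplattice_E in simp_all)
  moreover have "balanced A E C ev"
    by (rule balancedI) (simp_all add: ev_sup ev_sup' lE)
  ultimately have "bilin A E C ev"
    using A C AC by (simp add: bilin_def ev_lact rE)
  moreover have "\<exists>!e. e \<in> carrier E \<and> (\<forall>a \<in> carrier A. ev a e = f a)" if "left_lin A C f" for f
    using rep[OF that] ev_ext by (intro ex1I[of _ "rep f"]) auto
  ultimately have "lhom A C E ev" by (simp add: lhom_def)
  then show ?thesis by blast
qed

text \<open>Currying of homomorphisms out of a tensor product, without reference to tensor products.\<close>

definition curries :: "'u qmodule \<Rightarrow> 'u qmodule \<Rightarrow> 'u qmodule \<Rightarrow> ('u \<Rightarrow> 'u \<Rightarrow> 'u) \<Rightarrow> bool" where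
  "curries A C E ev \<longleftrightarrow> bilin A E C ev \<and>
     (\<forall>D f. bilin A D C f \<longrightarrow>
        (\<exists>\<phi>. lin D E \<phi> \<and> (\<forall>a \<in> carrier A. \<forall>d \<in> carrier D. ev a (\<phi> d) = f a d))) \<and>
     (\<forall>D \<phi> \<psi>. lin D E \<phi> \<longrightarrow> lin D E \<psi> \<longrightarrow>
        (\<forall>a \<in> carrier A. \<forall>d \<in> carrier D. ev a (\<phi> d) = ev a (\<psi> d)) \<longrightarrow>
        (\<forall>d \<in> carrier D. \<phi> d = \<psi> d))"

lemma curries_ex:
  "curries A C E ev \<Longrightarrow> bilin A D C f \<Longrightarrow>
    \<exists>\<phi>. lin D E \<phi> \<and> (\<forall>a \<in> carrier A. \<forall>d \<in> carrier D. ev a (\<phi> d) = f a d)"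
  by (simp add: curries_def)

lemma curries_unique:
  assumes "curries A C E ev" "lin D E \<phi>" "lin D E \<psi>" "d \<in> carrier D"
    and "\<And>a d. a \<in> carrier A \<Longrightarrow> d \<in> carrier D \<Longrightarrow> ev a (\<phi> d) = ev a (\<psi> d)"
  shows "\<phi> d = \<psi> d"
proof -
  have "\<forall>a \<in> carrier A. \<forall>d \<in> carrier D. ev a (\<phi> d) = ev a (\<psi> d)" using assms(5) by blast
  with assms(1-4) show ?thesis unfolding curries_def by meson
qed

text \<open>For fixed \<open>d\<close> the map \<open>a \<mapsto> f a d\<close> is left linear,
  hence represented by one element of \<open>E\<close>. The choice is linear in \<open>d\<close>
  because evaluations separate the elements of \<open>E\<close>.\<close>

lemma lhom_curries:
  assumes E: "lhom A C E ev"
  shows "curries A C E ev"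
proof -
  have ev: "bilin A E C ev" using E by (simp add: lhom_def)
  note B = bilinD[OF ev] and ext = lhom_eqI[OF E]
  have "\<exists>\<phi>. lin D E \<phi> \<and> (\<forall>a \<in> carrier A. \<forall>d \<in> carrier D. ev a (\<phi> d) = f a d)"
    if f: "bilin A D C f" for D f
  proof -
    note F = bilinD[OF f]
    interpret E: complete_lattice E using B(2) by (rule qmoduleD)
    interpret D: complete_lattice D using F(2) by (rule qmoduleD)
    have "\<forall>d. \<exists>e. d \<in> carrier D \<longrightarrow> e \<in> carrier E \<and> (\<forall>a \<in> carrier A. ev a e = f a d)"
      using lhom_ex[OF E left_lin_bilin[OF f]] by blast
    then obtain \<phi> where \<phi>: "\<And>d. d \<in> carrier D \<Longrightarrow> \<phi> d \<in> carrier E"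
      and ev_\<phi>: "\<And>d a. d \<in> carrier D \<Longrightarrow> a \<in> carrier A \<Longrightarrow> ev a (\<phi> d) = f a d" by metis
    have Q: "lquant D = lquant E" "rquant D = rquant E" using B F by simp_all
    have "\<phi> (\<Squnion>\<^bsub>D\<^esub> X) = \<Squnion>\<^bsub>E\<^esub> (\<phi> ` X)" if X: "X \<subseteq> carrier D" for X
    proof (rule ext[OF \<phi>[OF D.lub_closed[OF X]]])
      have \<phi>X: "\<phi> ` X \<subseteq> carrier E" using X \<phi> by blast
      then show "\<Squnion>\<^bsub>E\<^esub> (\<phi> ` X) \<in> carrier E" by (rule E.lub_closed)
      fix a assume a: "a \<in> carrier A"
      have "ev a ` \<phi> ` X = f a ` X"
        unfolding image_image using X ev_\<phi> a by (intro image_cong) auto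
      then show "ev a (\<phi> (\<Squnion>\<^bsub>D\<^esub> X)) = ev a (\<Squnion>\<^bsub>E\<^esub> (\<phi> ` X))"
        using sup_map_lub[OF balancedD(2)[OF B(7) a] \<phi>X] sup_map_lub[OF balancedD(2)[OF F(7) a] X]
          ev_\<phi>[OF D.lub_closed[OF X] a] by simp
    qed
    then have "sup_map D E \<phi>"
      using \<phi> D.complete_lattice_axioms E.complete_lattice_axioms by (simp add: sup_map_def sup_pres_def)
    moreover have "\<phi> (lact D r d) = lact E r (\<phi> d)" if "r \<in> carrier (lquant D)" "d \<in> carrier D" for r d
    proof (rule ext)
      show "ev a (\<phi> (lact D r d)) = ev a (lact E r (\<phi> d))" if a: "a \<in> carrier A" for a
        using balancedD(5)[OF B(7), of a r "\<phi> d"] balancedD(5)[OF F(7), of a r d]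
          a \<open>r \<in> _\<close> \<open>d \<in> _\<close> \<phi> ev_\<phi> B F by (simp add: lact_closed ract_closed)
    qed (use that \<phi> B F Q in \<open>simp_all add: lact_closed\<close>)
    moreover have "\<phi> (ract D d s) = ract E (\<phi> d) s" if "s \<in> carrier (rquant D)" "d \<in> carrier D" for s d
    proof (rule ext)
      show "ev a (\<phi> (ract D d s)) = ev a (ract E (\<phi> d) s)" if a: "a \<in> carrier A" for a
        using B(9)[of a "\<phi> d" s] F(9)[of a d s] a \<open>s \<in> _\<close> \<open>d \<in> _\<close> \<phi> ev_\<phi> B(2) F(2) Q
        by (simp add: ract_closed)
    qed (use that \<phi> B F Q in \<open>simp_all add: ract_closed\<close>)
    ultimately have "lin D E \<phi>" using B F Q by (simp add: lin_def)
    then show ?thesis using ev_\<phi> by blast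
  qed
  moreover have "\<phi> d = \<psi> d"
    if "lin D E \<phi>" "lin D E \<psi>" "\<forall>a \<in> carrier A. \<forall>d \<in> carrier D. ev a (\<phi> d) = ev a (\<psi> d)" "d \<in> carrier D"
    for D \<phi> \<psi> d
    by (rule ext[OF linD(6)[OF that(1) that(4)] linD(6)[OF that(2) that(4)]]) (use that in simp)
  ultimately show ?thesis unfolding curries_def using ev by blast
qed

text \<open>Currying tests \<open>E\<close> only against modules \<open>D\<close>, whereas duality
  needs its elements. They are recovered by comparison with a constructed hom module
  \<open>E'\<close>, which has the same currying property.\<close>

lemma curries_lhom:
  fixes A C E :: "'u qmodule"
  assumes sl: "strong_limit_type TYPE('u)" and E: "curries A C E ev"
  shows "lhom A C E ev"
proof -
  have ev: "bilin A E C ev" using E by (simp add: curries_def)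
  note B = bilinD[OF ev]
  obtain E' ev' where E': "lhom A C E' ev'" using lhom_exists[OF sl B(1,3)] B(5) by auto
  then have ev': "bilin A E' C ev'" by (simp add: lhom_def)
  obtain \<phi> where \<phi>: "lin E' E \<phi>" and ev_\<phi>: "\<And>a e. a \<in> carrier A \<Longrightarrow> e \<in> carrier E' \<Longrightarrow> ev a (\<phi> e) = ev' a e"
    using E ev' unfolding curries_def by blast
  obtain \<psi> where \<psi>: "lin E E' \<psi>" and ev_\<psi>: "\<And>a e. a \<in> carrier A \<Longrightarrow> e \<in> carrier E \<Longrightarrow> ev' a (\<psi> e) = ev a e"
    using lhom_curries[OF E'] ev unfolding curries_def by blast
  \<comment> \<open>One of the two composites suffices: it makes \<open>\<psi>\<close> injective,
    which yields uniqueness, while \<open>\<phi>\<close> transports representing elements from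
    \<open>E'\<close> to \<open>E\<close>.\<close>
  have "\<forall>a \<in> carrier A. \<forall>e \<in> carrier E. ev a (\<phi> (\<psi> e)) = ev a e"
    using ev_\<phi> ev_\<psi> linD(6)[OF \<psi>] by simp
  then have \<phi>\<psi>: "\<phi> (\<psi> e) = e" if "e \<in> carrier E" for e
    using E lin_comp[OF \<psi> \<phi>] lin_ident[OF B(2)] that unfolding curries_def by blast
  have "\<exists>!e. e \<in> carrier E \<and> (\<forall>a \<in> carrier A. ev a e = f a)" if f: "left_lin A C f" for f
  proof (rule ex_ex1I)
    obtain e where "e \<in> carrier E'" "\<forall>a \<in> carrier A. ev' a e = f a" using lhom_ex[OF E' f] by blast
    then show "\<exists>e. e \<in> carrier E \<and> (\<forall>a \<in> carrier A. ev a e = f a)"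
      using ev_\<phi> linD(6)[OF \<phi>] by (intro exI[of _ "\<phi> e"]) simp
    fix e e' assume e: "e \<in> carrier E \<and> (\<forall>a \<in> carrier A. ev a e = f a)"
      and e': "e' \<in> carrier E \<and> (\<forall>a \<in> carrier A. ev a e' = f a)"
    have "\<psi> e = \<psi> e'"
      by (rule lhom_eqI[OF E']) (use e e' linD(6)[OF \<psi>] in \<open>simp_all add: ev_\<psi>\<close>)
    then show "e = e'" using \<phi>\<psi> e e' by metis
  qed
  then show ?thesis using ev by (simp add: lhom_def)
qed

definition rcurries :: "'u qmodule \<Rightarrow> 'u qmodule \<Rightarrow> 'u qmodule \<Rightarrow> ('u \<Rightarrow> 'u \<Rightarrow> 'u) \<Rightarrow> bool" where
  "rcurries C A E ev \<longleftrightarrow> bilin E A C ev \<and>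
     (\<forall>D f. bilin D A C f \<longrightarrow>
        (\<exists>\<phi>. lin D E \<phi> \<and> (\<forall>a \<in> carrier A. \<forall>d \<in> carrier D. ev (\<phi> d) a = f d a))) \<and>
     (\<forall>D \<phi> \<psi>. lin D E \<phi> \<longrightarrow> lin D E \<psi> \<longrightarrow>
        (\<forall>a \<in> carrier A. \<forall>d \<in> carrier D. ev (\<phi> d) a = ev (\<psi> d) a) \<longrightarrow>
        (\<forall>d \<in> carrier D. \<phi> d = \<psi> d))"

lemma rcurries_ex:
  "rcurries C A E ev \<Longrightarrow> bilin D A C f \<Longrightarrow>
    \<exists>\<phi>. lin D E \<phi> \<and> (\<forall>a \<in> carrier A. \<forall>d \<in> carrier D. ev (\<phi> d) a = f d a)"
  by (simp add: rcurries_def)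

lemma rcurries_unique:
  assumes "rcurries C A E ev" "lin D E \<phi>" "lin D E \<psi>" "d \<in> carrier D"
    and "\<And>a d. a \<in> carrier A \<Longrightarrow> d \<in> carrier D \<Longrightarrow> ev (\<phi> d) a = ev (\<psi> d) a"
  shows "\<phi> d = \<psi> d"
proof -
  have "\<forall>a \<in> carrier A. \<forall>d \<in> carrier D. ev (\<phi> d) a = ev (\<psi> d) a" using assms(5) by blast
  with assms(1-4) show ?thesis unfolding rcurries_def by meson
qed

text \<open>Only the arguments of \<open>ev\<close> are exchanged: the test module \<open>D\<close>
  ranges over all modules, so its opposite may be substituted for it, and a linear map stays linear
  between opposites.\<close>

lemma curries_opp:
  assumes "curries A C E ev"
  shows "rcurries (opp_qmodule C) (opp_qmodule A) (opp_qmodule E) (\<lambda>e a. ev a e)"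
  unfolding rcurries_def
proof (intro conjI allI impI)
  show "bilin (opp_qmodule E) (opp_qmodule A) (opp_qmodule C) (\<lambda>e a. ev a e)"
    using assms by (simp add: curries_def bilin_opp_iff)
next
  fix D f assume "bilin D (opp_qmodule A) (opp_qmodule C) f"
  then have "bilin A (opp_qmodule D) C (\<lambda>a d. f d a)" by (auto dest: bilin_opp)
  then obtain \<phi> where "lin (opp_qmodule D) E \<phi>" "\<forall>a \<in> carrier A. \<forall>d \<in> carrier D. ev a (\<phi> d) = f d a"
    using curries_ex[OF assms] by fastforce
  then show "\<exists>\<phi>. lin D (opp_qmodule E) \<phi> \<and>
      (\<forall>a \<in> carrier (opp_qmodule A). \<forall>d \<in> carrier D. ev a (\<phi> d) = f d a)"
    using lin_opp[of "opp_qmodule D" E \<phi>] by auto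
next
  fix D \<phi> \<psi>
  assume *: "lin D (opp_qmodule E) \<phi>" "lin D (opp_qmodule E) \<psi>"
    and **: "\<forall>a \<in> carrier (opp_qmodule A). \<forall>d \<in> carrier D. ev a (\<phi> d) = ev a (\<psi> d)"
  have "lin (opp_qmodule D) E \<phi>" "lin (opp_qmodule D) E \<psi>"
    using * lin_opp[of D "opp_qmodule E"] by auto
  from curries_unique[OF assms this] show "\<forall>d \<in> carrier D. \<phi> d = \<psi> d" using ** by simp
qed

lemma rcurries_opp:
  assumes "rcurries C A E ev"
  shows "curries (opp_qmodule A) (opp_qmodule C) (opp_qmodule E) (\<lambda>a e. ev e a)"
  unfolding curries_def
proof (intro conjI allI impI)
  show "bilin (opp_qmodule A) (opp_qmodule E) (opp_qmodule C) (\<lambda>a e. ev e a)"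
    using assms by (simp add: rcurries_def bilin_opp_iff)
next
  fix D f assume "bilin (opp_qmodule A) D (opp_qmodule C) f"
  then have "bilin (opp_qmodule D) A C (\<lambda>d a. f a d)" by (auto dest: bilin_opp)
  then obtain \<phi> where "lin (opp_qmodule D) E \<phi>" "\<forall>a \<in> carrier A. \<forall>d \<in> carrier D. ev (\<phi> d) a = f a d"
    using rcurries_ex[OF assms] by fastforce
  then show "\<exists>\<phi>. lin D (opp_qmodule E) \<phi> \<and>
      (\<forall>a \<in> carrier (opp_qmodule A). \<forall>d \<in> carrier D. ev (\<phi> d) a = f a d)"
    using lin_opp[of "opp_qmodule D" E \<phi>] by auto
next
  fix D \<phi> \<psi>
  assume *: "lin D (opp_qmodule E) \<phi>" "lin D (opp_qmodule E) \<psi>"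
    and **: "\<forall>a \<in> carrier (opp_qmodule A). \<forall>d \<in> carrier D. ev (\<phi> d) a = ev (\<psi> d) a"
  have "lin (opp_qmodule D) E \<phi>" "lin (opp_qmodule D) E \<psi>"
    using * lin_opp[of D "opp_qmodule E"] by auto
  from rcurries_unique[OF assms this] show "\<forall>d \<in> carrier D. \<phi> d = \<psi> d" using ** by simp
qed

section \<open>Duality\<close>

text \<open>
  A perfect pairing of \<open>A : Q \<rightarrow> R\<close> with \<open>E : R \<rightarrow> Q\<close> identifies \<open>E\<close> with the order dual of \<open>A\<close>,
  via \<open>e \<mapsto> \<Squnion>{a. H a e}\<close>.
\<close>

definition perfect :: "'u qmodule \<Rightarrow> 'u qmodule \<Rightarrow> ('u \<Rightarrow> 'u \<Rightarrow> bool) \<Rightarrow> bool" where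
  "perfect A E H \<longleftrightarrow>
     is_qmodule A \<and> is_qmodule E \<and> lquant E = rquant A \<and> rquant E = lquant A \<and>
     (\<forall>X e. X \<subseteq> carrier A \<longrightarrow> e \<in> carrier E \<longrightarrow> H (\<Squnion>\<^bsub>A\<^esub> X) e \<longleftrightarrow> (\<forall>x \<in> X. H x e)) \<and>
     (\<forall>a X. a \<in> carrier A \<longrightarrow> X \<subseteq> carrier E \<longrightarrow> H a (\<Squnion>\<^bsub>E\<^esub> X) \<longleftrightarrow> (\<forall>x \<in> X. H a x)) \<and>
     (\<forall>q \<in> carrier (lquant A). \<forall>a \<in> carrier A. \<forall>e \<in> carrier E. H (lact A q a) e \<longleftrightarrow> H a (ract E e q)) \<and>
     (\<forall>r \<in> carrier (rquant A). \<forall>a \<in> carrier A. \<forall>e \<in> carrier E. H (ract A a r) e \<longleftrightarrow> H a (lact E r e)) \<and>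
     (\<forall>e \<in> carrier E. \<forall>e' \<in> carrier E. (\<forall>a \<in> carrier A. H a e \<longleftrightarrow> H a e') \<longrightarrow> e = e') \<and>
     (\<forall>b \<in> carrier A. \<exists>e \<in> carrier E. \<forall>a \<in> carrier A. H a e \<longleftrightarrow> a \<sqsubseteq>\<^bsub>A\<^esub> b)"

lemma perfectD:
  assumes "perfect A E H"
  shows "is_qmodule A" "is_qmodule E" "lquant E = rquant A" "rquant E = lquant A"
    and "X \<subseteq> carrier A \<Longrightarrow> e \<in> carrier E \<Longrightarrow> H (\<Squnion>\<^bsub>A\<^esub> X) e \<longleftrightarrow> (\<forall>x \<in> X. H x e)"
    and "a \<in> carrier A \<Longrightarrow> Y \<subseteq> carrier E \<Longrightarrow> H a (\<Squnion>\<^bsub>E\<^esub> Y) \<longleftrightarrow> (\<forall>x \<in> Y. H a x)"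
    and "q \<in> carrier (lquant A) \<Longrightarrow> a \<in> carrier A \<Longrightarrow> e \<in> carrier E
      \<Longrightarrow> H (lact A q a) e \<longleftrightarrow> H a (ract E e q)"
    and "r \<in> carrier (rquant A) \<Longrightarrow> a \<in> carrier A \<Longrightarrow> e \<in> carrier E
      \<Longrightarrow> H (ract A a r) e \<longleftrightarrow> H a (lact E r e)"
    and "b \<in> carrier A \<Longrightarrow> \<exists>e \<in> carrier E. \<forall>a \<in> carrier A. H a e \<longleftrightarrow> a \<sqsubseteq>\<^bsub>A\<^esub> b"
  using assms unfolding perfect_def by simp_all

lemma perfect_eqI:
  assumes "perfect A E H" "e \<in> carrier E" "e' \<in> carrier E"
    and "\<And>a. a \<in> carrier A \<Longrightarrow> H a e \<longleftrightarrow> H a e'"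
  shows "e = e'"
proof -
  have "\<forall>a \<in> carrier A. H a e \<longleftrightarrow> H a e'" using assms(4) by blast
  with assms(1-3) show ?thesis unfolding perfect_def by meson
qed

text \<open>The clauses for the left and the right scalars trade places, so the relation itself
  stays the same.\<close>

lemma perfect_opp: "perfect A E H \<Longrightarrow> perfect (opp_qmodule A) (opp_qmodule E) H"
  unfolding perfect_def by simp

text \<open>A predicate compatible with suprema in this two-sided sense is a sup-preserving map to
  the two-element lattice, where \<open>P\<close> marks the elements sent to 0. The largest such
  element, the supremum of all of them, represents it.\<close>

lemma (in complete_lattice) principal_if_lub_closed:
  assumes P: "\<And>X. X \<subseteq> carrier L \<Longrightarrow> P (\<Squnion>X) \<longleftrightarrow> (\<forall>x \<in> X. P x)"
  shows "\<exists>b \<in> carrier L. \<forall>a \<in> carrier L. P a \<longleftrightarrow> a \<sqsubseteq> b"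
proof (intro bexI ballI)
  let ?X = "{a \<in> carrier L. P a}"
  have X: "?X \<subseteq> carrier L" by blast
  show b: "\<Squnion>?X \<in> carrier L" using X by (rule lub_closed)
  fix a assume a: "a \<in> carrier L"
  show "P a \<longleftrightarrow> a \<sqsubseteq> \<Squnion>?X"
  proof
    show "a \<sqsubseteq> \<Squnion>?X" if "P a" using lub_le_iff[OF X b] a b that by simp
    assume le: "a \<sqsubseteq> \<Squnion>?X"
    \<comment> \<open>Downward closure is extracted from the supremum of a pair: if a is below b,
      then b is the supremum of {a, b}, and the equivalence passes from it to both members.\<close>
    have "P (\<Squnion>{a, \<Squnion>?X})" unfolding lub_pair_eq[OF a b le] using P[OF X] by simp
    then show "P a" using P[of "{a, \<Squnion>?X}"] a b by simp
  qed
qed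

lemma perfect_principal:
  assumes H: "perfect A E H" and e: "e \<in> carrier E"
  obtains b where "b \<in> carrier A" "\<And>a. a \<in> carrier A \<Longrightarrow> H a e \<longleftrightarrow> a \<sqsubseteq>\<^bsub>A\<^esub> b"
proof -
  interpret A: complete_lattice A using perfectD(1)[OF H] by (rule qmoduleD)
  show ?thesis
    using A.principal_if_lub_closed[of "\<lambda>a. H a e"] perfectD(5)[OF H _ e] that by blast
qed

text \<open>Only separation and representability are asymmetric in the definition. Separation of
  \<open>A\<close> follows by relating to the elements that represent principal ideals, and
  \<open>e0\<close> corresponds to the largest \<open>b\<close> related to it. This symmetry later
  makes \<open>A\<close> a partner of its own dual.\<close>

lemma perfect_sym:
  assumes H: "perfect A E H"
  shows "perfect E A (\<lambda>e a. H a e)"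
proof -
  note D = perfectD[OF H]
  interpret A: complete_lattice A using D(1) by (rule qmoduleD)
  interpret E: complete_lattice E using D(2) by (rule qmoduleD)
  have eq: "a = a'" if a: "a \<in> carrier A" and a': "a' \<in> carrier A"
    and eq: "\<forall>e \<in> carrier E. H a e \<longleftrightarrow> H a' e" for a a'
  proof (rule A.eq_by_upper[OF a a'])
    fix b assume b: "b \<in> carrier A"
    obtain e where e: "e \<in> carrier E" and He: "\<forall>a \<in> carrier A. H a e \<longleftrightarrow> a \<sqsubseteq>\<^bsub>A\<^esub> b"
      using D(9)[OF b] by blast
    then show "a \<sqsubseteq>\<^bsub>A\<^esub> b \<longleftrightarrow> a' \<sqsubseteq>\<^bsub>A\<^esub> b"
      using bspec[OF He a] bspec[OF He a'] bspec[OF eq e] by simp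
  qed
  have princ: "\<exists>b \<in> carrier A. \<forall>e \<in> carrier E. H b e \<longleftrightarrow> e \<sqsubseteq>\<^bsub>E\<^esub> e0" if e0: "e0 \<in> carrier E" for e0
  proof -
    obtain b where b: "b \<in> carrier A" and Hb: "\<And>a. a \<in> carrier A \<Longrightarrow> H a e0 \<longleftrightarrow> a \<sqsubseteq>\<^bsub>A\<^esub> b"
      using perfect_principal[OF H e0] by blast
    have "H b e \<longleftrightarrow> e \<sqsubseteq>\<^bsub>E\<^esub> e0" if e: "e \<in> carrier E" for e
    proof
      have sub: "{e, e0} \<subseteq> carrier E" using e e0 by simp
      \<comment> \<open>Since \<open>b\<close> is the largest element related to \<open>e0\<close>,
        this says that everything related to \<open>e0\<close> is related to \<open>e\<close>.
        Adding \<open>e\<close> to \<open>e0\<close> then does not change the relation, and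
        separation gives the equality of the supremum with \<open>e0\<close>.\<close>
      assume Hbe: "H b e"
      have "H a e" if "a \<in> carrier A" "H a e0" for a
      proof -
        obtain c where "c \<in> carrier A" "\<And>a. a \<in> carrier A \<Longrightarrow> H a e \<longleftrightarrow> a \<sqsubseteq>\<^bsub>A\<^esub> c"
          using perfect_principal[OF H e] by blast
        then show ?thesis using Hb[OF that(1)] that Hbe b by (metis A.le_trans)
      qed
      then have "\<Squnion>\<^bsub>E\<^esub> {e, e0} = e0"
        by (intro perfect_eqI[OF H E.lub_closed[OF sub] e0]) (use D(6)[OF _ sub] in auto)
      then show "e \<sqsubseteq>\<^bsub>E\<^esub> e0" using E.lub_le_iff[OF sub e0] e0 by simp
    next
      assume le: "e \<sqsubseteq>\<^bsub>E\<^esub> e0"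
      have sub: "{e, e0} \<subseteq> carrier E" using e e0 by simp
      have "H b e0" using Hb[OF b] b by simp
      then show "H b e" using D(6)[OF b sub] E.lub_pair_eq[OF e e0 le] by simp
    qed
    then show ?thesis using b by blast
  qed
  show ?thesis
    unfolding perfect_def using D eq princ by auto
qed

text \<open>Compatibility with the pairings already forces \<open>\<phi>\<close> to be an
  isomorphism of modules: every equation in \<open>E\<close> is tested by pairing with elements of
  \<open>A\<close>, where suprema and actions can be moved across the relation.\<close>

lemma perfect_iso:
  assumes H: "perfect A E H" and H': "perfect A E' H'"
    and \<phi>: "\<And>e. e \<in> carrier E' \<Longrightarrow> \<phi> e \<in> carrier E"
    and H\<phi>: "\<And>a e. a \<in> carrier A \<Longrightarrow> e \<in> carrier E' \<Longrightarrow> H a (\<phi> e) \<longleftrightarrow> H' a e"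
  shows "lin E' E \<phi>" and "bij_betw \<phi> (carrier E') (carrier E)"
proof -
  note D = perfectD[OF H] and D' = perfectD[OF H']
  interpret E: complete_lattice E using D(2) by (rule qmoduleD)
  interpret E': complete_lattice E' using D'(2) by (rule qmoduleD)
  have "\<phi> (\<Squnion>\<^bsub>E'\<^esub> X) = \<Squnion>\<^bsub>E\<^esub> (\<phi> ` X)" if X: "X \<subseteq> carrier E'" for X
  proof -
    have \<phi>X: "\<phi> ` X \<subseteq> carrier E" using X \<phi> by blast
    have "H a (\<phi> (\<Squnion>\<^bsub>E'\<^esub> X)) \<longleftrightarrow> H a (\<Squnion>\<^bsub>E\<^esub> (\<phi> ` X))" if a: "a \<in> carrier A" for a
      using H\<phi>[OF a E'.lub_closed[OF X]] D(6)[OF a \<phi>X] D'(6)[OF a X] H\<phi>[OF a] X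
      by (auto simp: subset_iff)
    then show ?thesis by (rule perfect_eqI[OF H \<phi>[OF E'.lub_closed[OF X]] E.lub_closed[OF \<phi>X]])
  qed
  then have "sup_map E' E \<phi>"
    using \<phi> E.complete_lattice_axioms E'.complete_lattice_axioms by (simp add: sup_map_def sup_pres_def)
  moreover have "\<phi> (lact E' r e) = lact E r (\<phi> e)" if "r \<in> carrier (rquant A)" "e \<in> carrier E'" for r e
    by (rule perfect_eqI[OF H])
      (use that \<phi> H\<phi> D D' in \<open>simp_all add: lact_closed ract_closed flip: D(8) D'(8)\<close>)
  moreover have "\<phi> (ract E' e q) = ract E (\<phi> e) q" if "q \<in> carrier (lquant A)" "e \<in> carrier E'" for q e
    by (rule perfect_eqI[OF H])
      (use that \<phi> H\<phi> D D' in \<open>simp_all add: lact_closed ract_closed flip: D(7) D'(7)\<close>)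
  ultimately show "lin E' E \<phi>" using D D' by (simp add: lin_def)
  show "bij_betw \<phi> (carrier E') (carrier E)"
  proof (rule bij_betwI')
    show "\<phi> e = \<phi> e' \<longleftrightarrow> e = e'" if e: "e \<in> carrier E'" and e': "e' \<in> carrier E'" for e e'
      using perfect_eqI[OF H' e e'] H\<phi>[OF _ e] H\<phi>[OF _ e'] by auto
    show "\<phi> e \<in> carrier E" if "e \<in> carrier E'" for e using that by (rule \<phi>)
    fix e assume e: "e \<in> carrier E"
    \<comment> \<open>Surjectivity holds because the elements of \<open>E\<close> and of
      \<open>E'\<close> are both indexed by elements \<open>b\<close> of \<open>A\<close>, as the
      relations of being below \<open>b\<close>.\<close>
    obtain b where b: "b \<in> carrier A" and Hb: "\<And>a. a \<in> carrier A \<Longrightarrow> H a e \<longleftrightarrow> a \<sqsubseteq>\<^bsub>A\<^esub> b"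
      using perfect_principal[OF H e] by blast
    obtain e' where e': "e' \<in> carrier E'" and Hb': "\<And>a. a \<in> carrier A \<Longrightarrow> H' a e' \<longleftrightarrow> a \<sqsubseteq>\<^bsub>A\<^esub> b"
      using D'(9)[OF b] by blast
    have "e = \<phi> e'" by (rule perfect_eqI[OF H e \<phi>[OF e']]) (use Hb Hb' H\<phi>[OF _ e'] in simp)
    then show "\<exists>e' \<in> carrier E'. e = \<phi> e'" using e' by blast
  qed
qed

lemma perfect_transport:
  assumes H: "perfect A E H" and H': "perfect A E' H'" and e: "e \<in> carrier E'"
  shows "\<exists>e' \<in> carrier E. \<forall>a \<in> carrier A. H a e' \<longleftrightarrow> H' a e"
proof -
  obtain b where b: "b \<in> carrier A" "\<And>a. a \<in> carrier A \<Longrightarrow> H' a e \<longleftrightarrow> a \<sqsubseteq>\<^bsub>A\<^esub> b"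
    using perfect_principal[OF H' e] by blast
  then show ?thesis using perfectD(9)[OF H b(1)] by simp
qed

text \<open>
  The dualizing object: \<open>Q\<close> with the reversed order, that is, the module \<open>[Q, 2]\<close> of sup-preserving
  maps from \<open>Q\<close> to the two-element lattice, where \<open>x\<close> stands for the map sending \<open>q\<close> to \<open>0\<close> iff
  \<open>q \<le> x\<close>.
\<close>

definition dual_module :: "'u quantale \<Rightarrow> 'u qmodule" where
  "dual_module Q = \<lparr>carrier = carrier Q, eq = eq Q, le = (\<lambda>x y. y \<sqsubseteq>\<^bsub>Q\<^esub> x), lquant = Q, rquant = Q,
     lact = (\<lambda>p x. \<Squnion>\<^bsub>Q\<^esub> {q \<in> carrier Q. qmult Q q p \<sqsubseteq>\<^bsub>Q\<^esub> x}),
     ract = (\<lambda>x r. \<Squnion>\<^bsub>Q\<^esub> {q \<in> carrier Q. qmult Q r q \<sqsubseteq>\<^bsub>Q\<^esub> x})\<rparr>"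

lemma dual_module_simps [simp]:
  "carrier (dual_module Q) = carrier Q" "eq (dual_module Q) = eq Q"
  "le (dual_module Q) = (\<lambda>x y. y \<sqsubseteq>\<^bsub>Q\<^esub> x)" "lquant (dual_module Q) = Q" "rquant (dual_module Q) = Q"
  by (simp_all add: dual_module_def)

lemma dual_module_opp: "dual_module (opp_quantale Q) = opp_qmodule (dual_module Q)"
  by (simp add: dual_module_def opp_qmodule_def)

text \<open>The supremum is the value at \<open>y\<close> of the right adjoint of \<open>f\<close>.
  The actions of \<open>dual_module\<close> are of this kind, adjoint to the multiplications of
  \<open>Q\<close>.\<close>

lemma le_lub_preimage_iff:
  assumes f: "sup_map L M f" and x: "x \<in> carrier L" and y: "y \<in> carrier M"
  shows "x \<sqsubseteq>\<^bsub>L\<^esub> \<Squnion>\<^bsub>L\<^esub> {x \<in> carrier L. f x \<sqsubseteq>\<^bsub>M\<^esub> y} \<longleftrightarrow> f x \<sqsubseteq>\<^bsub>M\<^esub> y"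
proof -
  let ?X = "{x \<in> carrier L. f x \<sqsubseteq>\<^bsub>M\<^esub> y}"
  interpret L: complete_lattice L by (rule sup_map_complete_lattice[OF f])
  interpret M: complete_lattice M by (rule sup_map_complete_lattice[OF f])
  have X: "?X \<subseteq> carrier L" by blast
  note c = L.lub_closed[OF X]
  have "f (\<Squnion>\<^bsub>L\<^esub> ?X) \<sqsubseteq>\<^bsub>M\<^esub> y" using sup_map_lub_le_iff[OF f X y] by simp
  then have "f x \<sqsubseteq>\<^bsub>M\<^esub> y" if "x \<sqsubseteq>\<^bsub>L\<^esub> \<Squnion>\<^bsub>L\<^esub> ?X"
    using sup_map_mono[OF f x c that] sup_map_closed[OF f] x y c by (meson M.le_trans)
  moreover have "x \<sqsubseteq>\<^bsub>L\<^esub> \<Squnion>\<^bsub>L\<^esub> ?X" if "f x \<sqsubseteq>\<^bsub>M\<^esub> y"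
    using L.lub_le_iff[OF X c] c x that by simp
  ultimately show ?thesis by blast
qed

text \<open>The actions are the two residuals of the multiplication. Read in [Q, 2], the left action
  by \<open>p\<close> precomposes a functional with right multiplication by \<open>p\<close>, and
  the right action with left multiplication.\<close>

lemma dual_module_act:
  assumes Q: "unital_quantale Q" and p: "p \<in> carrier Q" and x: "x \<in> carrier Q"
  shows "lact (dual_module Q) p x \<in> carrier Q" "ract (dual_module Q) x p \<in> carrier Q"
    and "q \<in> carrier Q \<Longrightarrow> q \<sqsubseteq>\<^bsub>Q\<^esub> lact (dual_module Q) p x \<longleftrightarrow> qmult Q q p \<sqsubseteq>\<^bsub>Q\<^esub> x"
    and "q \<in> carrier Q \<Longrightarrow> q \<sqsubseteq>\<^bsub>Q\<^esub> ract (dual_module Q) x p \<longleftrightarrow> qmult Q p q \<sqsubseteq>\<^bsub>Q\<^esub> x"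
proof -
  interpret Q: complete_lattice Q using Q by (rule unital_quantaleD)
  show "lact (dual_module Q) p x \<in> carrier Q" "ract (dual_module Q) x p \<in> carrier Q"
    by (auto simp: dual_module_def intro!: Q.lub_closed)
  show "q \<in> carrier Q \<Longrightarrow> q \<sqsubseteq>\<^bsub>Q\<^esub> lact (dual_module Q) p x \<longleftrightarrow> qmult Q q p \<sqsubseteq>\<^bsub>Q\<^esub> x"
    using le_lub_preimage_iff[OF unital_quantaleD(6)[OF Q p] _ x] by (simp add: dual_module_def)
  show "q \<in> carrier Q \<Longrightarrow> q \<sqsubseteq>\<^bsub>Q\<^esub> ract (dual_module Q) x p \<longleftrightarrow> qmult Q p q \<sqsubseteq>\<^bsub>Q\<^esub> x"
    using le_lub_preimage_iff[OF unital_quantaleD(5)[OF Q p] _ x] by (simp add: dual_module_def)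
qed

lemma is_qmodule_dual_module:
  assumes Q: "unital_quantale Q"
  shows "is_qmodule (dual_module Q)"
proof -
  let ?D = "dual_module Q"
  interpret Q: complete_lattice Q using Q by (rule unital_quantaleD)
  note U = unital_quantaleD[OF Q] and act = dual_module_act[OF Q]
  have D: "complete_lattice ?D"
    using Q.dual_complete_lattice complete_lattice_cong_order[of ?D "inv_gorder Q"] by simp
  show ?thesis
    unfolding is_qmodule_def
  proof (intro conjI ballI)
    show "suplattice ?D" using D U(1) by (simp add: suplattice_def)
    show "sup_bimap (lquant ?D) ?D ?D (lact ?D)"
    proof (rule sup_bimapI)
      \<comment> \<open>In \<open>Q\<close> a residual is a right adjoint; in the reversed order it
        becomes a left adjoint, with the multiplication as its partner.\<close>
      show "sup_map ?D ?D (lact ?D p)" if "p \<in> carrier (lquant ?D)" for p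
        by (rule sup_mapI_adjoint[OF D D, where g = "\<lambda>y. qmult Q y p"]) (use that act U in simp_all)
      \<comment> \<open>As functions of the scalar the two residuals form a Galois connection: both
        inequalities amount to y \<otimes> p \<le> x in \<open>Q\<close>.\<close>
      show "sup_map (lquant ?D) ?D (\<lambda>p. lact ?D p x)" if "x \<in> carrier ?D" for x
        unfolding dual_module_simps
        by (rule sup_mapI_adjoint[OF U(2) D, where g = "\<lambda>y. ract ?D x y"]) (use that act U in simp_all)
    qed
    show "sup_bimap ?D (rquant ?D) ?D (ract ?D)"
    proof (rule sup_bimapI)
      show "sup_map ?D ?D (\<lambda>x. ract ?D x p)" if "p \<in> carrier (rquant ?D)" for p
        by (rule sup_mapI_adjoint[OF D D, where g = "\<lambda>y. qmult Q p y"]) (use that act U in simp_all)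
      show "sup_map (rquant ?D) ?D (ract ?D x)" if "x \<in> carrier ?D" for x
        unfolding dual_module_simps
        by (rule sup_mapI_adjoint[OF U(2) D, where g = "\<lambda>y. lact ?D y x"]) (use that act U in simp_all)
    qed
  next
    fix p p' x assume *: "p \<in> carrier (lquant ?D)" "p' \<in> carrier (lquant ?D)" "x \<in> carrier ?D"
    show "lact ?D (qmult (lquant ?D) p p') x = lact ?D p (lact ?D p' x)"
      by (rule Q.eq_by_lower) (use * act U in simp_all)
  next
    fix x p p' assume *: "x \<in> carrier ?D" "p \<in> carrier (rquant ?D)" "p' \<in> carrier (rquant ?D)"
    show "ract ?D x (qmult (rquant ?D) p p') = ract ?D (ract ?D x p) p'"
      by (rule Q.eq_by_lower) (use * act U in simp_all)
  next
    fix x assume *: "x \<in> carrier ?D"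
    show "lact ?D (qunit (lquant ?D)) x = x"
      by (rule Q.eq_by_lower) (use * act U in simp_all)
    show "ract ?D x (qunit (rquant ?D)) = x"
      by (rule Q.eq_by_lower) (use * act U in simp_all)
  next
    fix p x r assume *: "p \<in> carrier (lquant ?D)" "x \<in> carrier ?D" "r \<in> carrier (rquant ?D)"
    show "ract ?D (lact ?D p x) r = lact ?D p (ract ?D x r)"
      by (rule Q.eq_by_lower) (use * act U in simp_all)
  qed (use Q in simp_all)
qed

text \<open>A map to \<open>[Q, 2]\<close> is determined by its value at the unit.\<close>

lemma lhom_dual_module_perfect:
  assumes E: "lhom A (dual_module (lquant A)) E ev"
  shows "perfect A E (\<lambda>a e. qunit (lquant A) \<sqsubseteq>\<^bsub>lquant A\<^esub> ev a e)"
proof -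
  let ?Q = "lquant A" let ?D = "dual_module ?Q" let ?H = "\<lambda>a e. qunit ?Q \<sqsubseteq>\<^bsub>?Q\<^esub> ev a e"
  have ev: "bilin A E ?D ev" using E by (simp add: lhom_def)
  note B = bilinD[OF ev]
  note Q = qmoduleD(1)[OF B(1)]
  note U = unital_quantaleD[OF Q] and act = dual_module_act[OF Q]
  interpret Q: complete_lattice ?Q by (rule U(2))
  interpret A: complete_lattice A using B(1) by (rule qmoduleD)
  interpret E: complete_lattice E using B(2) by (rule qmoduleD)
  have ec: "ev a e \<in> carrier ?Q" if "a \<in> carrier A" "e \<in> carrier E" for a e
    using bilin_closed[OF ev that] by simp
  \<comment> \<open>The relation recovers all of \<open>ev a e\<close>, since the elements below
    this value are read off from the multiples of \<open>a\<close>. Separation below rests on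
    this.\<close>
  have unit: "?H (lact A q a) e \<longleftrightarrow> q \<sqsubseteq>\<^bsub>?Q\<^esub> ev a e"
    if "q \<in> carrier ?Q" "a \<in> carrier A" "e \<in> carrier E" for q a e
    using that ec B(8) by (simp add: act U)
  have supA: "?H (\<Squnion>\<^bsub>A\<^esub> X) e \<longleftrightarrow> (\<forall>x \<in> X. ?H x e)" if "X \<subseteq> carrier A" "e \<in> carrier E" for X e
    using sup_map_lub_le_iff[OF balancedD(3)[OF B(7) that(2)] that(1), of "qunit ?Q"] U(3) by simp
  have supE: "?H a (\<Squnion>\<^bsub>E\<^esub> X) \<longleftrightarrow> (\<forall>x \<in> X. ?H a x)" if "a \<in> carrier A" "X \<subseteq> carrier E" for X a
    using sup_map_lub_le_iff[OF balancedD(2)[OF B(7) that(1)] that(2), of "qunit ?Q"] U(3) by simp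
  have real: "\<exists>e \<in> carrier E. \<forall>a \<in> carrier A. ?H a e \<longleftrightarrow> a \<sqsubseteq>\<^bsub>A\<^esub> b" if b: "b \<in> carrier A" for b
  proof -
    \<comment> \<open>The functional with value 0 exactly on the elements below \<open>b\<close>,
      transposed into [Q, 2]: \<open>?f a\<close> is the largest scalar \<open>q\<close> for which q
      a lies below \<open>b\<close>.\<close>
    let ?f = "\<lambda>a. \<Squnion>\<^bsub>?Q\<^esub> {q \<in> carrier ?Q. lact A q a \<sqsubseteq>\<^bsub>A\<^esub> b}"
    have fc: "?f a \<in> carrier ?Q" for a by (rule Q.lub_closed) blast
    have f: "q \<sqsubseteq>\<^bsub>?Q\<^esub> ?f a \<longleftrightarrow> lact A q a \<sqsubseteq>\<^bsub>A\<^esub> b" if "q \<in> carrier ?Q" "a \<in> carrier A" for q a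
      using le_lub_preimage_iff[OF sup_map_lact(2)[OF B(1) that(2)] that(1) b] .
    have "left_lin A ?D ?f"
      unfolding left_lin_def
    proof (intro conjI ballI)
      show "sup_map A ?D ?f"
      proof (rule sup_mapI[OF A.complete_lattice_axioms qmoduleD(4)[OF B(3)]])
        fix X y assume X: "X \<subseteq> carrier A" and y: "y \<in> carrier ?D"
        then show "?f (\<Squnion>\<^bsub>A\<^esub> X) \<sqsubseteq>\<^bsub>?D\<^esub> y \<longleftrightarrow> (\<forall>x \<in> X. ?f x \<sqsubseteq>\<^bsub>?D\<^esub> y)"
          using f[OF _ A.lub_closed[OF X]] f sup_map_lub_le_iff[OF sup_map_lact(1)[OF B(1)] X b]
          by (simp add: subset_iff)
      qed (simp add: fc)
      fix q a assume q: "q \<in> carrier ?Q" and a: "a \<in> carrier A"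
      show "?f (lact A q a) = lact ?D q (?f a)"
      proof (rule Q.eq_by_lower[OF fc])
        show "lact ?D q (?f a) \<in> carrier ?Q" using act(1)[OF q fc] .
        fix p assume p: "p \<in> carrier ?Q"
        show "p \<sqsubseteq>\<^bsub>?Q\<^esub> ?f (lact A q a) \<longleftrightarrow> p \<sqsubseteq>\<^bsub>?Q\<^esub> lact ?D q (?f a)"
          using f[OF p lact_closed[OF B(1) q a]] f[OF U(7)[OF p q] a] act(3)[OF q fc p]
            lact_qmult[OF B(1) p q a] by simp
      qed
    qed
    then obtain e where e: "e \<in> carrier E" "\<forall>a \<in> carrier A. ev a e = ?f a" using lhom_ex[OF E] by blast
    have "?H a e \<longleftrightarrow> a \<sqsubseteq>\<^bsub>A\<^esub> b" if "a \<in> carrier A" for a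
      using e(2) that f[OF U(3) that] lact_qunit[OF B(1) that] by simp
    then show ?thesis using e(1) by blast
  qed
  have sep: "e = e'" if e: "e \<in> carrier E" and e': "e' \<in> carrier E"
    and eq: "\<forall>a \<in> carrier A. ?H a e \<longleftrightarrow> ?H a e'" for e e'
  proof (rule lhom_eqI[OF E e e'])
    fix a assume a: "a \<in> carrier A"
    show "ev a e = ev a e'"
    proof (rule Q.eq_by_lower[OF ec[OF a e] ec[OF a e']])
      show "q \<sqsubseteq>\<^bsub>?Q\<^esub> ev a e \<longleftrightarrow> q \<sqsubseteq>\<^bsub>?Q\<^esub> ev a e'" if q: "q \<in> carrier ?Q" for q
        using unit[OF q a e] unit[OF q a e'] eq lact_closed[OF B(1) q a] by simp
    qed
  qed
  have r: "?H (ract A a r) e \<longleftrightarrow> ?H a (lact E r e)"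
    if "r \<in> carrier (rquant A)" "a \<in> carrier A" "e \<in> carrier E" for r a e
    using balancedD(5)[OF B(7) that(2,1,3)] by simp
  have q: "?H (lact A q a) e \<longleftrightarrow> ?H a (ract E e q)"
    if "q \<in> carrier ?Q" "a \<in> carrier A" "e \<in> carrier E" for q a e
  proof -
    have "ev a (ract E e q) = ract ?D (ev a e) q" using B(6) B(9)[of a e q] that by simp
    then show ?thesis using that ec B(8)[OF that] by (simp add: act U)
  qed
  show ?thesis
    unfolding perfect_def using B supA supE real sep r q by simp
qed

lemma bij_betw_ex1: "bij_betw f X Y \<Longrightarrow> y \<in> Y \<Longrightarrow> \<exists>!x. x \<in> X \<and> f x = y"
  unfolding bij_betw_def inj_on_def by blast

section \<open>The bicategory of unital quantales\<close>

context
  assumes strong_limit: "strong_limit_type TYPE('u)"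
begin

section \<open>Universal property of the chosen tensor products\<close>

lemma is_tensor_tensor:
  fixes A C :: "'u qmodule"
  assumes "is_qmodule A" "is_qmodule C" "rquant A = lquant C"
  shows "is_tensor A C (tensor A C) (tens A C)"
proof -
  have "\<exists>p. case_prod (is_tensor A C) p"
    using tensor_exists[OF strong_limit assms] by auto
  then have "case_prod (is_tensor A C) (SOME p. case_prod (is_tensor A C) p)" by (rule someI_ex)
  then show ?thesis by (simp add: tensor_def tens_def case_prod_unfold)
qed

lemma tensorD:
  fixes A C :: "'u qmodule"
  assumes "is_qmodule A" "is_qmodule C" "rquant A = lquant C"
  shows "is_qmodule (tensor A C)" "lquant (tensor A C) = lquant A" "rquant (tensor A C) = rquant C"
    and "sup_tensor A C (tensor A C) (tens A C)"
    and "bilin A C (tensor A C) (tens A C)"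
  using is_tensor_tensor[OF assms] assms
  by (auto simp: is_tensor_def sup_tensor_def bilin_def qmoduleD(3))

lemma tens_closed:
  fixes A C :: "'u qmodule"
  assumes "is_qmodule A" "is_qmodule C" "rquant A = lquant C" "a \<in> carrier A" "c \<in> carrier C"
  shows "tens A C a c \<in> carrier (tensor A C)"
  using bilin_closed[OF tensorD(5)] assms by blast

lemma tens_lact:
  fixes A C :: "'u qmodule"
  assumes "is_qmodule A" "is_qmodule C" "rquant A = lquant C" "a \<in> carrier A" "c \<in> carrier C"
    "q \<in> carrier (lquant A)"
  shows "lact (tensor A C) q (tens A C a c) = tens A C (lact A q a) c"
  using bilinD(8)[OF tensorD(5)] assms by simp

lemma tens_ract:
  fixes A C :: "'u qmodule"
  assumes "is_qmodule A" "is_qmodule C" "rquant A = lquant C" "a \<in> carrier A" "c \<in> carrier C"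
    "s \<in> carrier (rquant C)"
  shows "ract (tensor A C) (tens A C a c) s = tens A C a (ract C c s)"
  using bilinD(9)[OF tensorD(5)] assms by simp

lemma tens_balanced:
  fixes A C :: "'u qmodule"
  assumes "is_qmodule A" "is_qmodule C" "rquant A = lquant C" "a \<in> carrier A" "c \<in> carrier C"
    "r \<in> carrier (lquant C)"
  shows "tens A C (ract A a r) c = tens A C a (lact C r c)"
  using balancedD(5)[OF bilinD(7)[OF tensorD(5)]] assms by simp

lemma sup_map_tens:
  fixes A C :: "'u qmodule"
  assumes "is_qmodule A" "is_qmodule C" "rquant A = lquant C"
  shows "a \<in> carrier A \<Longrightarrow> sup_map C (tensor A C) (tens A C a)"
    and "c \<in> carrier C \<Longrightarrow> sup_map A (tensor A C) (\<lambda>a. tens A C a c)"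
  using balancedD(2,3)[OF bilinD(7)[OF tensorD(5)[OF assms]]] by auto

lemma tensor_ext:
  fixes A C :: "'u qmodule" and M :: "('u, 'x) gorder_scheme"
  assumes "is_qmodule A" "is_qmodule C" "rquant A = lquant C" "suplattice M"
    and "sup_map (tensor A C) M g" "sup_map (tensor A C) M h"
    and "\<And>a c. a \<in> carrier A \<Longrightarrow> c \<in> carrier C \<Longrightarrow> g (tens A C a c) = h (tens A C a c)"
    and "u \<in> carrier (tensor A C)"
  shows "g u = h u"
  by (rule sup_tensor_ext[OF tensorD(4)]) fact+

text \<open>Extensionality applied twice: first on the outer tensor, then, for fixed
  \<open>d\<close>, on the inner one, since forming the outer pure tensor with \<open>d\<close>
  preserves suprema.\<close>

lemma tensor_ext3:
  fixes A C D :: "'u qmodule" and M :: "('u, 'x) gorder_scheme"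
  assumes A: "is_qmodule A" and C: "is_qmodule C" and D: "is_qmodule D"
    and AC: "rquant A = lquant C" and CD: "rquant C = lquant D" and M: "suplattice M"
    and g: "sup_map (tensor (tensor A C) D) M g" and h: "sup_map (tensor (tensor A C) D) M h"
    and eq: "\<And>a c d. a \<in> carrier A \<Longrightarrow> c \<in> carrier C \<Longrightarrow> d \<in> carrier D
      \<Longrightarrow> g (tens (tensor A C) D (tens A C a c) d) = h (tens (tensor A C) D (tens A C a c) d)"
    and u: "u \<in> carrier (tensor (tensor A C) D)"
  shows "g u = h u"
proof (rule tensor_ext[OF tensorD(1)[OF A C AC] D _ M g h _ u])
  show comp: "rquant (tensor A C) = lquant D" using tensorD(3)[OF A C AC] CD by simp
  fix v d assume v: "v \<in> carrier (tensor A C)" and d: "d \<in> carrier D"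
  note td = sup_map_tens(2)[OF tensorD(1)[OF A C AC] D comp d]
  show "g (tens (tensor A C) D v d) = h (tens (tensor A C) D v d)"
    by (rule tensor_ext[OF A C AC M sup_map_comp[OF td g] sup_map_comp[OF td h] eq v]) (use d in simp_all)
qed

lemma tensor_ext3':
  fixes A C D :: "'u qmodule" and M :: "('u, 'x) gorder_scheme"
  assumes A: "is_qmodule A" and C: "is_qmodule C" and D: "is_qmodule D"
    and AC: "rquant A = lquant C" and CD: "rquant C = lquant D" and M: "suplattice M"
    and g: "sup_map (tensor A (tensor C D)) M g" and h: "sup_map (tensor A (tensor C D)) M h"
    and eq: "\<And>a c d. a \<in> carrier A \<Longrightarrow> c \<in> carrier C \<Longrightarrow> d \<in> carrier D
      \<Longrightarrow> g (tens A (tensor C D) a (tens C D c d)) = h (tens A (tensor C D) a (tens C D c d))"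
    and u: "u \<in> carrier (tensor A (tensor C D))"
  shows "g u = h u"
proof (rule tensor_ext[OF A tensorD(1)[OF C D CD] _ M g h _ u])
  show comp: "rquant A = lquant (tensor C D)" using tensorD(2)[OF C D CD] AC by simp
  fix a v assume v: "v \<in> carrier (tensor C D)" and a: "a \<in> carrier A"
  note ta = sup_map_tens(1)[OF A tensorD(1)[OF C D CD] comp a]
  show "g (tens A (tensor C D) a v) = h (tens A (tensor C D) a v)"
    by (rule tensor_ext[OF C D CD M sup_map_comp[OF ta g] sup_map_comp[OF ta h] eq v]) (use a in simp_all)
qed

lemma tensor_ext4:
  fixes A C D E :: "'u qmodule" and M :: "('u, 'x) gorder_scheme"
  assumes A: "is_qmodule A" and C: "is_qmodule C" and D: "is_qmodule D" and E: "is_qmodule E"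
    and AC: "rquant A = lquant C" and CD: "rquant C = lquant D" and DE: "rquant D = lquant E"
    and M: "suplattice M"
    and g: "sup_map (tensor (tensor (tensor A C) D) E) M g"
    and h: "sup_map (tensor (tensor (tensor A C) D) E) M h"
    and eq: "\<And>a c d e. a \<in> carrier A \<Longrightarrow> c \<in> carrier C \<Longrightarrow> d \<in> carrier D \<Longrightarrow> e \<in> carrier E
      \<Longrightarrow> g (tens (tensor (tensor A C) D) E (tens (tensor A C) D (tens A C a c) d) e)
        = h (tens (tensor (tensor A C) D) E (tens (tensor A C) D (tens A C a c) d) e)"
    and u: "u \<in> carrier (tensor (tensor (tensor A C) D) E)"
  shows "g u = h u"
proof (rule tensor_ext3[OF tensorD(1)[OF A C AC] D E _ DE M g h _ u])
  show comp: "rquant (tensor A C) = lquant D" using tensorD(3)[OF A C AC] CD by simp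
  fix v d e assume v: "v \<in> carrier (tensor A C)" and d: "d \<in> carrier D" and e: "e \<in> carrier E"
  note ACD = tensorD[OF tensorD(1)[OF A C AC] D comp]
  have comp': "rquant (tensor (tensor A C) D) = lquant E" using ACD(3) DE by simp
  note t = sup_map_comp[OF sup_map_tens(2)[OF tensorD(1)[OF A C AC] D comp d]
      sup_map_tens(2)[OF ACD(1) E comp' e]]
  show "g (tens (tensor (tensor A C) D) E (tens (tensor A C) D v d) e)
      = h (tens (tensor (tensor A C) D) E (tens (tensor A C) D v d) e)"
    by (rule tensor_ext[OF A C AC M sup_map_comp[OF t g] sup_map_comp[OF t h] eq v])
      (use d e in simp_all)
qed

text \<open>The universal property supplies only a sup-preserving map; compatibility with the outer
  actions follows by comparing on pure tensors.\<close>

lemma tensor_lift: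
  fixes A C M :: "'u qmodule"
  assumes f: "bilin A C M f"
  obtains h where "lin (tensor A C) M h"
    "\<And>a c. a \<in> carrier A \<Longrightarrow> c \<in> carrier C \<Longrightarrow> h (tens A C a c) = f a c"
proof -
  note B = bilinD[OF f]
  note T = tensorD[OF B(1,2,4)] and M = qmoduleD(3)[OF B(3)]
  obtain h where h: "sup_map (tensor A C) M h"
    and ht: "\<And>a c. a \<in> carrier A \<Longrightarrow> c \<in> carrier C \<Longrightarrow> h (tens A C a c) = f a c"
    by (rule sup_tensor_lift[OF T(4) M B(7)]) blast
  have "h (lact (tensor A C) q u) = lact M q (h u)"
    if q: "q \<in> carrier (lquant A)" and u: "u \<in> carrier (tensor A C)" for q u
    by (rule tensor_ext[OF B(1,2,4) M sup_map_comp[OF sup_map_lact(1)[OF T(1)] h]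
          sup_map_comp[OF h sup_map_lact(1)[OF B(3)]] _ u])
      (use q in \<open>simp_all add: T B tens_lact lact_closed ht\<close>)
  moreover have "h (ract (tensor A C) u s) = ract M (h u) s"
    if s: "s \<in> carrier (rquant C)" and u: "u \<in> carrier (tensor A C)" for s u
    by (rule tensor_ext[OF B(1,2,4) M sup_map_comp[OF sup_map_ract(1)[OF T(1)] h]
          sup_map_comp[OF h sup_map_ract(1)[OF B(3)]] _ u])
      (use s in \<open>simp_all add: T B tens_ract ract_closed ht\<close>)
  ultimately have "lin (tensor A C) M h" using h B T by (simp add: lin_def)
  then show ?thesis using ht by (rule that)
qed

text \<open>Besides giving 2-cells out of a tensor product, this justifies the definite descriptions
  of \<open>tensor_hom\<close>, \<open>tensor_lunit\<close> and \<open>tensor_runit\<close>.\<close>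

lemma ex1_tensor_hom:
  fixes A C M :: "'u qmodule"
  assumes f: "bilin A C M f"
  shows "\<exists>!h. h \<in> qmodule_homs (tensor A C) M \<and>
    (\<forall>a \<in> carrier A. \<forall>c \<in> carrier C. hmap h (tens A C a c) = f a c)"
proof (rule ex_ex1I)
  note B = bilinD[OF f]
  obtain h where "lin (tensor A C) M h"
    "\<And>a c. a \<in> carrier A \<Longrightarrow> c \<in> carrier C \<Longrightarrow> h (tens A C a c) = f a c"
    by (rule tensor_lift[OF f]) blast
  then show "\<exists>h. h \<in> qmodule_homs (tensor A C) M \<and>
      (\<forall>a \<in> carrier A. \<forall>c \<in> carrier C. hmap h (tens A C a c) = f a c)"
    using B by (intro exI[of _ "qhom_of (tensor A C) M h"]) (simp add: tens_closed)
  fix h k assume h: "h \<in> qmodule_homs (tensor A C) M \<and>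
      (\<forall>a \<in> carrier A. \<forall>c \<in> carrier C. hmap h (tens A C a c) = f a c)"
    and k: "k \<in> qmodule_homs (tensor A C) M \<and>
      (\<forall>a \<in> carrier A. \<forall>c \<in> carrier C. hmap k (tens A C a c) = f a c)"
  show "h = k"
  proof (rule qmodule_homs_eqI[OF conjunct1[OF h] conjunct1[OF k]])
    show "hmap h u = hmap k u" if u: "u \<in> carrier (tensor A C)" for u
      by (rule tensor_ext[OF B(1,2,4) qmoduleD(3)[OF B(3)]
            linD(5)[OF qmodule_homsD(1)[OF conjunct1[OF h]]]
            linD(5)[OF qmodule_homsD(1)[OF conjunct1[OF k]]] _ u]) (use h k in simp)
  qed
qed

text \<open>Lift in the first two variables with \<open>d\<close> as parameter; the resulting map of
  two variables is again bilinear and is lifted a second time.\<close>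

lemma trilin_lift:
  fixes A C D M :: "'u qmodule"
  assumes f: "trilin A C D M f"
  obtains h where "lin (tensor (tensor A C) D) M h"
    "\<And>a c d. a \<in> carrier A \<Longrightarrow> c \<in> carrier C \<Longrightarrow> d \<in> carrier D
      \<Longrightarrow> h (tens (tensor A C) D (tens A C a c) d) = f a c d"
proof -
  note B = trilinD[OF f]
  note T = tensorD[OF B(1,2,5)] and M = qmoduleD(3)[OF B(4)]
  obtain k where k: "sup_bimap (tensor A C) D M k"
    and kt: "\<And>a c d. a \<in> carrier A \<Longrightarrow> c \<in> carrier C \<Longrightarrow> d \<in> carrier D \<Longrightarrow> k (tens A C a c) d = f a c d"
    using sup_tensor_param_lift[OF T(4) M qmoduleD(4)[OF B(3)] B(9), of "\<lambda>d. d"]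
      balancedD(2)[OF B(10)] by metis
  note k2 = sup_bimapD(2)[OF k]
  note ext = tensor_ext[OF B(1,2,5) M]
  have r: "k (ract (tensor A C) u r) d = k u (lact D r d)"
    if "u \<in> carrier (tensor A C)" "r \<in> carrier (lquant D)" "d \<in> carrier D" for u r d
    by (rule ext[OF sup_map_comp[OF sup_map_ract(1)[OF T(1)] k2] k2])
      (use that in \<open>simp_all add: T B tens_ract ract_closed lact_closed kt
        balancedD(5)[OF B(10)]\<close>)
  have q: "k (lact (tensor A C) q u) d = lact M q (k u d)"
    if "u \<in> carrier (tensor A C)" "q \<in> carrier (lquant A)" "d \<in> carrier D" for u q d
    by (rule ext[OF sup_map_comp[OF sup_map_lact(1)[OF T(1)] k2]
          sup_map_comp[OF k2 sup_map_lact(1)[OF B(4)]]])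
      (use that in \<open>simp_all add: T B tens_lact lact_closed kt\<close>)
  have s: "k u (ract D d s) = ract M (k u d) s"
    if "u \<in> carrier (tensor A C)" "s \<in> carrier (rquant D)" "d \<in> carrier D" for u s d
    by (rule ext[OF k2 sup_map_comp[OF k2 sup_map_ract(1)[OF B(4)]]])
      (use that in \<open>simp_all add: T B ract_closed kt\<close>)
  have "bilin (tensor A C) D M k"
    using k r q s by (simp add: bilin_def balanced_def T B)
  then obtain h where h: "lin (tensor (tensor A C) D) M h"
    and ht: "\<And>u d. u \<in> carrier (tensor A C) \<Longrightarrow> d \<in> carrier D \<Longrightarrow> h (tens (tensor A C) D u d) = k u d"
    by (rule tensor_lift) blast
  show ?thesis using ht[OF tens_closed[OF B(1,2,5)]] kt by (intro that[OF h]) simp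
qed

text \<open>The other bracketing: now \<open>a\<close> is the parameter, which
  \<open>sup_tensor_param_lift\<close> places last, so the arguments are exchanged before the second
  lift.\<close>

lemma trilin_lift':
  fixes A C D M :: "'u qmodule"
  assumes f: "trilin A C D M f"
  obtains h where "lin (tensor A (tensor C D)) M h"
    "\<And>a c d. a \<in> carrier A \<Longrightarrow> c \<in> carrier C \<Longrightarrow> d \<in> carrier D
      \<Longrightarrow> h (tens A (tensor C D) a (tens C D c d)) = f a c d"
proof -
  note B = trilinD[OF f]
  note T = tensorD[OF B(2,3,6)] and M = qmoduleD(3)[OF B(4)]
  obtain k where k: "sup_bimap (tensor C D) A M k"
    and kt: "\<And>c d a. c \<in> carrier C \<Longrightarrow> d \<in> carrier D \<Longrightarrow> a \<in> carrier A \<Longrightarrow> k (tens C D c d) a = f a c d"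
    using sup_tensor_param_lift[OF T(4) M qmoduleD(4)[OF B(1)], of "\<lambda>c d a. f a c d"] B(10)
      balancedD(3)[OF B(9)] by metis
  note k2 = sup_bimapD(2)[OF k]
  note ext = tensor_ext[OF B(2,3,6) M]
  have r: "k u (ract A a r) = k (lact (tensor C D) r u) a"
    if "u \<in> carrier (tensor C D)" "r \<in> carrier (lquant C)" "a \<in> carrier A" for u r a
    by (rule ext[OF k2 sup_map_comp[OF sup_map_lact(1)[OF T(1)] k2]])
      (use that in \<open>simp_all add: T B tens_lact ract_closed lact_closed kt
        balancedD(5)[OF B(9)]\<close>)
  have s: "k (ract (tensor C D) u s) a = ract M (k u a) s"
    if "u \<in> carrier (tensor C D)" "s \<in> carrier (rquant D)" "a \<in> carrier A" for u s a
    by (rule ext[OF sup_map_comp[OF sup_map_ract(1)[OF T(1)] k2]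
          sup_map_comp[OF k2 sup_map_ract(1)[OF B(4)]]])
      (use that in \<open>simp_all add: T B tens_ract ract_closed kt\<close>)
  have q: "k u (lact A q a) = lact M q (k u a)"
    if "u \<in> carrier (tensor C D)" "q \<in> carrier (lquant A)" "a \<in> carrier A" for u q a
    by (rule ext[OF k2 sup_map_comp[OF k2 sup_map_lact(1)[OF B(4)]]])
      (use that in \<open>simp_all add: T B lact_closed kt\<close>)
  have "bilin A (tensor C D) M (\<lambda>a u. k u a)"
    using k r q s by (simp add: bilin_def balanced_def sup_bimap_def T B)
  then obtain h where h: "lin (tensor A (tensor C D)) M h"
    and ht: "\<And>a u. a \<in> carrier A \<Longrightarrow> u \<in> carrier (tensor C D) \<Longrightarrow> h (tens A (tensor C D) a u) = k u a"
    by (rule tensor_lift) blast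
  show ?thesis using ht[OF _ tens_closed[OF B(2,3,6)]] kt by (intro that[OF h]) simp
qed

text \<open>Lifting each of these maps along the opposite bracketing gives the associator and its
  inverse.\<close>

lemma trilin_tens_tens:
  fixes A C D :: "'u qmodule"
  assumes A: "is_qmodule A" and C: "is_qmodule C" and D: "is_qmodule D"
    and AC: "rquant A = lquant C" and CD: "rquant C = lquant D"
  shows "trilin A C D (tensor A (tensor C D)) (\<lambda>a c d. tens A (tensor C D) a (tens C D c d))"
    and "trilin A C D (tensor (tensor A C) D) (\<lambda>a c d. tens (tensor A C) D (tens A C a c) d)"
proof -
  note T = tensorD[OF A C AC] and T' = tensorD[OF C D CD]
  have c: "rquant (tensor A C) = lquant D" "rquant A = lquant (tensor C D)"
    using T(3) T'(2) AC CD by simp_all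
  note S = tensorD[OF T(1) D c(1)] and S' = tensorD[OF A T'(1) c(2)]
  show "trilin A C D (tensor A (tensor C D)) (\<lambda>a c d. tens A (tensor C D) a (tens C D c d))"
    unfolding trilin_def
  proof (intro conjI ballI)
    show "balanced A C (tensor A (tensor C D)) (\<lambda>a c. tens A (tensor C D) a (tens C D c d))"
      if d: "d \<in> carrier D" for d
      by (intro balancedI sup_map_comp[OF sup_map_tens(2) sup_map_tens(1)] sup_map_tens(2))
        (use A C D CD AC T' c d in \<open>simp_all add: tens_closed tens_balanced tens_lact\<close>)
    show "balanced C D (tensor A (tensor C D)) (\<lambda>c d. tens A (tensor C D) a (tens C D c d))"
      if a: "a \<in> carrier A" for a
      using balanced_comp[OF bilinD(7)[OF T'(5)] sup_map_tens(1)[OF A T'(1) c(2) a]] .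
  qed (use A C D T' S' AC CD c in \<open>simp_all add: tens_closed tens_lact tens_ract\<close>)
  show "trilin A C D (tensor (tensor A C) D) (\<lambda>a c d. tens (tensor A C) D (tens A C a c) d)"
    unfolding trilin_def
  proof (intro conjI ballI)
    show "balanced A C (tensor (tensor A C) D) (\<lambda>a c. tens (tensor A C) D (tens A C a c) d)"
      if d: "d \<in> carrier D" for d
      using balanced_comp[OF bilinD(7)[OF T(5)] sup_map_tens(2)[OF T(1) D c(1) d]] .
    show "balanced C D (tensor (tensor A C) D) (\<lambda>c d. tens (tensor A C) D (tens A C a c) d)"
      if a: "a \<in> carrier A" for a
      by (intro balancedI sup_map_comp[OF sup_map_tens(1) sup_map_tens(2)] sup_map_tens(1))
        (use A C D CD AC T c a in \<open>simp_all add: tens_closed tens_ract flip: tens_balanced\<close>)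
  qed (use A C D T S AC CD c in \<open>simp_all add: tens_closed tens_lact tens_ract\<close>)
qed

lemma tensor_homs_eqI:
  fixes A C M :: "'u qmodule"
  assumes "is_qmodule A" "is_qmodule C" "rquant A = lquant C"
    and f: "f \<in> qmodule_homs (tensor A C) M" and g: "g \<in> qmodule_homs (tensor A C) M"
    and eq: "\<And>a c. a \<in> carrier A \<Longrightarrow> c \<in> carrier C \<Longrightarrow> hmap f (tens A C a c) = hmap g (tens A C a c)"
  shows "f = g"
  by (rule qmodule_homs_eqI[OF f g], rule tensor_ext[OF assms(1-3) qmoduleD(3)])
    (use f g eq in \<open>auto dest: qmodule_homsD'\<close>)

lemma tensor_homs_eqI3:
  fixes A C D M :: "'u qmodule"
  assumes "is_qmodule A" "is_qmodule C" "is_qmodule D" "rquant A = lquant C" "rquant C = lquant D"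
    and f: "f \<in> qmodule_homs (tensor (tensor A C) D) M"
    and g: "g \<in> qmodule_homs (tensor (tensor A C) D) M"
    and eq: "\<And>a c d. a \<in> carrier A \<Longrightarrow> c \<in> carrier C \<Longrightarrow> d \<in> carrier D \<Longrightarrow>
      hmap f (tens (tensor A C) D (tens A C a c) d) = hmap g (tens (tensor A C) D (tens A C a c) d)"
  shows "f = g"
  by (rule qmodule_homs_eqI[OF f g], rule tensor_ext3[OF assms(1-5) qmoduleD(3)])
    (use f g eq in \<open>auto dest: qmodule_homsD'\<close>)

lemma tensor_homs_eqI4:
  fixes A C D E M :: "'u qmodule"
  assumes "is_qmodule A" "is_qmodule C" "is_qmodule D" "is_qmodule E"
    and "rquant A = lquant C" "rquant C = lquant D" "rquant D = lquant E"
    and f: "f \<in> qmodule_homs (tensor (tensor (tensor A C) D) E) M"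
    and g: "g \<in> qmodule_homs (tensor (tensor (tensor A C) D) E) M"
    and eq: "\<And>a c d e. a \<in> carrier A \<Longrightarrow> c \<in> carrier C \<Longrightarrow> d \<in> carrier D \<Longrightarrow> e \<in> carrier E \<Longrightarrow>
      hmap f (tens (tensor (tensor A C) D) E (tens (tensor A C) D (tens A C a c) d) e) =
      hmap g (tens (tensor (tensor A C) D) E (tens (tensor A C) D (tens A C a c) d) e)"
  shows "f = g"
  by (rule qmodule_homs_eqI[OF f g], rule tensor_ext4[OF assms(1-7) qmoduleD(3)])
    (use f g eq in \<open>auto dest: qmodule_homsD'\<close>)

section \<open>Tensor of homomorphisms, unitors and associator\<close>

lemma tensor_hom:
  fixes A A' C C' :: "'u qmodule"
  assumes f: "f \<in> qmodule_homs A A'" and g: "g \<in> qmodule_homs C C'" and AC: "rquant A = lquant C"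
  shows "tensor_hom f g \<in> qmodule_homs (tensor A C) (tensor A' C')"
    and "a \<in> carrier A \<Longrightarrow> c \<in> carrier C
      \<Longrightarrow> hmap (tensor_hom f g) (tens A C a c) = tens A' C' (hmap f a) (hmap g c)"
proof -
  have AC': "rquant A' = lquant C'" using AC qmodule_homsD'[OF f] qmodule_homsD'[OF g] by simp
  have "bilin A' C' (tensor A' C') (tens A' C')"
    using AC' qmodule_homsD'[OF f] qmodule_homsD'[OF g] by (intro tensorD) simp_all
  from ex1_tensor_hom[OF bilin_precomp[OF this qmodule_homsD(1)[OF f] qmodule_homsD(1)[OF g]]]
  have "tensor_hom f g \<in> qmodule_homs (tensor A C) (tensor A' C') \<and> (\<forall>a \<in> carrier A. \<forall>c \<in> carrier C.
      hmap (tensor_hom f g) (tens A C a c) = tens A' C' (hmap f a) (hmap g c))"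
    unfolding tensor_hom_def qmodule_homsD(2)[OF f] qmodule_homsD(2)[OF g]
      qmodule_homsD(3)[OF f] qmodule_homsD(3)[OF g] by (rule theI')
  then show "tensor_hom f g \<in> qmodule_homs (tensor A C) (tensor A' C')"
    and "a \<in> carrier A \<Longrightarrow> c \<in> carrier C
      \<Longrightarrow> hmap (tensor_hom f g) (tens A C a c) = tens A' C' (hmap f a) (hmap g c)"
    by simp_all
qed

lemma tensor_lunit:
  fixes A :: "'u qmodule"
  assumes A: "is_qmodule A"
  shows "tensor_lunit A \<in> qmodule_homs (tensor (id_qmodule (lquant A)) A) A"
    and "q \<in> carrier (lquant A) \<Longrightarrow> a \<in> carrier A
      \<Longrightarrow> hmap (tensor_lunit A) (tens (id_qmodule (lquant A)) A q a) = lact A q a"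
proof -
  have "tensor_lunit A \<in> qmodule_homs (tensor (id_qmodule (lquant A)) A) A \<and>
      (\<forall>q \<in> carrier (lquant A). \<forall>a \<in> carrier A.
        hmap (tensor_lunit A) (tens (id_qmodule (lquant A)) A q a) = lact A q a)"
    using ex1_tensor_hom[OF bilin_lact[OF A]] unfolding tensor_lunit_def id_qmodule_simps
    by (rule theI')
  then show "tensor_lunit A \<in> qmodule_homs (tensor (id_qmodule (lquant A)) A) A"
    and "q \<in> carrier (lquant A) \<Longrightarrow> a \<in> carrier A
      \<Longrightarrow> hmap (tensor_lunit A) (tens (id_qmodule (lquant A)) A q a) = lact A q a"
    by simp_all
qed

lemma tensor_runit:
  fixes A :: "'u qmodule"
  assumes A: "is_qmodule A"
  shows "tensor_runit A \<in> qmodule_homs (tensor A (id_qmodule (rquant A))) A"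
    and "a \<in> carrier A \<Longrightarrow> r \<in> carrier (rquant A)
      \<Longrightarrow> hmap (tensor_runit A) (tens A (id_qmodule (rquant A)) a r) = ract A a r"
proof -
  have "tensor_runit A \<in> qmodule_homs (tensor A (id_qmodule (rquant A))) A \<and>
      (\<forall>a \<in> carrier A. \<forall>r \<in> carrier (rquant A).
        hmap (tensor_runit A) (tens A (id_qmodule (rquant A)) a r) = ract A a r)"
    using ex1_tensor_hom[OF bilin_ract[OF A]] unfolding tensor_runit_def id_qmodule_simps
    by (rule theI')
  then show "tensor_runit A \<in> qmodule_homs (tensor A (id_qmodule (rquant A))) A"
    and "a \<in> carrier A \<Longrightarrow> r \<in> carrier (rquant A)
      \<Longrightarrow> hmap (tensor_runit A) (tens A (id_qmodule (rquant A)) a r) = ract A a r"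
    by simp_all
qed

text \<open>The description of the associator prescribes values on threefold pure tensors only, so
  existence comes from \<open>trilin_lift\<close> and uniqueness from extensionality in three
  variables.\<close>

lemma tensor_assoc:
  fixes A C D :: "'u qmodule"
  assumes A: "is_qmodule A" and C: "is_qmodule C" and D: "is_qmodule D"
    and AC: "rquant A = lquant C" and CD: "rquant C = lquant D"
  shows "tensor_assoc A C D \<in> qmodule_homs (tensor (tensor A C) D) (tensor A (tensor C D))"
    and "a \<in> carrier A \<Longrightarrow> c \<in> carrier C \<Longrightarrow> d \<in> carrier D
      \<Longrightarrow> hmap (tensor_assoc A C D) (tens (tensor A C) D (tens A C a c) d)
        = tens A (tensor C D) a (tens C D c d)"
proof -
  let ?P = "\<lambda>h. h \<in> qmodule_homs (tensor (tensor A C) D) (tensor A (tensor C D)) \<and>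
      (\<forall>a \<in> carrier A. \<forall>c \<in> carrier C. \<forall>d \<in> carrier D.
        hmap h (tens (tensor A C) D (tens A C a c) d) = tens A (tensor C D) a (tens C D c d))"
  obtain h where h: "lin (tensor (tensor A C) D) (tensor A (tensor C D)) h"
    and ht: "\<And>a c d. a \<in> carrier A \<Longrightarrow> c \<in> carrier C \<Longrightarrow> d \<in> carrier D
      \<Longrightarrow> h (tens (tensor A C) D (tens A C a c) d) = tens A (tensor C D) a (tens C D c d)"
    by (rule trilin_lift[OF trilin_tens_tens(1)[OF assms]]) blast
  note T = tensorD[OF A C AC]
  have "tens (tensor A C) D (tens A C a c) d \<in> carrier (tensor (tensor A C) D)"
    if "a \<in> carrier A" "c \<in> carrier C" "d \<in> carrier D" for a c d
    using that A C D AC CD T by (intro tens_closed) simp_all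
  then have ex: "?P (qhom_of (tensor (tensor A C) D) (tensor A (tensor C D)) h)"
    using h ht by simp
  have "\<exists>!h. ?P h"
  proof (rule ex_ex1I)
    show "\<exists>h. ?P h" by (rule exI[where P = ?P, OF ex])
    show "f = g" if "?P f" "?P g" for f g
      by (rule tensor_homs_eqI3[OF assms conjunct1[OF that(1)] conjunct1[OF that(2)]])
        (simp add: that)
  qed
  then have "?P (tensor_assoc A C D)"
    unfolding tensor_assoc_def by (rule theI')
  then show "tensor_assoc A C D \<in> qmodule_homs (tensor (tensor A C) D) (tensor A (tensor C D))"
    and "a \<in> carrier A \<Longrightarrow> c \<in> carrier C \<Longrightarrow> d \<in> carrier D
      \<Longrightarrow> hmap (tensor_assoc A C D) (tens (tensor A C) D (tens A C a c) d)
        = tens A (tensor C D) a (tens C D c d)"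
    by simp_all
qed

lemma tensor_assoc_iso:
  fixes A C D :: "'u qmodule"
  assumes A: "is_qmodule A" and C: "is_qmodule C" and D: "is_qmodule D"
    and AC: "rquant A = lquant C" and CD: "rquant C = lquant D"
  shows "tensor_assoc A C D \<in> iso2 Quant (tensor (tensor A C) D) (tensor A (tensor C D))"
proof -
  note f = tensor_assoc[OF assms]
  note f' = qmodule_homsD'[OF f(1)]
  obtain g where g: "lin (tensor A (tensor C D)) (tensor (tensor A C) D) g"
    and gt: "\<And>a c d. a \<in> carrier A \<Longrightarrow> c \<in> carrier C \<Longrightarrow> d \<in> carrier D
      \<Longrightarrow> g (tens A (tensor C D) a (tens C D c d)) = tens (tensor A C) D (tens A C a c) d"
    by (rule trilin_lift'[OF trilin_tens_tens(2)[OF assms]]) blast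
  note g' = linD(5)[OF g]
  show ?thesis
  proof (rule iso2_QuantI[OF f(1) g])
    show "g (hmap (tensor_assoc A C D) u) = u" if u: "u \<in> carrier (tensor (tensor A C) D)" for u
      by (rule tensor_ext3[OF assms qmoduleD(3)[OF f'(1)] sup_map_comp[OF f'(5) g']
            sup_map_ident[OF qmoduleD(4)[OF f'(1)]] _ u]) (simp add: f(2) gt)
    show "hmap (tensor_assoc A C D) (g u) = u" if u: "u \<in> carrier (tensor A (tensor C D))" for u
      by (rule tensor_ext3'[OF assms qmoduleD(3)[OF f'(2)] sup_map_comp[OF g' f'(5)]
            sup_map_ident[OF qmoduleD(4)[OF f'(2)]] _ u]) (simp add: f(2) gt)
  qed
qed

text \<open>The inverse inserts the unit, a \<mapsto> 1 \<otimes> a. It undoes the left unitor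
  because balancedness gives 1 \<otimes> q a = q \<otimes> a, the fact called
  \<open>move\<close>.\<close>

lemma tensor_lunit_iso:
  fixes A :: "'u qmodule"
  assumes A: "is_qmodule A"
  shows "tensor_lunit A \<in> iso2 Quant (tensor (id_qmodule (lquant A)) A) A"
proof -
  let ?Q = "lquant A" let ?I = "id_qmodule ?Q"
  note Q = qmoduleD(1)[OF A]
  note f = tensor_lunit[OF A] and I = is_qmodule_id_qmodule[OF Q]
  have c: "rquant ?I = lquant A" by simp
  note T = tensorD[OF I A c] and f' = qmodule_homsD'[OF f(1)]
  let ?g = "tens ?I A (qunit ?Q)"
  have move: "?g (lact A q a) = tens ?I A q a" if "q \<in> carrier ?Q" "a \<in> carrier A" for q a
    using tens_balanced[OF I A c, of "qunit ?Q" a q] that Q by (simp add: unital_quantaleD)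
  have g: "lin A (tensor ?I A) ?g"
    unfolding lin_def
  proof (intro conjI ballI)
    show "sup_map A (tensor ?I A) ?g"
      using Q by (intro sup_map_tens(1)[OF I A c]) (simp add: unital_quantaleD)
    show "?g (lact A q a) = lact (tensor ?I A) q (?g a)" if "q \<in> carrier ?Q" "a \<in> carrier A" for q a
      using that move tens_lact[OF I A c, of "qunit ?Q" a q] Q by (simp add: unital_quantaleD)
    show "?g (ract A a r) = ract (tensor ?I A) (?g a) r"
      if "a \<in> carrier A" "r \<in> carrier (rquant A)" for a r
      using that tens_ract[OF I A c, of "qunit ?Q" a r] Q by (simp add: unital_quantaleD)
  qed (use A T in simp_all)
  show ?thesis
  proof (rule iso2_QuantI[OF f(1) g])
    show "?g (hmap (tensor_lunit A) u) = u" if u: "u \<in> carrier (tensor ?I A)" for u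
      by (rule tensor_ext[OF I A c qmoduleD(3)[OF T(1)] sup_map_comp[OF f'(5) linD(5)[OF g]]
            sup_map_ident[OF qmoduleD(4)[OF T(1)]] _ u]) (simp add: f(2) move)
    show "hmap (tensor_lunit A) (?g a) = a" if "a \<in> carrier A" for a
      using that f(2)[of "qunit ?Q" a] Q A by (simp add: unital_quantaleD lact_qunit)
  qed
qed

lemma tensor_runit_iso:
  fixes A :: "'u qmodule"
  assumes A: "is_qmodule A"
  shows "tensor_runit A \<in> iso2 Quant (tensor A (id_qmodule (rquant A))) A"
proof -
  let ?Q = "rquant A" let ?I = "id_qmodule ?Q"
  note Q = qmoduleD(2)[OF A]
  note f = tensor_runit[OF A] and I = is_qmodule_id_qmodule[OF Q]
  have c: "rquant A = lquant ?I" by simp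
  note T = tensorD[OF A I c] and f' = qmodule_homsD'[OF f(1)]
  let ?g = "\<lambda>a. tens A ?I a (qunit ?Q)"
  have move: "?g (ract A a q) = tens A ?I a q" if "q \<in> carrier ?Q" "a \<in> carrier A" for q a
    using tens_balanced[OF A I c, of a "qunit ?Q" q] that Q by (simp add: unital_quantaleD)
  have g: "lin A (tensor A ?I) ?g"
    unfolding lin_def
  proof (intro conjI ballI)
    show "sup_map A (tensor A ?I) ?g"
      using Q by (intro sup_map_tens(2)[OF A I c]) (simp add: unital_quantaleD)
    show "?g (ract A a r) = ract (tensor A ?I) (?g a) r" if "a \<in> carrier A" "r \<in> carrier ?Q" for a r
      using that move tens_ract[OF A I c, of a "qunit ?Q" r] Q by (simp add: unital_quantaleD)
    show "?g (lact A q a) = lact (tensor A ?I) q (?g a)"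
      if "q \<in> carrier (lquant A)" "a \<in> carrier A" for q a
      using that tens_lact[OF A I c, of a "qunit ?Q" q] Q by (simp add: unital_quantaleD)
  qed (use A T in simp_all)
  show ?thesis
  proof (rule iso2_QuantI[OF f(1) g])
    show "?g (hmap (tensor_runit A) u) = u" if u: "u \<in> carrier (tensor A ?I)" for u
      by (rule tensor_ext[OF A I c qmoduleD(3)[OF T(1)] sup_map_comp[OF f'(5) linD(5)[OF g]]
            sup_map_ident[OF qmoduleD(4)[OF T(1)]] _ u]) (simp add: f(2) move)
    show "hmap (tensor_runit A) (?g a) = a" if "a \<in> carrier A" for a
      using that f(2)[of a "qunit ?Q"] Q A by (simp add: unital_quantaleD ract_qunit)
  qed
qed

section \<open>The bicategory axioms\<close>

lemma bicategory_Quant: "bicategory (Quant :: ('u quantale, 'u qmodule, 'u qmodule_hom) bicat)"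
\<comment> \<open>Cases are numbered in the order of the assumptions of the locale
  \<open>bicategory\<close>. Equations of 2-cells out of tensor products are checked on pure tensors
  with as many factors as the domain has.\<close>
proof (unfold_locales, goal_cases)
  case (8 f A B g C)
  then show ?case by auto
next
  case (9 f A B g C h D)
  then have f: "f \<in> qmodule_homs A B" and g: "g \<in> qmodule_homs B C" and h: "h \<in> qmodule_homs C D"
    by simp_all
  note gf = vcomp_Quant_closed[OF f g] and hg = vcomp_Quant_closed[OF g h]
  show ?case
    by (rule qmodule_homs_eqI[OF vcomp_Quant_closed[OF f hg] vcomp_Quant_closed[OF gf h]])
      (simp add: hmap_vcomp_Quant[OF f] hmap_vcomp_Quant[OF gf] hmap_vcomp_Quant[OF g] hmap_closed[OF f])
next
  case (10 f A B)
  then have f: "f \<in> qmodule_homs A B" by simp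
  note i = vid_Quant_closed[OF qmodule_homsD'(1)[OF f]]
  show ?case
    unfolding Quant_simps
    by (rule qmodule_homs_eqI[OF vcomp_Quant_closed[OF i f] f]) (simp add: hmap_vcomp_Quant[OF i])
next
  case (11 f A B)
  then have f: "f \<in> qmodule_homs A B" by simp
  note i = vid_Quant_closed[OF qmodule_homsD'(2)[OF f]]
  show ?case
    unfolding Quant_simps
    by (rule qmodule_homs_eqI[OF vcomp_Quant_closed[OF f i] f])
      (simp add: hmap_vcomp_Quant[OF f] hmap_closed[OF f])
next
  case (13 A X Y C Z)
  then show ?case by (simp add: tensorD)
next
  case (14 f A A' g C C')
  then show ?case by (simp add: tensor_hom)
next
  case (15 A X Y C Z)
  then have A: "is_qmodule A" and C: "is_qmodule C" and AC: "rquant A = lquant C" by simp_all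
  note i = vid_Quant_closed[OF A] and j = vid_Quant_closed[OF C]
    and k = vid_Quant_closed[OF tensorD(1)[OF A C AC]]
  show ?case
    unfolding Quant_simps
    by (rule tensor_homs_eqI[OF A C AC tensor_hom(1)[OF i j AC] k])
      (simp add: tensor_hom(2)[OF i j AC] tens_closed[OF A C AC])
next
  \<comment> \<open>Interchange: both sides apply the two composites factorwise to a pure
    tensor.\<close>
  case (16 f A A' f' A'' g C C' g' C'')
  then have f: "f \<in> qmodule_homs A A'" and f': "f' \<in> qmodule_homs A' A''"
    and g: "g \<in> qmodule_homs C C'" and g': "g' \<in> qmodule_homs C' C''" and AC: "rquant A = lquant C"
    by simp_all
  note A = qmodule_homsD'[OF f] and C = qmodule_homsD'[OF g]
  have AC': "rquant A' = lquant C'" using AC A C by simp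
  note m = vcomp_Quant_closed[OF f f'] and n = vcomp_Quant_closed[OF g g']
  show ?case
    unfolding Quant_simps
    by (rule tensor_homs_eqI[OF A(1) C(1) AC tensor_hom(1)[OF m n AC]
          vcomp_Quant_closed[OF tensor_hom(1)[OF f g AC] tensor_hom(1)[OF f' g' AC']]])
      (simp add: tensor_hom(2)[OF m n AC] hmap_vcomp_Quant[OF f] hmap_vcomp_Quant[OF g]
        hmap_vcomp_Quant[OF tensor_hom(1)[OF f g AC]] tens_closed[OF A(1) C(1) AC]
        tensor_hom(2)[OF f g AC] tensor_hom(2)[OF f' g' AC'] hmap_closed[OF f] hmap_closed[OF g])
next
  case (17 A W X C Y D Z)
  then show ?case by (simp add: tensor_assoc_iso)
next
  \<comment> \<open>Naturality of the associator: both routes end in the rebracketed pure tensor of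
    the three images.\<close>
  case (18 f A A' g C C' h D D')
  then have f: "f \<in> qmodule_homs A A'" and g: "g \<in> qmodule_homs C C'" and h: "h \<in> qmodule_homs D D'"
    and AC: "rquant A = lquant C" and CD: "rquant C = lquant D" by simp_all
  note A = qmodule_homsD'[OF f] and C = qmodule_homsD'[OF g] and D = qmodule_homsD'[OF h]
  have AC': "rquant A' = lquant C'" and CD': "rquant C' = lquant D'" using AC CD A C D by simp_all
  note fg = tensor_hom[OF f g AC] and gh = tensor_hom[OF g h CD]
  note T = tensorD[OF A(1) C(1) AC] and T' = tensorD[OF C(1) D(1) CD]
  have ACD: "rquant (tensor A C) = lquant D" "rquant A = lquant (tensor C D)"
    using T(3) T'(2) AC CD by simp_all
  note fgh = tensor_hom[OF fg(1) h ACD(1)] and fgh' = tensor_hom[OF f gh(1) ACD(2)]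
  note a = tensor_assoc[OF A(1) C(1) D(1) AC CD] and a' = tensor_assoc[OF A(2) C(2) D(2) AC' CD']
  show ?case
    unfolding Quant_simps
    by (rule tensor_homs_eqI3[OF A(1) C(1) D(1) AC CD vcomp_Quant_closed[OF fgh(1) a'(1)]
          vcomp_Quant_closed[OF a(1) fgh'(1)]])
      (simp add: hmap_vcomp_Quant[OF fgh(1)] hmap_vcomp_Quant[OF a(1)] tens_closed[OF A(1) C(1) AC]
        tens_closed[OF T(1) D(1) ACD(1)] tens_closed[OF C(1) D(1) CD]
        fg(2) gh(2) fgh(2) fgh'(2) a(2) a'(2) hmap_closed[OF f] hmap_closed[OF g] hmap_closed[OF h])
next
  case (19 A X Y)
  then show ?case using tensor_lunit_iso by auto
next
  \<comment> \<open>On pure tensors, naturality of the left unitor is left linearity of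
    \<open>f\<close>.\<close>
  case (20 f A A' X Y)
  then have f: "f \<in> qmodule_homs A A'" and X: "X = lquant A" by simp_all
  note A = qmodule_homsD'[OF f]
  note I = is_qmodule_id_qmodule[OF qmoduleD(1)[OF A(1)]] and l = tensor_lunit[OF A(1)]
    and l' = tensor_lunit[OF A(2), unfolded A(3)]
  have c: "rquant (id_qmodule (lquant A)) = lquant A" by simp
  note i = tensor_hom[OF vid_Quant_closed[OF I] f c]
  show ?case
    unfolding Quant_simps X
    by (rule tensor_homs_eqI[OF I A(1) c vcomp_Quant_closed[OF i(1) l'(1)]
          vcomp_Quant_closed[OF l(1) f]])
      (simp add: hmap_vcomp_Quant[OF i(1)] hmap_vcomp_Quant[OF l(1)] tens_closed[OF I A(1) c]
        i(2) l(2) l'(2) hmap_closed[OF f] linD(7)[OF qmodule_homsD(1)[OF f]])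
next
  case (21 A X Y)
  then show ?case using tensor_runit_iso by auto
next
  case (22 f A A' X Y)
  then have f: "f \<in> qmodule_homs A A'" and Y: "Y = rquant A" by simp_all
  note A = qmodule_homsD'[OF f]
  note I = is_qmodule_id_qmodule[OF qmoduleD(2)[OF A(1)]] and r = tensor_runit[OF A(1)]
    and r' = tensor_runit[OF A(2), unfolded A(4)]
  have c: "rquant A = lquant (id_qmodule (rquant A))" by simp
  note i = tensor_hom[OF f vid_Quant_closed[OF I] c]
  show ?case
    unfolding Quant_simps Y
    by (rule tensor_homs_eqI[OF A(1) I c vcomp_Quant_closed[OF i(1) r'(1)]
          vcomp_Quant_closed[OF r(1) f]])
      (simp add: hmap_vcomp_Quant[OF i(1)] hmap_vcomp_Quant[OF r(1)] tens_closed[OF A(1) I c]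
        i(2) r(2) r'(2) hmap_closed[OF f] linD(8)[OF qmodule_homsD(1)[OF f]])
next
  \<comment> \<open>Pentagon: both composites send the fourfold pure tensor bracketed to the left to
    the one bracketed to the right.\<close>
  case (23 A V W C X D Y E Z)
  then have A: "is_qmodule A" and C: "is_qmodule C" and D: "is_qmodule D" and E: "is_qmodule E"
    and AC: "rquant A = lquant C" and CD: "rquant C = lquant D" and DE: "rquant D = lquant E"
    by simp_all
  note T1 = tensorD(1-3)[OF A C AC] and T2 = tensorD(1-3)[OF C D CD] and T3 = tensorD(1-3)[OF D E DE]
  have c1: "rquant (tensor A C) = lquant D" and c2: "rquant A = lquant (tensor C D)"
    and c3: "rquant (tensor C D) = lquant E" and c4: "rquant C = lquant (tensor D E)"
    and c5: "rquant (tensor A C) = lquant (tensor D E)"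
    using T1 T2 T3 AC CD DE by simp_all
  note S1 = tensorD(1-3)[OF T1(1) D c1] and S2 = tensorD(1-3)[OF A T2(1) c2]
    and S3 = tensorD(1-3)[OF T2(1) E c3] and S4 = tensorD(1-3)[OF C T3(1) c4]
  have d1: "rquant (tensor (tensor A C) D) = lquant E"
    and d2: "rquant (tensor A (tensor C D)) = lquant E"
    and d3: "rquant A = lquant (tensor (tensor C D) E)"
    using S1 S2 S3 S4 AC CD DE T1 T2 T3 by simp_all
  note a1 = tensor_assoc[OF T1(1) D E c1 DE] and a2 = tensor_assoc[OF A C T3(1) AC c4]
    and a3 = tensor_assoc[OF A C D AC CD] and a4 = tensor_assoc[OF A T2(1) E c2 c3]
    and a5 = tensor_assoc[OF C D E CD DE]
  note h1 = tensor_hom[OF a3(1) vid_Quant_closed[OF E] d1]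
    and h2 = tensor_hom[OF vid_Quant_closed[OF A] a5(1) d3]
  note cl = tens_closed[OF A C AC] tens_closed[OF C D CD] tens_closed[OF D E DE]
    tens_closed[OF T1(1) D c1] tens_closed[OF A T2(1) c2] tens_closed[OF T2(1) E c3]
    tens_closed[OF C T3(1) c4] tens_closed[OF T1(1) T3(1) c5] tens_closed[OF S1(1) E d1]
    tens_closed[OF S2(1) E d2] tens_closed[OF A S3(1) d3]
  note m1 = vcomp_Quant_closed[OF a1(1) a2(1)] and m2 = vcomp_Quant_closed[OF h1(1) a4(1)]
  show ?case
    unfolding Quant_simps
    by (rule tensor_homs_eqI4[OF A C D E AC CD DE m1 vcomp_Quant_closed[OF m2 h2(1)]])
      (simp add: hmap_vcomp_Quant[OF a1(1)] hmap_vcomp_Quant[OF m2] hmap_vcomp_Quant[OF h1(1)]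
        cl a1(2) a2(2) a3(2) a4(2) a5(2) h1(2) h2(2))
next
  \<comment> \<open>Triangle: on pure tensors this is exactly balancedness, a \<otimes> q c = a q
    \<otimes> c.\<close>
  case (24 A X Y C Z)
  then have A: "is_qmodule A" and C: "is_qmodule C" and AC: "rquant A = lquant C"
    and Y: "Y = rquant A" by simp_all
  let ?I = "id_qmodule (rquant A)"
  note Q = qmoduleD(2)[OF A]
  note I = is_qmodule_id_qmodule[OF Q] and r = tensor_runit[OF A]
    and l = tensor_lunit[OF C, folded AC]
  have c1: "rquant A = lquant ?I" and c2: "rquant ?I = lquant C" using AC by simp_all
  note T1 = tensorD(1-3)[OF A I c1] and T2 = tensorD(1-3)[OF I C c2]
  have d1: "rquant (tensor A ?I) = lquant C" and d2: "rquant A = lquant (tensor ?I C)"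
    using T1 T2 AC by simp_all
  note a = tensor_assoc[OF A I C c1 c2] and h = tensor_hom[OF vid_Quant_closed[OF A] l(1) d2]
    and k = tensor_hom[OF r(1) vid_Quant_closed[OF C] d1]
  show ?case
    unfolding Quant_simps Y
    by (rule tensor_homs_eqI3[OF A I C c1 c2 vcomp_Quant_closed[OF a(1) h(1)] k(1)])
      (simp add: hmap_vcomp_Quant[OF a(1)] a(2) h(2) k(2) r(2) l(2) tens_closed[OF A I c1]
        tens_closed[OF I C c2] tens_closed[OF T1(1) C d1] tens_balanced[OF A C AC] flip: AC)
qed (auto simp: qmoduleD is_qmodule_id_qmodule lin_ident is_qmodule_hom_iff_lin linD)

interpretation Quant: bicategory "Quant :: ('u quantale, 'u qmodule, 'u qmodule_hom) bicat"
  by (rule bicategory_Quant)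


section \<open>Right extensions and right liftings as currying\<close>

lemma whisker_left:
  fixes A D E C :: "'u qmodule"
  assumes A: "is_qmodule A" and AE: "rquant A = lquant E"
    and \<epsilon>: "\<epsilon> \<in> qmodule_homs (tensor A E) C" and \<phi>: "\<phi> \<in> qmodule_homs D E"
  shows "vcomp Quant \<epsilon> (tensor_hom (vid Quant A) \<phi>) \<in> qmodule_homs (tensor A D) C"
    and "a \<in> carrier A \<Longrightarrow> d \<in> carrier D \<Longrightarrow>
      hmap (vcomp Quant \<epsilon> (tensor_hom (vid Quant A) \<phi>)) (tens A D a d) = hmap \<epsilon> (tens A E a (hmap \<phi> d))"
proof -
  have AD: "rquant A = lquant D" using AE qmodule_homsD'[OF \<phi>] by simp
  note t = tensor_hom[OF vid_Quant_closed[OF A] \<phi> AD]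
  show "vcomp Quant \<epsilon> (tensor_hom (vid Quant A) \<phi>) \<in> qmodule_homs (tensor A D) C"
    unfolding Quant_simps by (rule vcomp_Quant_closed[OF t(1) \<epsilon>])
  show "hmap (vcomp Quant \<epsilon> (tensor_hom (vid Quant A) \<phi>)) (tens A D a d) = hmap \<epsilon> (tens A E a (hmap \<phi> d))"
    if "a \<in> carrier A" "d \<in> carrier D"
    using that tens_closed[OF A qmodule_homsD'(1)[OF \<phi>] AD]
    by (simp add: hmap_vcomp_Quant[OF t(1)] t(2))
qed

lemma whisker_right:
  fixes A D E C :: "'u qmodule"
  assumes A: "is_qmodule A" and EA: "rquant E = lquant A"
    and \<epsilon>: "\<epsilon> \<in> qmodule_homs (tensor E A) C" and \<phi>: "\<phi> \<in> qmodule_homs D E"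
  shows "vcomp Quant \<epsilon> (tensor_hom \<phi> (vid Quant A)) \<in> qmodule_homs (tensor D A) C"
    and "a \<in> carrier A \<Longrightarrow> d \<in> carrier D \<Longrightarrow>
      hmap (vcomp Quant \<epsilon> (tensor_hom \<phi> (vid Quant A))) (tens D A d a) = hmap \<epsilon> (tens E A (hmap \<phi> d) a)"
proof -
  have DA: "rquant D = lquant A" using EA qmodule_homsD'[OF \<phi>] by simp
  note t = tensor_hom[OF \<phi> vid_Quant_closed[OF A] DA]
  show "vcomp Quant \<epsilon> (tensor_hom \<phi> (vid Quant A)) \<in> qmodule_homs (tensor D A) C"
    unfolding Quant_simps by (rule vcomp_Quant_closed[OF t(1) \<epsilon>])
  show "hmap (vcomp Quant \<epsilon> (tensor_hom \<phi> (vid Quant A))) (tens D A d a) = hmap \<epsilon> (tens E A (hmap \<phi> d) a)"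
    if "a \<in> carrier A" "d \<in> carrier D"
    using that tens_closed[OF qmodule_homsD'(1)[OF \<phi>] A DA]
    by (simp add: hmap_vcomp_Quant[OF t(1)] t(2))
qed

text \<open>A 2-cell out of the tensor of \<open>A\<close> and \<open>D\<close> is the same as a
  bilinear map, and by \<open>whisker_left\<close> the map required to be bijective becomes
  substitution into \<open>ev\<close>. Injectivity and surjectivity are uniqueness and existence in
  \<open>curries\<close>.\<close>

lemma curries_is_rext:
  fixes A C E :: "'u qmodule"
  assumes E: "curries A C E ev"
  obtains \<epsilon> where "Quant.is_rext A C E \<epsilon>"
proof -
  have ev: "bilin A E C ev" using E by (simp add: curries_def)
  note B = bilinD[OF ev]
  obtain \<epsilon> where \<epsilon>: "\<epsilon> \<in> qmodule_homs (tensor A E) C"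
    and \<epsilon>t: "\<And>a e. a \<in> carrier A \<Longrightarrow> e \<in> carrier E \<Longrightarrow> hmap \<epsilon> (tens A E a e) = ev a e"
    using ex1_tensor_hom[OF ev] by blast
  have "bij_betw (\<lambda>\<phi>. vcomp Quant \<epsilon> (tensor_hom (vid Quant A) \<phi>))
      (qmodule_homs D E) (qmodule_homs (tensor A D) C)"
    if D: "is_qmodule D" and AD: "rquant A = lquant D" for D
  proof (rule bij_betwI')
    let ?F = "\<lambda>\<phi>. vcomp Quant \<epsilon> (tensor_hom (vid Quant A) \<phi>)"
    note w = whisker_left[OF B(1,4) \<epsilon>]
    have Ft: "hmap (?F \<phi>) (tens A D a d) = ev a (hmap \<phi> d)"
      if "\<phi> \<in> qmodule_homs D E" "a \<in> carrier A" "d \<in> carrier D" for \<phi> a d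
      using w(2)[OF that] \<epsilon>t[OF that(2) hmap_closed[OF that(1,3)]] by simp
    show "?F \<phi> = ?F \<psi> \<longleftrightarrow> \<phi> = \<psi>"
      if \<phi>: "\<phi> \<in> qmodule_homs D E" and \<psi>: "\<psi> \<in> qmodule_homs D E" for \<phi> \<psi>
    proof
      assume eq: "?F \<phi> = ?F \<psi>"
      have "ev a (hmap \<phi> d) = ev a (hmap \<psi> d)" if "a \<in> carrier A" "d \<in> carrier D" for a d
        using Ft[OF \<phi> that] Ft[OF \<psi> that] eq by simp
      from curries_unique[OF E qmodule_homsD(1)[OF \<phi>] qmodule_homsD(1)[OF \<psi>] _ this]
      show "\<phi> = \<psi>" by (intro qmodule_homs_eqI[OF \<phi> \<psi>])
    qed simp
    show "?F \<phi> \<in> qmodule_homs (tensor A D) C" if "\<phi> \<in> qmodule_homs D E" for \<phi>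
      using w(1)[OF that] .
    fix \<gamma> assume \<gamma>: "\<gamma> \<in> qmodule_homs (tensor A D) C"
    have "bilin A D C (\<lambda>a d. hmap \<gamma> (tens A D a d))"
      by (rule bilin_comp[OF tensorD(5)[OF B(1) D AD] qmodule_homsD(1)[OF \<gamma>]])
    then obtain \<phi> where \<phi>: "lin D E \<phi>"
      and \<phi>\<gamma>: "\<forall>a \<in> carrier A. \<forall>d \<in> carrier D. ev a (\<phi> d) = hmap \<gamma> (tens A D a d)"
      using curries_ex[OF E] by blast
    then have \<phi>': "qhom_of D E \<phi> \<in> qmodule_homs D E" by simp
    have "\<gamma> = ?F (qhom_of D E \<phi>)"
      by (rule tensor_homs_eqI[OF B(1) D AD \<gamma> w(1)[OF \<phi>']]) (use Ft[OF \<phi>'] \<phi>\<gamma> in simp)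
    then show "\<exists>\<phi> \<in> qmodule_homs D E. \<gamma> = ?F \<phi>" using \<phi>' by blast
  qed
  then have "Quant.is_rext A C E \<epsilon>"
    using B \<epsilon> unfolding Quant.is_rext_def by simp
  then show ?thesis by (rule that)
qed

text \<open>The converse is needed because a chosen extension is an arbitrary module satisfying
  \<open>is_rext\<close>; this extracts a currying property from it, from which its elements can be
  identified.\<close>

lemma is_rext_curries:
  fixes A C E :: "'u qmodule"
  assumes A: "is_qmodule A" and E: "Quant.is_rext A C E \<epsilon>"
  shows "curries A C E (\<lambda>a e. hmap \<epsilon> (tens A E a e))"
proof -
  have E1: "is_qmodule E" "rquant A = lquant E" "rquant E = rquant C"
    and \<epsilon>: "\<epsilon> \<in> qmodule_homs (tensor A E) C"
    and bij: "\<And>D. is_qmodule D \<Longrightarrow> rquant A = lquant D \<Longrightarrow> rquant D = rquant C \<Longrightarrow>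
      bij_betw (\<lambda>\<phi>. vcomp Quant \<epsilon> (tensor_hom (vid Quant A) \<phi>))
        (qmodule_homs D E) (qmodule_homs (tensor A D) C)"
    using E unfolding Quant.is_rext_def by simp_all
  note w = whisker_left[OF A E1(2) \<epsilon>]
  show ?thesis
    unfolding curries_def
  proof (intro conjI allI impI)
    show "bilin A E C (\<lambda>a e. hmap \<epsilon> (tens A E a e))"
      by (rule bilin_comp[OF tensorD(5)[OF A E1(1,2)] qmodule_homsD(1)[OF \<epsilon>]])
  next
    fix D f assume f: "bilin A D C f"
    note B = bilinD[OF f]
    obtain \<gamma> where \<gamma>: "\<gamma> \<in> qmodule_homs (tensor A D) C"
      and \<gamma>f: "\<And>a d. a \<in> carrier A \<Longrightarrow> d \<in> carrier D \<Longrightarrow> hmap \<gamma> (tens A D a d) = f a d"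
      using ex1_tensor_hom[OF f] by blast
    have "\<gamma> \<in> (\<lambda>\<phi>. vcomp Quant \<epsilon> (tensor_hom (vid Quant A) \<phi>)) ` qmodule_homs D E"
      using bij_betw_imp_surj_on[OF bij[OF B(2,4) B(6)[symmetric]]] \<gamma> by simp
    then obtain \<phi> where \<phi>\<gamma>: "\<gamma> = vcomp Quant \<epsilon> (tensor_hom (vid Quant A) \<phi>)"
      and \<phi>: "\<phi> \<in> qmodule_homs D E" by (rule imageE)
    show "\<exists>\<phi>. lin D E \<phi> \<and> (\<forall>a \<in> carrier A. \<forall>d \<in> carrier D. hmap \<epsilon> (tens A E a (\<phi> d)) = f a d)"
      using w(2)[OF \<phi>] \<gamma>f qmodule_homsD(1)[OF \<phi>] unfolding \<phi>\<gamma>[symmetric]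
      by (intro exI[of _ "hmap \<phi>"]) simp
  next
    fix D \<phi> \<psi>
    assume \<phi>: "lin D E \<phi>" and \<psi>: "lin D E \<psi>"
      and eq: "\<forall>a \<in> carrier A. \<forall>d \<in> carrier D. hmap \<epsilon> (tens A E a (\<phi> d)) = hmap \<epsilon> (tens A E a (\<psi> d))"
    have \<phi>': "qhom_of D E \<phi> \<in> qmodule_homs D E" and \<psi>': "qhom_of D E \<psi> \<in> qmodule_homs D E"
      using \<phi> \<psi> by simp_all
    have D: "is_qmodule D" "rquant A = lquant D" "rquant D = rquant C" using linD(1-4)[OF \<phi>] E1 by simp_all
    have "vcomp Quant \<epsilon> (tensor_hom (vid Quant A) (qhom_of D E \<phi>))
        = vcomp Quant \<epsilon> (tensor_hom (vid Quant A) (qhom_of D E \<psi>))"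
      by (rule tensor_homs_eqI[OF A D(1,2) w(1)[OF \<phi>'] w(1)[OF \<psi>']])
        (use w(2)[OF \<phi>'] w(2)[OF \<psi>'] eq in simp)
    then have "qhom_of D E \<phi> = qhom_of D E \<psi>"
      using bij[OF D] \<phi>' \<psi>' unfolding bij_betw_def inj_on_def by blast
    then have "restrict \<phi> (carrier D) = restrict \<psi> (carrier D)" by (metis qhom_of_simps(3))
    then show "\<forall>d \<in> carrier D. \<phi> d = \<psi> d" by (metis restrict_apply')
  qed
qed

lemma rcurries_is_rlift:
  fixes A C E :: "'u qmodule"
  assumes E: "rcurries C A E ev"
  obtains \<epsilon> where "Quant.is_rlift C A E \<epsilon>"
proof -
  have ev: "bilin E A C ev" using E by (simp add: rcurries_def)
  note B = bilinD[OF ev]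
  obtain \<epsilon> where \<epsilon>: "\<epsilon> \<in> qmodule_homs (tensor E A) C"
    and \<epsilon>t: "\<And>e a. e \<in> carrier E \<Longrightarrow> a \<in> carrier A \<Longrightarrow> hmap \<epsilon> (tens E A e a) = ev e a"
    using ex1_tensor_hom[OF ev] by blast
  have "bij_betw (\<lambda>\<phi>. vcomp Quant \<epsilon> (tensor_hom \<phi> (vid Quant A)))
      (qmodule_homs D E) (qmodule_homs (tensor D A) C)"
    if D: "is_qmodule D" and DA: "rquant D = lquant A" for D
  proof (rule bij_betwI')
    let ?F = "\<lambda>\<phi>. vcomp Quant \<epsilon> (tensor_hom \<phi> (vid Quant A))"
    note w = whisker_right[OF B(2,4) \<epsilon>]
    have Ft: "hmap (?F \<phi>) (tens D A d a) = ev (hmap \<phi> d) a"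
      if "\<phi> \<in> qmodule_homs D E" "a \<in> carrier A" "d \<in> carrier D" for \<phi> a d
      using w(2)[OF that] \<epsilon>t[OF hmap_closed[OF that(1,3)] that(2)] by simp
    show "?F \<phi> = ?F \<psi> \<longleftrightarrow> \<phi> = \<psi>"
      if \<phi>: "\<phi> \<in> qmodule_homs D E" and \<psi>: "\<psi> \<in> qmodule_homs D E" for \<phi> \<psi>
    proof
      assume eq: "?F \<phi> = ?F \<psi>"
      have "ev (hmap \<phi> d) a = ev (hmap \<psi> d) a" if "a \<in> carrier A" "d \<in> carrier D" for a d
        using Ft[OF \<phi> that] Ft[OF \<psi> that] eq by simp
      from rcurries_unique[OF E qmodule_homsD(1)[OF \<phi>] qmodule_homsD(1)[OF \<psi>] _ this]
      show "\<phi> = \<psi>" by (intro qmodule_homs_eqI[OF \<phi> \<psi>])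
    qed simp
    show "?F \<phi> \<in> qmodule_homs (tensor D A) C" if "\<phi> \<in> qmodule_homs D E" for \<phi>
      using w(1)[OF that] .
    fix \<gamma> assume \<gamma>: "\<gamma> \<in> qmodule_homs (tensor D A) C"
    have "bilin D A C (\<lambda>d a. hmap \<gamma> (tens D A d a))"
      by (rule bilin_comp[OF tensorD(5)[OF D B(2) DA] qmodule_homsD(1)[OF \<gamma>]])
    then obtain \<phi> where \<phi>: "lin D E \<phi>"
      and \<phi>\<gamma>: "\<forall>a \<in> carrier A. \<forall>d \<in> carrier D. ev (\<phi> d) a = hmap \<gamma> (tens D A d a)"
      using rcurries_ex[OF E] by blast
    then have \<phi>': "qhom_of D E \<phi> \<in> qmodule_homs D E" by simp
    have "\<gamma> = ?F (qhom_of D E \<phi>)"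
      by (rule tensor_homs_eqI[OF D B(2) DA \<gamma> w(1)[OF \<phi>']]) (use Ft[OF \<phi>'] \<phi>\<gamma> in simp)
    then show "\<exists>\<phi> \<in> qmodule_homs D E. \<gamma> = ?F \<phi>" using \<phi>' by blast
  qed
  then have "Quant.is_rlift C A E \<epsilon>"
    using B \<epsilon> unfolding Quant.is_rlift_def by simp
  then show ?thesis by (rule that)
qed

lemma is_rlift_rcurries:
  fixes A C E :: "'u qmodule"
  assumes A: "is_qmodule A" and E: "Quant.is_rlift C A E \<epsilon>"
  shows "rcurries C A E (\<lambda>e a. hmap \<epsilon> (tens E A e a))"
proof -
  have E1: "is_qmodule E" "rquant E = lquant A" "lquant E = lquant C"
    and \<epsilon>: "\<epsilon> \<in> qmodule_homs (tensor E A) C"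
    and bij: "\<And>D. is_qmodule D \<Longrightarrow> rquant D = lquant A \<Longrightarrow> lquant D = lquant C \<Longrightarrow>
      bij_betw (\<lambda>\<phi>. vcomp Quant \<epsilon> (tensor_hom \<phi> (vid Quant A)))
        (qmodule_homs D E) (qmodule_homs (tensor D A) C)"
    using E unfolding Quant.is_rlift_def by simp_all
  note w = whisker_right[OF A E1(2) \<epsilon>]
  show ?thesis
    unfolding rcurries_def
  proof (intro conjI allI impI)
    show "bilin E A C (\<lambda>e a. hmap \<epsilon> (tens E A e a))"
      by (rule bilin_comp[OF tensorD(5)[OF E1(1) A E1(2)] qmodule_homsD(1)[OF \<epsilon>]])
  next
    fix D f assume f: "bilin D A C f"
    note B = bilinD[OF f]
    obtain \<gamma> where \<gamma>: "\<gamma> \<in> qmodule_homs (tensor D A) C"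
      and \<gamma>f: "\<And>d a. d \<in> carrier D \<Longrightarrow> a \<in> carrier A \<Longrightarrow> hmap \<gamma> (tens D A d a) = f d a"
      using ex1_tensor_hom[OF f] by blast
    have "\<gamma> \<in> (\<lambda>\<phi>. vcomp Quant \<epsilon> (tensor_hom \<phi> (vid Quant A))) ` qmodule_homs D E"
      using bij_betw_imp_surj_on[OF bij[OF B(1,4) B(5)[symmetric]]] \<gamma> by simp
    then obtain \<phi> where \<phi>\<gamma>: "\<gamma> = vcomp Quant \<epsilon> (tensor_hom \<phi> (vid Quant A))"
      and \<phi>: "\<phi> \<in> qmodule_homs D E" by (rule imageE)
    show "\<exists>\<phi>. lin D E \<phi> \<and> (\<forall>a \<in> carrier A. \<forall>d \<in> carrier D. hmap \<epsilon> (tens E A (\<phi> d) a) = f d a)"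
      using w(2)[OF \<phi>] \<gamma>f qmodule_homsD(1)[OF \<phi>] unfolding \<phi>\<gamma>[symmetric]
      by (intro exI[of _ "hmap \<phi>"]) simp
  next
    fix D \<phi> \<psi>
    assume \<phi>: "lin D E \<phi>" and \<psi>: "lin D E \<psi>"
      and eq: "\<forall>a \<in> carrier A. \<forall>d \<in> carrier D. hmap \<epsilon> (tens E A (\<phi> d) a) = hmap \<epsilon> (tens E A (\<psi> d) a)"
    have \<phi>': "qhom_of D E \<phi> \<in> qmodule_homs D E" and \<psi>': "qhom_of D E \<psi> \<in> qmodule_homs D E"
      using \<phi> \<psi> by simp_all
    have D: "is_qmodule D" "rquant D = lquant A" "lquant D = lquant C" using linD(1-4)[OF \<phi>] E1 by simp_all
    have "vcomp Quant \<epsilon> (tensor_hom (qhom_of D E \<phi>) (vid Quant A))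
        = vcomp Quant \<epsilon> (tensor_hom (qhom_of D E \<psi>) (vid Quant A))"
      by (rule tensor_homs_eqI[OF D(1) A D(2) w(1)[OF \<phi>'] w(1)[OF \<psi>']])
        (use w(2)[OF \<phi>'] w(2)[OF \<psi>'] eq in simp)
    then have "qhom_of D E \<phi> = qhom_of D E \<psi>"
      using bij[OF D] \<phi>' \<psi>' unfolding bij_betw_def inj_on_def by blast
    then have "restrict \<phi> (carrier D) = restrict \<psi> (carrier D)" by (metis qhom_of_simps(3))
    then show "\<forall>d \<in> carrier D. \<phi> d = \<psi> d" by (metis restrict_apply')
  qed
qed

lemma biclosed_bicategory_Quant:
  "biclosed_bicategory (Quant :: ('u quantale, 'u qmodule, 'u qmodule_hom) bicat)"
proof
  fix A C :: "'u qmodule"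
  assume *: "A \<in> cells1 Quant" "C \<in> cells1 Quant"
  then have A: "is_qmodule A" and C: "is_qmodule C" by simp_all
  show "\<exists>E \<epsilon>. Quant.is_rext A C E \<epsilon>" if "src Quant A = src Quant C"
  proof -
    obtain E ev where "lhom A C E ev" using lhom_exists[OF strong_limit A C] \<open>src Quant A = _\<close> by auto
    then show ?thesis using curries_is_rext[OF lhom_curries] by blast
  qed
  show "\<exists>E \<epsilon>. Quant.is_rlift C A E \<epsilon>" if "trg Quant A = trg Quant C"
  proof -
    \<comment> \<open>Left linear maps between opposites are the right linear maps from
      \<open>A\<close> to \<open>C\<close>, and these form the right lifting.\<close>
    obtain E ev where "lhom (opp_qmodule A) (opp_qmodule C) E ev"
      using lhom_exists[OF strong_limit, of "opp_qmodule A" "opp_qmodule C"] A C \<open>trg Quant A = _\<close> by auto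
    from curries_opp[OF lhom_curries[OF this]]
    have "rcurries C A (opp_qmodule E) (\<lambda>e a. ev a e)" by simp
    then show ?thesis by (rule rcurries_is_rlift) blast
  qed
qed

interpretation Quant: biclosed_bicategory "Quant :: ('u quantale, 'u qmodule, 'u qmodule_hom) bicat"
  by (rule biclosed_bicategory_Quant)


section \<open>Chosen extensions and liftings, transposes and contravariant actions\<close>

abbreviation rext_app :: "'u qmodule \<Rightarrow> 'u qmodule \<Rightarrow> 'u \<Rightarrow> 'u \<Rightarrow> 'u" where
  "rext_app A C a e \<equiv> hmap (Quant.rext_ev A C) (tens A (Quant.rext A C) a e)"

abbreviation rlift_app :: "'u qmodule \<Rightarrow> 'u qmodule \<Rightarrow> 'u \<Rightarrow> 'u \<Rightarrow> 'u" where
  "rlift_app C A e a \<equiv> hmap (Quant.rlift_ev C A) (tens (Quant.rlift C A) A e a)"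

lemma is_rext_rext:
  fixes A C :: "'u qmodule"
  assumes "is_qmodule A" "is_qmodule C" "lquant A = lquant C"
  shows "Quant.is_rext A C (Quant.rext A C) (Quant.rext_ev A C)"
proof -
  have "\<exists>p. case_prod (Quant.is_rext A C) p"
    using Quant.rext_exists[of A C] assms by auto
  then have "case_prod (Quant.is_rext A C) (SOME p. case_prod (Quant.is_rext A C) p)" by (rule someI_ex)
  then show ?thesis by (simp add: Quant.rext_def Quant.rext_ev_def case_prod_unfold)
qed

lemma is_rlift_rlift:
  fixes A C :: "'u qmodule"
  assumes "is_qmodule A" "is_qmodule C" "rquant A = rquant C"
  shows "Quant.is_rlift C A (Quant.rlift C A) (Quant.rlift_ev C A)"
proof -
  have "\<exists>p. case_prod (Quant.is_rlift C A) p"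
    using Quant.rlift_exists[of A C] assms by auto
  then have "case_prod (Quant.is_rlift C A) (SOME p. case_prod (Quant.is_rlift C A) p)" by (rule someI_ex)
  then show ?thesis by (simp add: Quant.rlift_def Quant.rlift_ev_def case_prod_unfold)
qed

lemma rext_ev_closed:
  fixes A C :: "'u qmodule"
  assumes "is_qmodule A" "is_qmodule C" "lquant A = lquant C"
  shows "is_qmodule (Quant.rext A C)" "lquant (Quant.rext A C) = rquant A"
    "rquant (Quant.rext A C) = rquant C"
    "Quant.rext_ev A C \<in> qmodule_homs (tensor A (Quant.rext A C)) C"
  using is_rext_rext[OF assms] by (simp_all add: Quant.is_rext_def)

lemma rlift_ev_closed:
  fixes A C :: "'u qmodule"
  assumes "is_qmodule A" "is_qmodule C" "rquant A = rquant C"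
  shows "is_qmodule (Quant.rlift C A)" "lquant (Quant.rlift C A) = lquant C"
    "rquant (Quant.rlift C A) = lquant A"
    "Quant.rlift_ev C A \<in> qmodule_homs (tensor (Quant.rlift C A) A) C"
  using is_rlift_rlift[OF assms] by (simp_all add: Quant.is_rlift_def)

text \<open>Bijectivity in \<open>is_rext\<close> makes the definite description meaningful;
  evaluating on pure tensors then yields the usual formula for a transpose.\<close>

lemma rext_transpose:
  fixes A C D :: "'u qmodule"
  assumes A: "is_qmodule A" and D: "is_qmodule D" and AD: "rquant A = lquant D"
    and \<gamma>: "\<gamma> \<in> qmodule_homs (tensor A D) C"
  shows "Quant.rext_transpose A C D \<gamma> \<in> qmodule_homs D (Quant.rext A C)"
    and "a \<in> carrier A \<Longrightarrow> d \<in> carrier D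
      \<Longrightarrow> rext_app A C a (hmap (Quant.rext_transpose A C D \<gamma>) d) = hmap \<gamma> (tens A D a d)"
proof -
  note T = tensorD[OF A D AD]
  have C: "is_qmodule C" and AC: "lquant A = lquant C" and DC: "rquant D = rquant C"
    using qmodule_homsD'[OF \<gamma>] T by simp_all
  note E = rext_ev_closed[OF A C AC]
  let ?P = "\<lambda>\<phi>. \<phi> \<in> hom2 Quant D (Quant.rext A C) \<and>
    vcomp Quant (Quant.rext_ev A C) (hcomp2 Quant (vid Quant A) \<phi>) = \<gamma>"
  have bij: "bij_betw (\<lambda>\<phi>. vcomp Quant (Quant.rext_ev A C) (hcomp2 Quant (vid Quant A) \<phi>))
      (hom2 Quant D (Quant.rext A C)) (hom2 Quant (hcomp1 Quant A D) C)"
    using is_rext_rext[OF A C AC] D AD DC unfolding Quant.is_rext_def by simp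
  have "\<exists>!\<phi>. ?P \<phi>"
    by (rule bij_betw_ex1[OF bij]) (use \<gamma> in simp)
  then have P: "?P (Quant.rext_transpose A C D \<gamma>)"
    unfolding Quant.rext_transpose_def by (rule theI')
  then show 1: "Quant.rext_transpose A C D \<gamma> \<in> qmodule_homs D (Quant.rext A C)" by simp
  show "rext_app A C a (hmap (Quant.rext_transpose A C D \<gamma>) d) = hmap \<gamma> (tens A D a d)"
    if "a \<in> carrier A" "d \<in> carrier D"
    using whisker_left(2)[OF A E(2)[symmetric] E(4) 1 that] P by simp
qed

lemma rlift_transpose:
  fixes A C D :: "'u qmodule"
  assumes A: "is_qmodule A" and D: "is_qmodule D" and DA: "rquant D = lquant A"
    and \<gamma>: "\<gamma> \<in> qmodule_homs (tensor D A) C"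
  shows "Quant.rlift_transpose C A D \<gamma> \<in> qmodule_homs D (Quant.rlift C A)"
    and "a \<in> carrier A \<Longrightarrow> d \<in> carrier D
      \<Longrightarrow> rlift_app C A (hmap (Quant.rlift_transpose C A D \<gamma>) d) a = hmap \<gamma> (tens D A d a)"
proof -
  note T = tensorD[OF D A DA]
  have C: "is_qmodule C" and AC: "rquant A = rquant C" and DC: "lquant D = lquant C"
    using qmodule_homsD'[OF \<gamma>] T by simp_all
  note E = rlift_ev_closed[OF A C AC]
  let ?P = "\<lambda>\<phi>. \<phi> \<in> hom2 Quant D (Quant.rlift C A) \<and>
    vcomp Quant (Quant.rlift_ev C A) (hcomp2 Quant \<phi> (vid Quant A)) = \<gamma>"
  have bij: "bij_betw (\<lambda>\<phi>. vcomp Quant (Quant.rlift_ev C A) (hcomp2 Quant \<phi> (vid Quant A)))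
      (hom2 Quant D (Quant.rlift C A)) (hom2 Quant (hcomp1 Quant D A) C)"
    using is_rlift_rlift[OF A C AC] D DA DC unfolding Quant.is_rlift_def by simp
  have "\<exists>!\<phi>. ?P \<phi>"
    by (rule bij_betw_ex1[OF bij]) (use \<gamma> in simp)
  then have P: "?P (Quant.rlift_transpose C A D \<gamma>)"
    unfolding Quant.rlift_transpose_def by (rule theI')
  then show 1: "Quant.rlift_transpose C A D \<gamma> \<in> qmodule_homs D (Quant.rlift C A)" by simp
  show "rlift_app C A (hmap (Quant.rlift_transpose C A D \<gamma>) d) a = hmap \<gamma> (tens D A d a)"
    if "a \<in> carrier A" "d \<in> carrier D"
    using whisker_right(2)[OF A E(3) E(4) 1 that] P by simp
qed

text \<open>Seen through evaluation, the contravariant action is precomposition with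
  \<open>\<alpha>\<close>.\<close>

lemma rext_map:
  fixes A A' C :: "'u qmodule"
  assumes \<alpha>: "\<alpha> \<in> qmodule_homs A A'" and C: "is_qmodule C" and AC: "lquant A = lquant C"
  shows "Quant.rext_map \<alpha> C \<in> qmodule_homs (Quant.rext A' C) (Quant.rext A C)"
    and "a \<in> carrier A \<Longrightarrow> e \<in> carrier (Quant.rext A' C)
      \<Longrightarrow> rext_app A C a (hmap (Quant.rext_map \<alpha> C) e) = rext_app A' C (hmap \<alpha> a) e"
proof -
  note A = qmodule_homsD'[OF \<alpha>]
  let ?E = "Quant.rext A' C"
  have AC': "lquant A' = lquant C" using A AC by simp
  note E = rext_ev_closed[OF A(2) C AC']
  have AE: "rquant A = lquant ?E" using E A by simp
  note t = tensor_hom[OF \<alpha> vid_Quant_closed[OF E(1)] AE]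
  note m = rext_transpose[OF A(1) E(1) AE vcomp_Quant_closed[OF t(1) E(4)]]
  have eq: "Quant.rext_map \<alpha> C = Quant.rext_transpose A C ?E
      (vcomp Quant (Quant.rext_ev A' C) (tensor_hom \<alpha> (qhom_of ?E ?E (\<lambda>a. a))))"
    using qmodule_homsD[OF \<alpha>] by (simp add: Quant.rext_map_def)
  show "Quant.rext_map \<alpha> C \<in> qmodule_homs ?E (Quant.rext A C)" unfolding eq by (rule m(1))
  show "rext_app A C a (hmap (Quant.rext_map \<alpha> C) e) = rext_app A' C (hmap \<alpha> a) e"
    if "a \<in> carrier A" "e \<in> carrier ?E"
    unfolding eq m(2)[OF that] hmap_vcomp_Quant[OF t(1) tens_closed[OF A(1) E(1) AE that]]
    using t(2)[of a e] that by simp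
qed

lemma rlift_map:
  fixes A A' C :: "'u qmodule"
  assumes \<alpha>: "\<alpha> \<in> qmodule_homs A A'" and C: "is_qmodule C" and AC: "rquant A = rquant C"
  shows "Quant.rlift_map C \<alpha> \<in> qmodule_homs (Quant.rlift C A') (Quant.rlift C A)"
    and "a \<in> carrier A \<Longrightarrow> e \<in> carrier (Quant.rlift C A')
      \<Longrightarrow> rlift_app C A (hmap (Quant.rlift_map C \<alpha>) e) a = rlift_app C A' e (hmap \<alpha> a)"
proof -
  note A = qmodule_homsD'[OF \<alpha>]
  let ?E = "Quant.rlift C A'"
  have AC': "rquant A' = rquant C" using A AC by simp
  note E = rlift_ev_closed[OF A(2) C AC']
  have EA: "rquant ?E = lquant A" using E A by simp
  note t = tensor_hom[OF vid_Quant_closed[OF E(1)] \<alpha> EA]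
  note m = rlift_transpose[OF A(1) E(1) EA vcomp_Quant_closed[OF t(1) E(4)]]
  have eq: "Quant.rlift_map C \<alpha> = Quant.rlift_transpose C A ?E
      (vcomp Quant (Quant.rlift_ev C A') (tensor_hom (qhom_of ?E ?E (\<lambda>a. a)) \<alpha>))"
    using qmodule_homsD[OF \<alpha>] by (simp add: Quant.rlift_map_def)
  show "Quant.rlift_map C \<alpha> \<in> qmodule_homs ?E (Quant.rlift C A)" unfolding eq by (rule m(1))
  show "rlift_app C A (hmap (Quant.rlift_map C \<alpha>) e) a = rlift_app C A' e (hmap \<alpha> a)"
    if "a \<in> carrier A" "e \<in> carrier ?E"
    unfolding eq m(2)[OF that] hmap_vcomp_Quant[OF t(1) tens_closed[OF E(1) A(1) EA that(2,1)]]
    using t(2)[of e a] that by simp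
qed

section \<open>Left and right duals and their pairings\<close>

abbreviation rdual :: "'u qmodule \<Rightarrow> 'u qmodule" where
  "rdual A \<equiv> Quant.rext A (dual_module (lquant A))"

abbreviation ldual :: "'u qmodule \<Rightarrow> 'u qmodule" where
  "ldual A \<equiv> Quant.rlift (dual_module (rquant A)) A"

text \<open>The comparison uses the order of the quantale, opposite to that of
  \<open>dual_module\<close>: it says that the functional assigned to \<open>a\<close> by
  \<open>e\<close> vanishes at the unit. As in \<open>lpair\<close>, the element of \<open>A\<close>
  comes first, so that the relations of both duals can be compared.\<close>

definition rpair :: "'u qmodule \<Rightarrow> 'u \<Rightarrow> 'u \<Rightarrow> bool" where
  "rpair A a e \<longleftrightarrow> qunit (lquant A) \<sqsubseteq>\<^bsub>lquant A\<^esub> rext_app A (dual_module (lquant A)) a e"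

definition lpair :: "'u qmodule \<Rightarrow> 'u \<Rightarrow> 'u \<Rightarrow> bool" where
  "lpair A a e \<longleftrightarrow> qunit (rquant A) \<sqsubseteq>\<^bsub>rquant A\<^esub> rlift_app (dual_module (rquant A)) A e a"

lemma rdual_closed:
  fixes A :: "'u qmodule"
  assumes A: "is_qmodule A"
  shows "is_qmodule (rdual A)" "lquant (rdual A) = rquant A" "rquant (rdual A) = lquant A"
    "Quant.rext_ev A (dual_module (lquant A)) \<in> qmodule_homs (tensor A (rdual A)) (dual_module (lquant A))"
  using rext_ev_closed[OF A is_qmodule_dual_module[OF qmoduleD(1)[OF A]]] by simp_all

lemma ldual_closed:
  fixes A :: "'u qmodule"
  assumes A: "is_qmodule A"
  shows "is_qmodule (ldual A)" "lquant (ldual A) = rquant A" "rquant (ldual A) = lquant A"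
    "Quant.rlift_ev (dual_module (rquant A)) A \<in> qmodule_homs (tensor (ldual A) A) (dual_module (rquant A))"
  using rlift_ev_closed[OF A is_qmodule_dual_module[OF qmoduleD(2)[OF A]]] by simp_all

text \<open>Being chosen as an extension, the dual curries; \<open>curries_lhom\<close> turns this
  into a description of its elements as left linear maps into the dualizing object, which pair
  perfectly with \<open>A\<close>.\<close>

lemma perfect_rdual:
  fixes A :: "'u qmodule"
  assumes A: "is_qmodule A"
  shows "perfect A (rdual A) (rpair A)"
proof -
  note D = is_qmodule_dual_module[OF qmoduleD(1)[OF A]]
  have "lhom A (dual_module (lquant A)) (rdual A) (rext_app A (dual_module (lquant A)))"
    by (rule curries_lhom[OF strong_limit is_rext_curries[OF A is_rext_rext[OF A D]]]) simp
  from lhom_dual_module_perfect[OF this] show ?thesis unfolding rpair_def .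
qed

text \<open>Passing to opposites makes the left dual a module of left linear maps, and
  \<open>dual_module_opp\<close> identifies the opposite of the dualizing object with the dualizing
  object of the opposite quantale. The perfect pairing obtained there returns by
  \<open>perfect_opp\<close>.\<close>

lemma perfect_ldual:
  fixes A :: "'u qmodule"
  assumes A: "is_qmodule A"
  shows "perfect A (ldual A) (lpair A)"
proof -
  note D = is_qmodule_dual_module[OF qmoduleD(2)[OF A]]
  have "rcurries (dual_module (rquant A)) A (ldual A) (rlift_app (dual_module (rquant A)) A)"
    by (rule is_rlift_rcurries[OF A is_rlift_rlift[OF A D]]) simp
  from curries_lhom[OF strong_limit rcurries_opp[OF this]]
  have "lhom (opp_qmodule A) (dual_module (lquant (opp_qmodule A))) (opp_qmodule (ldual A))
      (\<lambda>a e. rlift_app (dual_module (rquant A)) A e a)"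
    by (simp add: dual_module_opp)
  from perfect_opp[OF lhom_dual_module_perfect[OF this]] show ?thesis
    by (simp add: lpair_def[abs_def])
qed

text \<open>Transposing the evaluation exchanges the roles of its arguments: the image of
  \<open>a\<close> is evaluation at \<open>a\<close>. Both pairings read the same value in the same
  dualizing object.\<close>

lemma delta_r:
  fixes A :: "'u qmodule"
  assumes A: "is_qmodule A"
  shows "Quant.delta_r dual_module A \<in> qmodule_homs A (rdual (ldual A))"
    and "a \<in> carrier A \<Longrightarrow> e \<in> carrier (ldual A) \<Longrightarrow>
      rpair (ldual A) e (hmap (Quant.delta_r dual_module A) a) \<longleftrightarrow> lpair A a e"
proof -
  note E = ldual_closed[OF A]
  note t = rext_transpose[OF E(1) A E(3) E(4)]
  have eq: "Quant.delta_r dual_module A = Quant.rext_transpose (ldual A) (dual_module (rquant A)) A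
      (Quant.rlift_ev (dual_module (rquant A)) A)"
    by (simp add: Quant.delta_r_def)
  show "Quant.delta_r dual_module A \<in> qmodule_homs A (rdual (ldual A))"
    using t(1) unfolding eq E(2) .
  show "rpair (ldual A) e (hmap (Quant.delta_r dual_module A) a) \<longleftrightarrow> lpair A a e"
    if "a \<in> carrier A" "e \<in> carrier (ldual A)"
    unfolding rpair_def lpair_def eq E(2) t(2)[OF that(2,1)] ..
qed

lemma delta_l:
  fixes A :: "'u qmodule"
  assumes A: "is_qmodule A"
  shows "Quant.delta_l dual_module A \<in> qmodule_homs A (ldual (rdual A))"
    and "a \<in> carrier A \<Longrightarrow> e \<in> carrier (rdual A) \<Longrightarrow>
      lpair (rdual A) e (hmap (Quant.delta_l dual_module A) a) \<longleftrightarrow> rpair A a e"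
proof -
  note E = rdual_closed[OF A]
  note t = rlift_transpose[OF E(1) A E(2)[symmetric] E(4)]
  have eq: "Quant.delta_l dual_module A = Quant.rlift_transpose (dual_module (lquant A)) (rdual A) A
      (Quant.rext_ev A (dual_module (lquant A)))"
    by (simp add: Quant.delta_l_def)
  show "Quant.delta_l dual_module A \<in> qmodule_homs A (ldual (rdual A))"
    using t(1) unfolding eq E(3) .
  show "lpair (rdual A) e (hmap (Quant.delta_l dual_module A) a) \<longleftrightarrow> rpair A a e"
    if "a \<in> carrier A" "e \<in> carrier (rdual A)"
    unfolding rpair_def lpair_def eq E(3) t(2)[OF that(2,1)] ..
qed

text \<open>By \<open>perfect_sym\<close>, \<open>A\<close> pairs perfectly with its own left dual,
  and so does the right dual of that left dual. The canonical 2-cell respects the two pairings and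
  is therefore invertible by \<open>perfect_iso\<close>; the other one is treated
  symmetrically.\<close>

lemma dualizing_dual_module: "Quant.dualizing (dual_module :: 'u quantale \<Rightarrow> 'u qmodule)"
proof -
  have "Quant.delta_r dual_module A \<in> iso2 Quant A (rdual (ldual A))" if A: "is_qmodule A"
    for A :: "'u qmodule"
  proof (rule iso2_Quant_bij[OF delta_r(1)[OF A]])
    show "bij_betw (hmap (Quant.delta_r dual_module A)) (carrier A) (carrier (rdual (ldual A)))"
      by (rule perfect_iso(2)[OF perfect_rdual[OF ldual_closed(1)[OF A]] perfect_sym[OF perfect_ldual[OF A]]])
        (simp_all add: delta_r[OF A] hmap_closed[OF delta_r(1)[OF A]])
  qed
  moreover have "Quant.delta_l dual_module A \<in> iso2 Quant A (ldual (rdual A))" if A: "is_qmodule A"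
    for A :: "'u qmodule"
  proof (rule iso2_Quant_bij[OF delta_l(1)[OF A]])
    show "bij_betw (hmap (Quant.delta_l dual_module A)) (carrier A) (carrier (ldual (rdual A)))"
      by (rule perfect_iso(2)[OF perfect_ldual[OF rdual_closed(1)[OF A]] perfect_sym[OF perfect_rdual[OF A]]])
        (simp_all add: delta_l[OF A] hmap_closed[OF delta_l(1)[OF A]])
  qed
  ultimately show ?thesis
    by (simp add: Quant.dualizing_def is_qmodule_dual_module ldual_closed rdual_closed)
qed

text \<open>The chosen element exists by \<open>perfect_transport\<close> and is unique by
  separation, so the choice is harmless and only the pairing property is ever used.\<close>

definition theta :: "'u qmodule \<Rightarrow> 'u qmodule_hom" where
  "theta A = qhom_of (ldual A) (rdual A)
     (\<lambda>e. SOME e'. e' \<in> carrier (rdual A) \<and> (\<forall>a \<in> carrier A. rpair A a e' \<longleftrightarrow> lpair A a e))"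

lemma theta_iso:
  fixes A :: "'u qmodule"
  assumes A: "is_qmodule A"
  shows "theta A \<in> iso2 Quant (ldual A) (rdual A)"
    and "a \<in> carrier A \<Longrightarrow> e \<in> carrier (ldual A) \<Longrightarrow> rpair A a (hmap (theta A) e) \<longleftrightarrow> lpair A a e"
proof -
  note r = perfect_rdual[OF A] and l = perfect_ldual[OF A]
  have "hmap (theta A) e \<in> carrier (rdual A) \<and> (\<forall>a \<in> carrier A. rpair A a (hmap (theta A) e) \<longleftrightarrow> lpair A a e)"
    if e: "e \<in> carrier (ldual A)" for e
  proof -
    have "\<exists>e'. e' \<in> carrier (rdual A) \<and> (\<forall>a \<in> carrier A. rpair A a e' \<longleftrightarrow> lpair A a e)"
      using perfect_transport[OF r l e] by blast
    from someI_ex[OF this] show ?thesis using e by (simp add: theta_def)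
  qed
  then have \<theta>: "\<And>e. e \<in> carrier (ldual A) \<Longrightarrow> hmap (theta A) e \<in> carrier (rdual A)"
    and *: "\<And>a e. a \<in> carrier A \<Longrightarrow> e \<in> carrier (ldual A) \<Longrightarrow> rpair A a (hmap (theta A) e) \<longleftrightarrow> lpair A a e"
    by blast+
  note iso = perfect_iso[OF r l \<theta> *]
  have "hdom (theta A) = ldual A" "hcod (theta A) = rdual A"
    "hmap (theta A) \<in> extensional (carrier (ldual A))"
    by (simp_all add: theta_def)
  then have "theta A \<in> qmodule_homs (ldual A) (rdual A)"
    using iso(1) by (simp add: qmodule_homs_def is_qmodule_hom_iff_lin)
  then show "theta A \<in> iso2 Quant (ldual A) (rdual A)" using iso(2) by (rule iso2_Quant_bij)
  show "rpair A a (hmap (theta A) e) \<longleftrightarrow> lpair A a e" if "a \<in> carrier A" "e \<in> carrier (ldual A)"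
    using *[OF that] .
qed

lemma theta_closed:
  fixes A :: "'u qmodule"
  shows "is_qmodule A \<Longrightarrow> theta A \<in> qmodule_homs (ldual A) (rdual A)"
  using theta_iso(1) by (auto simp: iso2_def)

text \<open>Pair both sides with \<open>a\<close>. The maps induced by \<open>\<alpha>\<close> move
  it onto \<open>a\<close> and the components of \<open>theta\<close> exchange \<open>lpair\<close>
  and \<open>rpair\<close>, so both sides reduce to pairing the image of \<open>a\<close> with
  \<open>e\<close>.\<close>

lemma theta_natural:
  fixes A A' :: "'u qmodule"
  assumes \<alpha>: "\<alpha> \<in> qmodule_homs A A'"
  shows "vcomp Quant (theta A) (Quant.rlift_map (dual_module (rquant A)) \<alpha>)
    = vcomp Quant (Quant.rext_map \<alpha> (dual_module (lquant A))) (theta A')"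
proof -
  note A = qmodule_homsD'[OF \<alpha>]
  note l = rlift_map[OF \<alpha> is_qmodule_dual_module[OF qmoduleD(2)[OF A(1)]] dual_module_simps(5)[symmetric]]
  note r = rext_map[OF \<alpha> is_qmodule_dual_module[OF qmoduleD(1)[OF A(1)]] dual_module_simps(4)[symmetric]]
  note \<theta> = theta_closed[OF A(1)] and \<theta>' = theta_closed[OF A(2)]
  have l1: "Quant.rlift_map (dual_module (rquant A)) \<alpha> \<in> qmodule_homs (ldual A') (ldual A)"
    using l(1) A(4) by simp
  have r1: "Quant.rext_map \<alpha> (dual_module (lquant A)) \<in> qmodule_homs (rdual A') (rdual A)"
    using r(1) A(3) by simp
  note m = vcomp_Quant_closed[OF l1 \<theta>] and n = vcomp_Quant_closed[OF \<theta>' r1]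
  show ?thesis
  proof (rule qmodule_homs_eqI[OF m n])
    fix e assume e: "e \<in> carrier (ldual A')"
    show "hmap (vcomp Quant (theta A) (Quant.rlift_map (dual_module (rquant A)) \<alpha>)) e
      = hmap (vcomp Quant (Quant.rext_map \<alpha> (dual_module (lquant A))) (theta A')) e"
    proof (rule perfect_eqI[OF perfect_rdual[OF A(1)] hmap_closed[OF m e] hmap_closed[OF n e]])
      fix a assume a: "a \<in> carrier A"
      have "rpair A a (hmap (vcomp Quant (theta A) (Quant.rlift_map (dual_module (rquant A)) \<alpha>)) e)
          \<longleftrightarrow> lpair A a (hmap (Quant.rlift_map (dual_module (rquant A)) \<alpha>) e)"
        using theta_iso(2)[OF A(1) a hmap_closed[OF l1 e]] by (simp add: hmap_vcomp_Quant[OF l1 e])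
      also have "\<dots> \<longleftrightarrow> lpair A' (hmap \<alpha> a) e"
        using l(2)[OF a] e A(4) by (simp add: lpair_def)
      also have "\<dots> \<longleftrightarrow> rpair A' (hmap \<alpha> a) (hmap (theta A') e)"
        using theta_iso(2)[OF A(2) hmap_closed[OF \<alpha> a] e] by simp
      also have "\<dots> \<longleftrightarrow> rpair A a (hmap (Quant.rext_map \<alpha> (dual_module (lquant A))) (hmap (theta A') e))"
        using r(2)[OF a] hmap_closed[OF \<theta>' e] A(3) by (simp add: rpair_def)
      finally show "rpair A a (hmap (vcomp Quant (theta A) (Quant.rlift_map (dual_module (rquant A)) \<alpha>)) e)
          \<longleftrightarrow> rpair A a (hmap (vcomp Quant (Quant.rext_map \<alpha> (dual_module (lquant A))) (theta A')) e)"
        by (simp add: hmap_vcomp_Quant[OF \<theta>' e])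
    qed
  qed
qed

text \<open>Both sides send \<open>a\<close> to the element whose pairing with \<open>e \<in> ldual A\<close> is \<open>lpair A a e\<close>.\<close>

lemma theta_cyclic:
  fixes A :: "'u qmodule"
  assumes A: "is_qmodule A"
  shows "vcomp Quant (theta (ldual A))
      (vcomp Quant (Quant.rlift_map (dual_module (lquant A)) (theta A)) (Quant.delta_l dual_module A))
    = Quant.delta_r dual_module A"
proof -
  note L = ldual_closed[OF A] and R = rdual_closed[OF A]
  note \<theta> = theta_closed[OF A] and \<theta>' = theta_closed[OF L(1)]
  note d = delta_l[OF A] and d' = delta_r[OF A]
  note l = rlift_map[OF \<theta> is_qmodule_dual_module[OF qmoduleD(1)[OF A]]]
  let ?m = "Quant.rlift_map (dual_module (lquant A)) (theta A)"
  have m1: "?m \<in> qmodule_homs (ldual (rdual A)) (ldual (ldual A))"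
    using l(1) L R by simp
  have m2: "lpair (ldual A) e (hmap ?m x) \<longleftrightarrow> lpair (rdual A) (hmap (theta A) e) x"
    if "e \<in> carrier (ldual A)" "x \<in> carrier (ldual (rdual A))" for e x
    using l(2)[OF _ that(1)] that L R by (simp add: lpair_def)
  note f = vcomp_Quant_closed[OF d(1) m1]
  note g = vcomp_Quant_closed[OF f \<theta>']
  show ?thesis
  proof (rule qmodule_homs_eqI[OF g d'(1)])
    fix a assume a: "a \<in> carrier A"
    let ?x = "hmap (Quant.delta_l dual_module A) a"
    note x = hmap_closed[OF d(1) a]
    show "hmap (vcomp Quant (theta (ldual A)) (vcomp Quant ?m (Quant.delta_l dual_module A))) a
        = hmap (Quant.delta_r dual_module A) a"
    proof (rule perfect_eqI[OF perfect_rdual[OF L(1)] hmap_closed[OF g a] hmap_closed[OF d'(1) a]])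
      fix e assume e: "e \<in> carrier (ldual A)"
      have "rpair (ldual A) e (hmap (theta (ldual A)) (hmap ?m ?x)) \<longleftrightarrow> lpair (ldual A) e (hmap ?m ?x)"
        by (rule theta_iso(2)[OF L(1) e hmap_closed[OF m1 x]])
      also have "\<dots> \<longleftrightarrow> lpair (rdual A) (hmap (theta A) e) ?x" by (rule m2[OF e x])
      also have "\<dots> \<longleftrightarrow> rpair A a (hmap (theta A) e)" by (rule d(2)[OF a hmap_closed[OF \<theta> e]])
      also have "\<dots> \<longleftrightarrow> lpair A a e" by (rule theta_iso(2)[OF A a e])
      also have "\<dots> \<longleftrightarrow> rpair (ldual A) e (hmap (Quant.delta_r dual_module A) a)"
        using d'(2)[OF a e] by simp
      finally show "rpair (ldual A) e
          (hmap (vcomp Quant (theta (ldual A)) (vcomp Quant ?m (Quant.delta_l dual_module A))) a)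
          \<longleftrightarrow> rpair (ldual A) e (hmap (Quant.delta_r dual_module A) a)"
        by (simp add: hmap_vcomp_Quant[OF f a] hmap_vcomp_Quant[OF d(1) a])
    qed
  qed
qed

lemma cyclic_dualizing_dual_module: "Quant.cyclic_dualizing (dual_module :: 'u quantale \<Rightarrow> 'u qmodule)"
  unfolding Quant.cyclic_dualizing_def
proof (intro conjI dualizing_dual_module exI[of _ theta] ballI)
  fix A :: "'u qmodule" assume "A \<in> cells1 Quant"
  then have A: "is_qmodule A" by simp
  show "theta A \<in> iso2 Quant (Quant.rlift (dual_module (trg Quant A)) A)
      (Quant.rext A (dual_module (src Quant A)))"
    using theta_iso(1)[OF A] by simp
  show "vcomp Quant (theta (Quant.rlift (dual_module (trg Quant A)) A))
      (vcomp Quant (Quant.rlift_map (dual_module (src Quant A)) (theta A)) (Quant.delta_l dual_module A))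
    = Quant.delta_r dual_module A"
    using theta_cyclic[OF A] by simp
next
  fix A A' :: "'u qmodule" and \<alpha>
  assume "\<alpha> \<in> hom2 Quant A A'"
  then show "vcomp Quant (theta A) (Quant.rlift_map (dual_module (trg Quant A)) \<alpha>)
    = vcomp Quant (Quant.rext_map \<alpha> (dual_module (src Quant A))) (theta A')"
    using theta_natural by simp
qed

lemma cyclic_star_autonomous_Quant:
  "cyclic_star_autonomous_bicategory (Quant :: ('u quantale, 'u qmodule, 'u qmodule_hom) bicat)"
  by unfold_locales (use cyclic_dualizing_dual_module in blast)

end

theorem theorem7p8:
  assumes "strong_limit_type TYPE('u)"
  shows "cyclic_star_autonomous_bicategory
           (Quant :: ('u quantale, 'u qmodule, 'u qmodule_hom) bicat)"
  using assms by (rule cyclic_star_autonomous_Quant)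

end
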